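(* Let $f:\mathbb{P}^1\to\mathbb{P}^1$ be a rational map over $\mathbb{C}$ of degree $d>1$ for which there exist an integer $k\ge 1$, a constant $\lambda\in\mathbb{C}^*$ and a nonzero global meromorphic section $q$ of $\Omega_{\mathbb{P}^1}^{\otimes k}$ with $f^*q=\lambda q$. Then, up to conjugation by an element of $PGL_2(\mathbb{C})$, $f$ is induced by an automorphism $L$ of $\mathbb{C}$, i.e. $f$ is obtained as the quotient of $L$ under the action of a discrete group $\Gamma$ of automorphisms of the complex plane, where the orbifold preserved by $f$, the group $\Gamma$ and the map $L$ are given by one of the following cases (with $\zeta=e^{2\pi i/3}$): (1) orbifold $(\infty,\infty)$, $\Gamma=\mathbb{Z}$ acting by translations, $L(z)=nz$ with $n\in\mathbb{Z}$, $|n|>1$; (2) orbifold $(2,2,\infty)$, $\Gamma=\langle \mathbb{Z},\, z\mapsto -z\rangle$, $L(z)=nz+\beta$ with $n\in\mathbb{Z}$, $|n|>1$, and $\beta\in\{0,\tfrac12\}$; (3) orbifold $(2,2,2,2)$, $\Gamma=\langle \mathbb{Z}\oplus\mathbb{Z}\tau,\, z\mapsto -z\rangle$ for some $\tau$ with $\operatorname{Im}\tau>0$, $L(z)=\alpha z+\beta$ with $\alpha$ an algebraic integer in an imaginary quadratic field (ordinary integers allowed) and $\beta$ representing a point of the $2$-torsion subgroup $E[2]$ of $E=\mathbb{C}/(\mathbb{Z}\oplus\mathbb{Z}\tau)$; (4) orbifold $(3,3,3)$, $\Gamma=\langle \mathbb{Z}[\zeta],\, z\mapsto \zeta z\rangle$,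 $L(z)=\alpha z+\beta$ with $\alpha\in\mathbb{Z}[\zeta]$ and $\beta\in\{0,\tfrac13(\zeta+2),\tfrac13 i\sqrt3\}$; (5) orbifold $(2,4,4)$, $\Gamma=\langle \mathbb{Z}[i],\, z\mapsto iz\rangle$, $L(z)=\alpha z+\beta$ with $\alpha\in\mathbb{Z}[i]$ and $\beta\in\{0,\tfrac12(i+1)\}$; (6) orbifold $(2,3,6)$, $\Gamma=\langle \mathbb{Z}[\zeta],\, z\mapsto -\zeta z\rangle$, $L(z)=\alpha z$ with $\alpha\in\mathbb{Z}[\zeta]$.
   Context: $\Omega_{\mathbb{P}^1}$ is the sheaf of holomorphic differential forms on $\mathbb{P}^1$; a meromorphic section of $\Omega_{\mathbb{P}^1}^{\otimes k}$ is locally $q(z)\,dz^k$ with $q(z)$ meromorphic, and $f^*(q(z)dz^k)=q(f(z))f'(z)^k\,dz^k$. An orbifold structure on $\mathbb{P}^1$ is a weight function $\nu:\mathbb{P}^1\to\{1,2,3,\dots\}\cup\{\infty\}$ equal to $1$ outside a finite set; it is denoted by the list of its weights different from $1$ (e.g. $(2,4,4)$), and $D$ denotes the set of points of weight $\infty$ (the boundary). Let $P_f=\bigcup_{n>0}f^n(\mathrm{Ram}_f)$ be the post-critical set of $f$. The map $f$ preserves the orbifold $(\mathbb{P}^1,\nu)$ if $\nu(x)=1$ for $x\notin P_f$, and for every $x\in\mathbb{P}^1$ and every $y\in f^{-1}(x)$, $\nu(x)$ divides $\nu(y)\deg_y(f)$, where $\deg_y(f)$ is the local degree (with the conventions $\infty\cdot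 m=\infty$, everything divides $\infty$, and $\infty$ divides only $\infty$). In each case, $\Gamma$ acts on $\mathbb{C}$ with quotient (as orbifold) the complement of the boundary $D$ in the given orbifold on $\mathbb{P}^1$: there is a holomorphic map $\Theta:\mathbb{C}\to\mathbb{P}^1$ with image $\mathbb{P}^1\setminus D$, with $\Theta(z)=\Theta(w)$ iff $w\in\Gamma z$, and such that the stabilizer in $\Gamma$ of $z$ has order $\nu(\Theta(z))$. "$f$ is induced by $L$" (or "is obtained as quotient of $L$ under $\Gamma$") means $f\circ\Theta=\Theta\circ L$; in particular $L$ must descend to the quotient by $\Gamma$. "Automorphism of $\mathbb{C}$" means an affine map $z\mapsto \alpha z+\beta$ with $\alpha\neq0$. *)

theory Defs
  imports
    "HOL-Complex_Analysis.Complex_Analysis"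
    "HOL-Algebra.Generated_Groups"
    "HOL-Library.Extended_Nat"
    "HOL-Library.Multiset"
begin

section \<open>The projective line\<close>

datatype P1 = Fin complex | Infty

text \<open>
  The two standard affine coordinates. The value of \<open>coord\<close> at \<open>Infty\<close>, and that of
  \<open>coord_inf\<close> at \<open>Fin 0\<close>, is a dummy: these points lie outside the respective chart.
\<close>

fun coord :: "P1 \<Rightarrow> complex" where
  "coord (Fin z) = z"
| "coord Infty = 0"

fun coord_inf :: "P1 \<Rightarrow> complex" where
  "coord_inf (Fin z) = 1 / z"
| "coord_inf Infty = 0"

text \<open>
  Since \<open>coord\<close> and \<open>coord_inf\<close> have dummy values, the map has to stay inside the chart near the
  point in question (this is where continuity enters).
\<close>

definition holomorphic_to_P1 :: "(complex \<Rightarrow> P1) \<Rightarrow> bool" where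
  "holomorphic_to_P1 \<Theta> \<longleftrightarrow>
     (\<forall>z. ((\<forall>\<^sub>F w in nhds z. \<Theta> w \<noteq> Infty) \<and> (\<lambda>w. coord (\<Theta> w)) analytic_on {z}) \<or>
          ((\<forall>\<^sub>F w in nhds z. \<Theta> w \<noteq> Fin 0) \<and> (\<lambda>w. coord_inf (\<Theta> w)) analytic_on {z}))"

text \<open>
  The map induced by \<open>p/q\<close>, for coprime \<open>p\<close> and \<open>q\<close>; its value at infinity is read off
  from the homogenizations of \<open>p\<close> and \<open>q\<close> in degree \<open>max (degree p) (degree q)\<close>.
\<close>

definition rat_map :: "complex poly \<Rightarrow> complex poly \<Rightarrow> P1 \<Rightarrow> P1" where
  "rat_map p q x =
     (case x of
        Fin z \<Rightarrow> if poly q z = 0 then Infty else Fin (poly p z / poly q z)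
      | Infty \<Rightarrow> (let n = max (degree p) (degree q) in
                  if coeff q n = 0 then Infty else Fin (coeff p n / coeff q n)))"

definition rational_map_of_degree :: "(P1 \<Rightarrow> P1) \<Rightarrow> nat \<Rightarrow> bool" where
  "rational_map_of_degree f d \<longleftrightarrow>
     (\<exists>p q. coprime p q \<and> d = max (degree p) (degree q) \<and> f = rat_map p q)"

text \<open>The elements of \<open>PGL_2(C)\<close>, as the maps sending \<open>z\<close> to \<open>(a z + b) / (c z + d)\<close>.\<close>

definition PGL2 :: "(P1 \<Rightarrow> P1) set" where
  "PGL2 = {rat_map [:b, a:] [:d, c:] | a b c d. a * d - b * c \<noteq> 0}"

fun local_param :: "P1 \<Rightarrow> complex \<Rightarrow> P1" where
  "local_param (Fin a) t = Fin (a + t)"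
| "local_param Infty t = (if t = 0 then Infty else Fin (1 / t))"

fun local_coord :: "P1 \<Rightarrow> P1 \<Rightarrow> complex" where
  "local_coord (Fin b) x = coord x - b"
| "local_coord Infty x = coord_inf x"

text \<open>
  The local degree at \<open>y\<close> of a nonconstant rational map: the order of vanishing at \<open>y\<close> of a local
  coordinate centred at \<open>f y\<close>, composed with \<open>f\<close>.
\<close>

definition local_degree :: "(P1 \<Rightarrow> P1) \<Rightarrow> P1 \<Rightarrow> nat" where
  "local_degree f y = nat (zorder (\<lambda>t. local_coord (f y) (f (local_param y t))) 0)"

definition ramification :: "(P1 \<Rightarrow> P1) \<Rightarrow> P1 set" where
  "ramification f = {y. local_degree f y > 1}"

definition postcritical :: "(P1 \<Rightarrow> P1) \<Rightarrow> P1 set" where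
  "postcritical f = (\<Union>n\<in>{0<..}. (f ^^ n) ` ramification f)"


section \<open>Meromorphic sections of powers of the sheaf of differentials\<close>

text \<open>
  A global meromorphic section of the \<open>k\<close>-th tensor power is represented by its expression
  \<open>q(z) dz^k\<close> in the chart \<open>coord\<close>. In the coordinate \<open>w = 1/z\<close> at infinity it becomes
  \<open>q(1/w) (-1/w^2)^k dw^k\<close>, which has to be meromorphic as well. As usual for \<open>meromorphic_on\<close>,
  values at isolated points are irrelevant, so sections are compared off a sparse set.
\<close>

definition meromorphic_section :: "nat \<Rightarrow> (complex \<Rightarrow> complex) \<Rightarrow> bool" where
  "meromorphic_section k q \<longleftrightarrow>
     q meromorphic_on UNIV \<and> (\<lambda>w. q (1 / w) * (- 1 / w ^ 2) ^ k) meromorphic_on UNIV"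

definition section_eq :: "(complex \<Rightarrow> complex) \<Rightarrow> (complex \<Rightarrow> complex) \<Rightarrow> bool" where
  "section_eq q r \<longleftrightarrow> (\<forall>\<^sub>\<approx>z. q z = r z)"

text \<open>\<open>q(f(z)) f'(z)^k\<close>, for a nonconstant rational map \<open>f\<close>; the finitely many poles of \<open>f\<close> in the
  plane are immaterial.\<close>

definition pullback :: "nat \<Rightarrow> (P1 \<Rightarrow> P1) \<Rightarrow> (complex \<Rightarrow> complex) \<Rightarrow> complex \<Rightarrow> complex" where
  "pullback k f q z = q (coord (f (Fin z))) * deriv (\<lambda>w. coord (f (Fin w))) z ^ k"


section \<open>Orbifold structures\<close>

definition orbifold :: "(P1 \<Rightarrow> enat) \<Rightarrow> bool" where
  "orbifold \<nu> \<longleftrightarrow> (\<forall>x. \<nu> x \<ge> 1) \<and> finite {x. \<nu> x \<noteq> 1}"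

definition weights :: "(P1 \<Rightarrow> enat) \<Rightarrow> enat multiset" where
  "weights \<nu> = image_mset \<nu> (mset_set {x. \<nu> x \<noteq> 1})"

definition boundary_points :: "(P1 \<Rightarrow> enat) \<Rightarrow> P1 set" where
  "boundary_points \<nu> = {x. \<nu> x = \<infinity>}"

text \<open>
  On nonzero elements, multiplication and divisibility in \<open>enat\<close> obey the conventions for weights:
  \<open>\<infinity> * m = \<infinity>\<close>, everything divides \<open>\<infinity>\<close>, and \<open>\<infinity>\<close> divides only \<open>\<infinity>\<close>.
\<close>

definition preserves_orbifold :: "(P1 \<Rightarrow> P1) \<Rightarrow> (P1 \<Rightarrow> enat) \<Rightarrow> bool" where
  "preserves_orbifold f \<nu> \<longleftrightarrow>
     orbifold \<nu> \<and> (\<forall>x. x \<notin> postcritical f \<longrightarrow> \<nu> x = 1) \<and>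
     (\<forall>x. \<forall>y \<in> f -` {x}. \<nu> x dvd \<nu> y * enat (local_degree f y))"


section \<open>Groups of automorphisms of the complex plane\<close>

definition AutC :: "(complex \<Rightarrow> complex) monoid" where
  "AutC = \<lparr>carrier = {(\<lambda>z. \<alpha> * z + \<beta>) | \<alpha> \<beta>. \<alpha> \<noteq> 0}, mult = (\<circ>), one = id\<rparr>"

text \<open>
  The map \<open>\<alpha> z + \<beta>\<close> is identified with the pair \<open>(\<alpha>, \<beta>)\<close>, which gives \<open>AutC\<close> its topology.
\<close>

definition discrete_group :: "(complex \<Rightarrow> complex) set \<Rightarrow> bool" where
  "discrete_group \<Gamma> \<longleftrightarrow> subgroup \<Gamma> AutC \<and> discrete ((\<lambda>\<gamma>. (\<gamma> 1 - \<gamma> 0, \<gamma> 0)) ` \<Gamma>)"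

text \<open>
  \<open>\<Theta>\<close> exhibits the complement of the boundary as the orbifold quotient of the plane by \<open>\<Gamma>\<close>.
  As weights are nonzero while infinite sets have \<open>card\<close> zero, the last condition forces
  stabilizers to be finite.
\<close>

definition orbifold_quotient_map ::
    "(complex \<Rightarrow> complex) set \<Rightarrow> (P1 \<Rightarrow> enat) \<Rightarrow> (complex \<Rightarrow> P1) \<Rightarrow> bool" where
  "orbifold_quotient_map \<Gamma> \<nu> \<Theta> \<longleftrightarrow>
     holomorphic_to_P1 \<Theta> \<and>
     range \<Theta> = UNIV - boundary_points \<nu> \<and>
     (\<forall>z w. \<Theta> z = \<Theta> w \<longleftrightarrow> (\<exists>\<gamma>\<in>\<Gamma>. w = \<gamma> z)) \<and>
     (\<forall>z. enat (card {\<gamma>\<in>\<Gamma>. \<gamma> z = z}) = \<nu> (\<Theta> z))"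

definition induced_by ::
    "(P1 \<Rightarrow> P1) \<Rightarrow> (P1 \<Rightarrow> enat) \<Rightarrow> (complex \<Rightarrow> complex) set \<Rightarrow> (complex \<Rightarrow> complex) \<Rightarrow> bool" where
  "induced_by f \<nu> \<Gamma> L \<longleftrightarrow>
     discrete_group \<Gamma> \<and> L \<in> carrier AutC \<and>
     (\<exists>\<Theta>. orbifold_quotient_map \<Gamma> \<nu> \<Theta> \<and> f \<circ> \<Theta> = \<Theta> \<circ> L)"

text \<open>
  \<open>Z + Z \<tau>\<close>. This is the ring \<open>Z[\<tau>]\<close> for \<open>\<tau> = \<i>\<close> and for \<open>\<tau> = \<zeta>\<close>.
\<close>

definition plane_lattice :: "complex \<Rightarrow> complex set" where
  "plane_lattice \<tau> = {of_int m + of_int n * \<tau> | m n :: int. True}"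

definition translations_by :: "complex set \<Rightarrow> (complex \<Rightarrow> complex) set" where
  "translations_by A = {(\<lambda>z. z + a) | a. a \<in> A}"

definition zeta :: complex ("\<zeta>") where
  "\<zeta> = exp (2 * of_real pi * \<i> / 3)"

definition imaginary_quadratic_field :: "complex set \<Rightarrow> bool" where
  "imaginary_quadratic_field K \<longleftrightarrow>
     (\<exists>D::nat. D > 0 \<and> K = {of_rat a + of_rat b * (\<i> * of_real (sqrt (real D))) | a b :: rat. True})"

end

theory Submission
  imports Defs "HOL-Computational_Algebra.Fundamental_Theorem_Algebra"
begin

text \<open>
  Write \<open>q\<close> for the section and let \<open>ord x\<close> be its order at a point \<open>x\<close> of the projective line. The
  equation \<open>f^*q = c q\<close> says that the integers \<open>b x = ord x + k\<close> satisfy \<open>b y = e_y b(f y)\<close>, where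
  \<open>e_y\<close> is the local degree (\<open>b_multiplicative\<close>). Only finitely many points have \<open>b x \<noteq> k\<close>, while a
  nonempty finite set cannot contain its preimage under \<open>f\<close> with all the preimages unramified
  (\<open>no_unramified_backward_invariant\<close>). Applied to suitable level sets of \<open>b\<close>, this gives
  \<open>0 \<le> b x \<le> k\<close>, that \<open>b x\<close> divides \<open>k\<close> unless it vanishes, and \<open>b x = k\<close> off the post-critical set.
  Hence \<open>\<nu> = k / b\<close>, with \<open>\<nu> = \<infinity>\<close> where \<open>b\<close> vanishes, is an orbifold structure preserved by \<open>f\<close>.
  As the divisor of \<open>q\<close> has degree \<open>-2k\<close>, its weights satisfy \<open>\<Sum>(1 - 1/\<nu>) = 2\<close>
  (\<open>degree_formula\<close>, \<open>weights_sum\<close>).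

  The uniformization comes from a fixed point. The sum of \<open>1/(1 - \<mu>)\<close> over the fixed points of \<open>f\<close>,
  \<open>\<mu>\<close> being the multiplier, equals \<open>1\<close> when no multiplier is \<open>1\<close>; so some multiplier is \<open>1\<close> or lies
  outside the closed unit disc. Such a fixed point has finite weight, since the points of infinite
  weight are superattracting. At a point of finite weight \<open>n\<close>, a substitution \<open>t = W(z)^n\<close> in the local
  coordinate \<open>t\<close> turns \<open>q\<close> into \<open>dz^k\<close> (\<open>exists_normal_form\<close>). In the coordinate \<open>z\<close> the map \<open>f\<close>
  preserves \<open>dz^k\<close> up to the factor \<open>c\<close>, so it becomes \<open>z \<mapsto> \<alpha> z\<close> with \<open>\<alpha>^n = \<mu>\<close>, and \<open>\<alpha>\<close>
  lies outside the closed unit disc because \<open>f\<close> is not the identity. Therefore \<open>f(\<Theta> z) = \<Theta>(\<alpha> z)\<close>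
  extends the substitution to a holomorphic map \<open>\<Theta>\<close> on the whole plane with \<open>\<Theta>^*q = dz^k\<close>
  (\<open>exists_uniformization\<close>).

  The map \<open>\<Theta>\<close> is the orbifold quotient map. It misses exactly the points of infinite weight, by
  Picard's theorem and backward invariance (\<open>range_\<Theta>\<close>). Locally \<open>\<Theta>\<close> is determined by its value
  and by \<open>q\<close> up to a \<open>k\<close>-th root of unity, so two points of a fibre differ by an affine map preserving
  \<open>\<Theta>\<close> (\<open>fibre_transitive\<close>), and the stabilizer of \<open>z\<close> consists of the rotations by the
  \<open>\<nu>(\<Theta> z)\<close>-th roots of unity (\<open>stabilizer\<close>).

  The group of these affine maps is then found from its translations, which form a discrete subgroup
  of the plane, and from the finite group of its linear parts, its rotations. Without translations
  \<open>\<Theta>\<close> would have generic fibres of constant finite size, against \<open>deg f > 1\<close>. If the translations are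
  cyclic, the only rotations are \<open>\<plusminus> 1\<close>. If they form a lattice, then \<open>\<Theta>\<close> is onto and every rotation
  \<open>\<omega>\<close> has \<open>2 Re \<omega>\<close> integral, which leaves rotation groups of order \<open>1, 2, 3, 4, 6\<close>. The weights divide
  this order, and \<open>\<Sum>(1 - 1/\<nu>) = 2\<close> determines them and excludes order \<open>1\<close> for a lattice. After moving
  the centre of a generating rotation \<open>\<omega>\<close> to \<open>0\<close>, the map \<open>L(z) = \<alpha> z + \<beta>\<close> has to normalize the group:
  \<open>\<alpha>\<close> maps translations to translations and \<open>(1 - \<omega>) \<beta>\<close> is a translation, whence the lists of \<open>\<alpha>\<close>
  and \<open>\<beta>\<close>. The map \<open>\<Theta>\<close> absorbs every change of coordinate on the projective line, so the conjugation
  can be taken trivial.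
\<close>

section \<open>Holomorphic maps to the projective line\<close>

text \<open>
  Holomorphy at a single point, by means of the local parameter centred at the image point. This
  avoids a case distinction between the two affine charts.
\<close>

definition P1_analytic :: "(complex \<Rightarrow> P1) \<Rightarrow> complex \<Rightarrow> bool" where
  "P1_analytic h z \<longleftrightarrow>
     (\<exists>F. F analytic_on {z} \<and> F z = 0 \<and> (\<forall>\<^sub>F w in nhds z. h w = local_param (h z) (F w)))"

lemma local_param_0 [simp]: "local_param x 0 = x"
  by (cases x) auto

lemma local_coord_param [simp]: "local_coord x (local_param x t) = t"
  by (cases x) auto

lemma local_param_inject: "local_param x s = local_param x t \<longleftrightarrow> s = t"
  by (metis local_coord_param)

text \<open>
  The projective line is Hausdorff: values converging to \<open>x\<close> and to \<open>y\<close> in their local parameters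
  cannot agree arbitrarily far along the filter unless \<open>x = y\<close>.
\<close>

lemma local_param_separated:
  assumes F: "(F \<longlongrightarrow> 0) A" and G: "(G \<longlongrightarrow> 0) A"
    and eq: "\<exists>\<^sub>F w in A. local_param x (F w) = local_param y (G w)"
  shows "x = y"
proof (rule ccontr)
  assume "x \<noteq> y"
  have key: False if F: "(F \<longlongrightarrow> 0) A" and G: "(G \<longlongrightarrow> 0) A"
    and eq: "\<exists>\<^sub>F w in A. local_param (Fin a) (F w) = local_param Infty (G w)"
    for F G :: "'a \<Rightarrow> complex" and a
  proof -
    have "((\<lambda>w. (a + F w) * G w) \<longlongrightarrow> (a + 0) * 0) A"
      by (intro tendsto_intros F G)
    then have "\<forall>\<^sub>F w in A. (a + F w) * G w \<noteq> 1"
      using tendsto_imp_eventually_ne[of "\<lambda>w. (a + F w) * G w" 0 A 1] by simp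
    then have "\<forall>\<^sub>F w in A. \<not> local_param (Fin a) (F w) = local_param Infty (G w)"
      by eventually_elim auto
    with eq show False by (simp add: frequently_def)
  qed
  show False
  proof (cases x)
    case x: (Fin a)
    show False
    proof (cases y)
      case y: (Fin b)
      have "((\<lambda>w. (a + F w) - (b + G w)) \<longlongrightarrow> (a + 0) - (b + 0)) A"
        by (intro tendsto_intros F G)
      then have "\<forall>\<^sub>F w in A. (a + F w) - (b + G w) \<noteq> 0"
        using tendsto_imp_eventually_ne[of "\<lambda>w. (a + F w) - (b + G w)" "a - b" A 0] \<open>x \<noteq> y\<close> x y by simp
      then have "\<forall>\<^sub>F w in A. \<not> local_param x (F w) = local_param y (G w)"
        by eventually_elim (use x y in auto)
      with eq show False by (simp add: frequently_def)
    next
      case Infty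
      then show False using key[OF F G] eq x by simp
    qed
  next
    case x: Infty
    then obtain b where y: "y = Fin b" using \<open>x \<noteq> y\<close> by (cases y) auto
    have "\<exists>\<^sub>F w in A. local_param (Fin b) (G w) = local_param Infty (F w)"
      using eq by (rule frequently_elim1) (simp only: x y)
    then show False by (rule key[OF G F])
  qed
qed

lemma analytic_tendsto:
  assumes "F analytic_on {z}"
  shows "F \<midarrow>z\<rightarrow> F z"
  using assms analytic_at_imp_isCont isCont_def by blast

lemma analytic_tendsto_nhds:
  assumes "F analytic_on {z}"
  shows "filterlim F (nhds (F z)) (nhds z)"
  using analytic_tendsto[OF assms] by (simp add: tendsto_at_iff_tendsto_nhds)

lemma analytic_frequently_eq:
  assumes F: "F analytic_on {z}" and G: "G analytic_on {z}" and "\<exists>\<^sub>F w in at z. F w = (G w :: complex)"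
  shows "\<forall>\<^sub>F w in nhds z. F w = G w"
proof -
  let ?d = "\<lambda>w. F w - G w"
  have d: "?d analytic_on {z}" using F G by (intro analytic_intros)
  have "\<forall>\<^sub>F w in at z. ?d w = 0"
    using assms(3)
    by (intro not_essential_frequently_0_imp_eventually_0 isolated_singularity_at_analytic
        not_essential_analytic d) simp_all
  moreover have "?d z = 0"
  proof -
    have "?d \<midarrow>z\<rightarrow> ?d z" using d by (rule analytic_tendsto)
    moreover have "?d \<midarrow>z\<rightarrow> 0"
      using \<open>\<forall>\<^sub>F w in at z. ?d w = 0\<close> by (rule tendsto_eventually)
    ultimately show ?thesis by (rule tendsto_unique[rotated]) simp
  qed
  ultimately have "\<forall>\<^sub>F w in nhds z. ?d w = 0"
    by (simp add: eventually_nhds_conv_at)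
  then show ?thesis by eventually_elim simp
qed

lemma P1_analytic_identity_local:
  assumes h1: "P1_analytic h1 z" and h2: "P1_analytic h2 z" and eq: "\<exists>\<^sub>F w in at z. h1 w = h2 w"
  shows "\<forall>\<^sub>F w in nhds z. h1 w = h2 w"
proof -
  obtain F where F: "F analytic_on {z}" "F z = 0" and Fe: "\<forall>\<^sub>F w in nhds z. h1 w = local_param (h1 z) (F w)"
    using h1 unfolding P1_analytic_def by blast
  obtain G where G: "G analytic_on {z}" "G z = 0" and Ge: "\<forall>\<^sub>F w in nhds z. h2 w = local_param (h2 z) (G w)"
    using h2 unfolding P1_analytic_def by blast
  have Fe': "\<forall>\<^sub>F w in at z. h1 w = local_param (h1 z) (F w)" and Ge': "\<forall>\<^sub>F w in at z. h2 w = local_param (h2 z) (G w)"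
    using Fe Ge by (auto simp: eventually_nhds_conv_at)
  have fr: "\<exists>\<^sub>F w in at z. local_param (h1 z) (F w) = local_param (h2 z) (G w)"
    by (rule frequently_rev_mp[OF eq]) (use Fe' Ge' in eventually_elim, metis)
  have x: "h1 z = h2 z"
    using local_param_separated[OF _ _ fr] analytic_tendsto[OF F(1)] analytic_tendsto[OF G(1)] F(2) G(2) by simp
  have "\<forall>\<^sub>F w in nhds z. F w = G w"
    using fr unfolding x local_param_inject by (intro analytic_frequently_eq F G)
  with Fe Ge show ?thesis by eventually_elim (simp add: x)
qed

lemma P1_analytic_identity:
  assumes h1: "\<And>z. P1_analytic h1 z" and h2: "\<And>z. P1_analytic h2 z" and eq: "\<forall>\<^sub>F w in nhds z0. h1 w = h2 w"
  shows "h1 = h2"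
proof -
  define S where "S = {z. \<forall>\<^sub>F w in nhds z. h1 w = h2 w}"
  have "open S"
  proof (subst open_subopen, intro ballI)
    fix z assume "z \<in> S"
    then obtain T where "open T" "z \<in> T" "\<And>w. w \<in> T \<Longrightarrow> h1 w = h2 w" by (auto simp: S_def eventually_nhds)
    then have "\<exists>T. open T \<and> z \<in> T \<and> T \<subseteq> S"
      by (intro exI[of _ T]) (auto simp: S_def eventually_nhds)
    then show "\<exists>T. open T \<and> z \<in> T \<and> T \<subseteq> S" .
  qed
  moreover have "closed S"
    unfolding closed_limpt
  proof (intro allI impI)
    fix z assume "z islimpt S"
    then have "\<exists>\<^sub>F w in at z. w \<in> S" by (simp add: islimpt_conv_frequently_at)
    then have "\<exists>\<^sub>F w in at z. h1 w = h2 w"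
      by (rule frequently_elim1) (auto simp: S_def dest: eventually_nhds_x_imp_x)
    then show "z \<in> S" unfolding S_def using P1_analytic_identity_local[OF h1 h2] by simp
  qed
  moreover have "z0 \<in> S" using eq by (simp add: S_def)
  ultimately have "S = UNIV" using clopen[of S] by auto
  then show ?thesis unfolding S_def using eventually_nhds_x_imp_x by blast
qed

lemma P1_analytic_imp_holomorphic:
  assumes h: "\<And>z. P1_analytic h z"
  shows "holomorphic_to_P1 h"
  unfolding holomorphic_to_P1_def
proof
  fix z
  obtain F where F: "F analytic_on {z}" "F z = 0" and Fe: "\<forall>\<^sub>F w in nhds z. h w = local_param (h z) (F w)"
    using h unfolding P1_analytic_def by blast
  show "(\<forall>\<^sub>F w in nhds z. h w \<noteq> Infty) \<and> (\<lambda>w. coord (h w)) analytic_on {z} \<or>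
        (\<forall>\<^sub>F w in nhds z. h w \<noteq> Fin 0) \<and> (\<lambda>w. coord_inf (h w)) analytic_on {z}"
  proof (cases "h z")
    case (Fin a)
    have "\<forall>\<^sub>F w in nhds z. h w \<noteq> Infty" using Fe by eventually_elim (simp add: Fin)
    moreover have "(\<lambda>w. coord (h w)) analytic_on {z} \<longleftrightarrow> (\<lambda>w. a + F w) analytic_on {z}"
      by (rule analytic_at_cong) (use Fe in eventually_elim, auto simp: Fin)
    moreover have "(\<lambda>w. a + F w) analytic_on {z}" by (intro analytic_intros F)
    ultimately show ?thesis by blast
  next
    case Infty
    have "\<forall>\<^sub>F w in nhds z. h w \<noteq> Fin 0" using Fe by eventually_elim (simp add: Infty)
    moreover have "(\<lambda>w. coord_inf (h w)) analytic_on {z} \<longleftrightarrow> F analytic_on {z}"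
      by (rule analytic_at_cong) (use Fe in eventually_elim, auto simp: Infty)
    ultimately show ?thesis using F by blast
  qed
qed

lemma P1_analytic_compose:
  assumes h: "P1_analytic h (g z)" and g: "g analytic_on {z}"
  shows "P1_analytic (\<lambda>w. h (g w)) z"
proof -
  obtain F where F: "F analytic_on {g z}" "F (g z) = 0" and Fe: "\<forall>\<^sub>F w in nhds (g z). h w = local_param (h (g z)) (F w)"
    using h unfolding P1_analytic_def by blast
  have "\<forall>\<^sub>F w in nhds z. h (g w) = local_param (h (g z)) (F (g w))"
    using Fe analytic_tendsto_nhds[OF g] by (rule eventually_compose_filterlim)
  moreover have "(\<lambda>w. F (g w)) analytic_on {z}"
    using analytic_on_compose_gen[OF g F(1), unfolded o_def] by simp
  ultimately show ?thesis unfolding P1_analytic_def using F(2) by (intro exI[of _ "\<lambda>w. F (g w)"]) auto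
qed

lemma P1_analytic_cong:
  assumes "\<forall>\<^sub>F w in nhds z. h w = g w"
  shows "P1_analytic h z \<longleftrightarrow> P1_analytic g z"
proof -
  have "h z = g z" using assms eventually_nhds_x_imp_x by blast
  moreover have "(\<forall>\<^sub>F w in nhds z. h w = local_param x (F w)) \<longleftrightarrow> (\<forall>\<^sub>F w in nhds z. g w = local_param x (F w))" for F x
    by (rule eventually_cong[OF assms]) simp
  ultimately show ?thesis unfolding P1_analytic_def by simp
qed

lemma P1_analytic_local_param: "P1_analytic (local_param x) 0"
  unfolding P1_analytic_def by (intro exI[of _ "\<lambda>t. t"]) auto

section \<open>Rational maps in local coordinates\<close>

lemma poly_analytic: "(\<lambda>t. poly P t) analytic_on A" for P :: "complex poly"
  by (rule analytic_on_subset[of _ UNIV]) (auto simp: analytic_on_open intro: holomorphic_intros)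

lemma zorder_eq_if_eventually:
  assumes g: "g analytic_on {z}" "g z \<noteq> 0" and eq: "\<forall>\<^sub>F w in at z. h w = g w * (w - z) powi n"
  shows "zorder h z = n"
proof -
  obtain A where A: "open A" "z \<in> A" "g holomorphic_on A"
    using g(1) unfolding analytic_at by blast
  obtain B where B: "open B" "z \<in> B" "\<And>w. w \<in> B \<Longrightarrow> w \<noteq> z \<Longrightarrow> h w = g w * (w - z) powi n"
    using eq unfolding eventually_at_topological by blast
  show ?thesis
  proof (rule zorder_eqI)
    show "open (A \<inter> B)" "z \<in> A \<inter> B" "g z \<noteq> 0" using A B g by auto
    show "g holomorphic_on A \<inter> B" using A(3) by (rule holomorphic_on_subset) auto
  qed (use B in auto)
qed

text \<open>
  The polynomial \<open>t^n P(1/t)\<close>, for \<open>P\<close> of degree at most \<open>n\<close>.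
\<close>

definition homogenize :: "nat \<Rightarrow> complex poly \<Rightarrow> complex poly" where
  "homogenize n P = (\<Sum>i\<le>n. monom (coeff P (n - i)) i)"

lemma coeff_homogenize: "coeff (homogenize n P) i = (if i \<le> n then coeff P (n - i) else 0)"
  unfolding homogenize_def coeff_sum coeff_monom by (simp add: sum.delta')

lemma poly_homogenize_0 [simp]: "poly (homogenize n P) 0 = coeff P n"
  by (simp add: poly_0_coeff_0 coeff_homogenize)

lemma poly_homogenize:
  assumes "t \<noteq> 0" and deg: "degree P \<le> n"
  shows "poly (homogenize n P) t = t ^ n * poly P (1 / t)"
proof -
  have "poly P (1 / t) = (\<Sum>i\<le>n. coeff P i * (1 / t) ^ i)"
    unfolding poly_altdef
    by (rule sum.mono_neutral_left) (use deg in \<open>auto simp: coeff_eq_0\<close>)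
  then have "t ^ n * poly P (1 / t) = (\<Sum>i\<le>n. coeff P i * (t ^ n * (1 / t) ^ i))"
    by (simp add: sum_distrib_left mult_ac)
  also have "\<dots> = (\<Sum>i\<le>n. coeff P i * t ^ (n - i))"
    using \<open>t \<noteq> 0\<close> by (intro sum.cong refl) (simp add: power_diff power_divide)
  also have "\<dots> = (\<Sum>i\<le>n. coeff P (n - i) * t ^ i)"
    by (rule sum.reindex_bij_witness[of _ "\<lambda>i. n - i" "\<lambda>i. n - i"]) auto
  also have "\<dots> = poly (homogenize n P) t"
    unfolding homogenize_def by (simp add: poly_sum poly_monom)
  finally show ?thesis ..
qed

lemma homogenize_diff: "homogenize n (P - smult b Q) = homogenize n P - smult b (homogenize n Q)"
  by (rule poly_eqI) (simp add: coeff_homogenize)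

text \<open>
  The cofactor of the full power of \<open>[:-a, 1:]\<close> has no root at all, hence is constant by the
  fundamental theorem of algebra.
\<close>

lemma order_0_eq_degree:
  assumes P: "P \<noteq> 0" and roots: "\<And>z::complex. poly P z = 0 \<Longrightarrow> z = a"
  shows "Polynomial.order a P = degree P"
proof -
  obtain R where R: "P = [:-a, 1:] ^ Polynomial.order a P * R" "\<not> [:-a, 1:] dvd R"
    using order_decomp[OF P] by blast
  have "poly R z \<noteq> 0" for z
  proof
    assume z: "poly R z = 0"
    then have "poly P z = 0" by (subst R(1)) simp
    then have "z = a" by (rule roots)
    with z R(2) show False by (simp add: poly_eq_0_iff_dvd)
  qed
  then have "degree R = 0"
    using alg_closed_imp_poly_has_root[of R] by auto
  moreover have "R \<noteq> 0" using P R(1) by auto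
  ultimately show ?thesis
    by (subst (2) R(1)) (simp add: degree_mult_eq degree_power_eq)
qed

locale rational_map =
  fixes p r :: "complex poly" and d :: nat and f :: "P1 \<Rightarrow> P1"
  assumes coprime: "coprime p r"
    and d_eq: "d = max (degree p) (degree r)"
    and f_eq: "f = rat_map p r"
    and d_gt_1: "d > 1"
begin

text \<open>
  A polynomial of degree at most \<open>d\<close> as a form of degree \<open>d\<close>, written in the local parameter at \<open>y\<close>.
\<close>

definition chart_poly :: "P1 \<Rightarrow> complex poly \<Rightarrow> complex poly" where
  "chart_poly y P = (case y of Fin a \<Rightarrow> P \<circ>\<^sub>p [:a, 1:] | Infty \<Rightarrow> homogenize d P)"

text \<open>
  As a form of degree \<open>d\<close>, it vanishes on the fibre over \<open>x\<close>.
\<close>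

definition fiber_poly :: "P1 \<Rightarrow> complex poly" where
  "fiber_poly x = (case x of Fin b \<Rightarrow> p - smult b r | Infty \<Rightarrow> r)"

text \<open>
  The form whose quotient with \<open>fiber_poly x\<close> pulls the local coordinate at \<open>x\<close> back along \<open>f\<close>.
\<close>

definition denom_poly :: "P1 \<Rightarrow> complex poly" where
  "denom_poly x = (case x of Fin b \<Rightarrow> r | Infty \<Rightarrow> p)"

lemma chart_poly_diff: "chart_poly y (P - smult b Q) = chart_poly y P - smult b (chart_poly y Q)"
  by (cases y) (simp_all add: chart_poly_def homogenize_diff pcompose_diff pcompose_smult)

lemma degree_le_d: "degree p \<le> d" "degree r \<le> d"
  by (simp_all add: d_eq)

lemma no_common_root: "poly p z \<noteq> 0 \<or> poly r z \<noteq> 0"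
  using coprime coprime_poly_0 by blast

lemma coeff_d: "coeff p d \<noteq> 0 \<or> coeff r d \<noteq> 0"
proof (cases "degree p \<ge> degree r")
  case True
  then show ?thesis using d_eq d_gt_1 by (intro disjI1) (auto simp: max_def)
next
  case False
  then show ?thesis using d_eq d_gt_1 by (intro disjI2) (auto simp: max_def)
qed

lemma chart_no_common_root: "poly (chart_poly y p) t \<noteq> 0 \<or> poly (chart_poly y r) t \<noteq> 0"
proof (cases y)
  case (Fin a)
  then show ?thesis using no_common_root by (simp add: chart_poly_def poly_pcompose)
next
  case Infty
  show ?thesis
  proof (cases "t = 0")
    case True
    then show ?thesis using coeff_d by (simp add: chart_poly_def Infty)
  next
    case False
    then show ?thesis using no_common_root
      by (simp add: chart_poly_def Infty poly_homogenize degree_le_d)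
  qed
qed

lemma f_local_param:
  "f (local_param y t) =
     (if poly (chart_poly y r) t = 0 then Infty
      else Fin (poly (chart_poly y p) t / poly (chart_poly y r) t))"
proof (cases y)
  case (Fin a)
  then show ?thesis by (simp add: f_eq rat_map_def chart_poly_def poly_pcompose)
next
  case Infty
  then show ?thesis
    by (cases "t = 0")
       (auto simp: f_eq rat_map_def chart_poly_def poly_homogenize degree_le_d d_eq[symmetric] Let_def)
qed

lemma fiber_poly_nonzero: "fiber_poly x \<noteq> 0"
proof
  assume 0: "fiber_poly x = 0"
  show False
  proof (cases x)
    case (Fin b)
    with 0 have eq: "p = smult b r" by (simp add: fiber_poly_def)
    then have "r dvd p" by (simp add: dvd_smult)
    then have "is_unit r" using coprime by (metis coprime_absorb_right coprime_commute)
    then have "degree r = 0" using is_unit_iff_degree by (metis not_is_unit_0)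
    then show False using eq d_eq d_gt_1 by (auto split: if_splits)
  next
    case Infty
    with 0 have "r = 0" by (simp add: fiber_poly_def)
    then have "is_unit p" using coprime by simp
    then have "degree p = 0" using is_unit_iff_degree by (metis not_is_unit_0)
    then show False using \<open>r = 0\<close> d_eq d_gt_1 by simp
  qed
qed

lemma degree_fiber_poly: "degree (fiber_poly x) \<le> d"
  by (cases x) (auto simp: fiber_poly_def degree_le_d intro: degree_diff_le order_trans[OF degree_smult_le])

lemma chart_poly_nonzero:
  assumes "P \<noteq> 0" "degree P \<le> d"
  shows "chart_poly y P \<noteq> 0"
proof (cases y)
  case (Fin a)
  then show ?thesis using assms by (simp add: chart_poly_def pcompose_eq_0_iff)
next
  case Infty
  have "coeff (homogenize d P) (d - degree P) = coeff P (degree P)"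
    using assms by (simp add: coeff_homogenize)
  then show ?thesis using assms Infty by (auto simp: chart_poly_def)
qed

lemma f_local_param_eq_iff:
  "f (local_param y t) = x \<longleftrightarrow> poly (chart_poly y (fiber_poly x)) t = 0"
  using chart_no_common_root[of y t]
  by (cases x) (auto simp: f_local_param fiber_poly_def chart_poly_diff field_simps)

lemma f_eq_iff: "f y = x \<longleftrightarrow> poly (chart_poly y (fiber_poly x)) 0 = 0"
  using f_local_param_eq_iff[of y 0 x] by simp

lemma denom_nonzero: "poly (chart_poly y (denom_poly (f y))) 0 \<noteq> 0"
  using chart_no_common_root[of y 0] f_local_param[of y 0]
  by (cases "f y") (auto simp: denom_poly_def split: if_splits)

lemma f_local_form:
  "\<forall>\<^sub>F t in nhds 0. f (local_param y t) =
     local_param (f y) (poly (chart_poly y (fiber_poly (f y))) t / poly (chart_poly y (denom_poly (f y))) t)"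
proof -
  let ?D = "chart_poly y (denom_poly (f y))"
  have "isCont (poly ?D) 0" by simp
  then have "filterlim (poly ?D) (nhds (poly ?D 0)) (nhds 0)"
    by (simp add: isCont_def tendsto_at_iff_tendsto_nhds)
  then have "\<forall>\<^sub>F t in nhds 0. poly ?D t \<noteq> 0"
    using denom_nonzero tendsto_imp_eventually_ne by blast
  then show ?thesis
  proof eventually_elim
    case (elim t)
    then show ?case
      using chart_no_common_root[of y t]
      by (cases "f y") (auto simp: f_local_param fiber_poly_def denom_poly_def chart_poly_diff field_simps)
  qed
qed

lemma
  shows local_degree_eq: "local_degree f y = Polynomial.order 0 (chart_poly y (fiber_poly (f y)))"
    and local_degree_ge_1: "local_degree f y \<ge> 1"
    and f_local_factor: "\<exists>g. g analytic_on {0} \<and> g 0 \<noteq> 0 \<and>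
      (\<forall>\<^sub>F t in nhds 0. f (local_param y t) = local_param (f y) (t ^ local_degree f y * g t))"
proof -
  define S where "S = chart_poly y (fiber_poly (f y))"
  define D where "D = chart_poly y (denom_poly (f y))"
  define e where "e = Polynomial.order 0 S"
  have "S \<noteq> 0" unfolding S_def by (intro chart_poly_nonzero fiber_poly_nonzero degree_fiber_poly)
  then obtain R where R: "S = [:-0, 1:] ^ e * R" "\<not> [:-0, 1:] dvd R"
    unfolding e_def using order_decomp[of S 0] by blast
  have R0: "poly R 0 \<noteq> 0" using R(2) poly_eq_0_iff_dvd[of R 0] by simp
  have S_eq: "poly S t = t ^ e * poly R t" for t by (subst R(1)) simp
  define g where "g t = poly R t / poly D t" for t
  have D0: "poly D 0 \<noteq> 0" using denom_nonzero by (simp add: D_def)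
  have g: "g analytic_on {0}" "g 0 \<noteq> 0"
    unfolding g_def using D0 R0 by (auto intro!: analytic_intros poly_analytic)
  have *: "\<forall>\<^sub>F t in nhds 0. f (local_param y t) = local_param (f y) (t ^ e * g t)"
    using f_local_form[of y, folded S_def D_def] by eventually_elim (simp add: S_eq g_def)
  have "\<forall>\<^sub>F t in nhds 0. local_coord (f y) (f (local_param y t)) = g t * (t - 0) powi (int e)"
    using * by eventually_elim (simp add: mult.commute)
  then have "\<forall>\<^sub>F t in at 0. local_coord (f y) (f (local_param y t)) = g t * (t - 0) powi (int e)"
    by (simp add: eventually_nhds_conv_at)
  then have "zorder (\<lambda>t. local_coord (f y) (f (local_param y t))) 0 = int e"
    by (rule zorder_eq_if_eventually[OF g])
  then have deg: "local_degree f y = e" by (simp add: local_degree_def)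
  then show "local_degree f y = Polynomial.order 0 (chart_poly y (fiber_poly (f y)))"
    by (simp add: e_def S_def)
  show "\<exists>g. g analytic_on {0} \<and> g 0 \<noteq> 0 \<and>
      (\<forall>\<^sub>F t in nhds 0. f (local_param y t) = local_param (f y) (t ^ local_degree f y * g t))"
    using g * deg by blast
  have "poly S 0 = 0" using f_eq_iff[of y "f y"] by (simp add: S_def)
  then have "e \<noteq> 0" unfolding e_def using \<open>S \<noteq> 0\<close> by (simp add: order_root)
  then show "local_degree f y \<ge> 1" using deg by simp
qed

lemma f_eq_iff_Fin: "f (Fin a) = x \<longleftrightarrow> poly (fiber_poly x) a = 0"
  and f_eq_iff_Infty: "f Infty = x \<longleftrightarrow> coeff (fiber_poly x) d = 0"
  by (simp_all add: f_eq_iff chart_poly_def poly_pcompose)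

lemma f_surj: "\<exists>y. f y = x"
proof (cases "coeff (fiber_poly x) d = 0")
  case True
  then show ?thesis using f_eq_iff_Infty by blast
next
  case False
  then have "degree (fiber_poly x) = d" using degree_fiber_poly[of x] le_degree[of "fiber_poly x" d] by linarith
  then show ?thesis using alg_closed_imp_poly_has_root[of "fiber_poly x"] d_gt_1 f_eq_iff_Fin by auto
qed

text \<open>
  The fibre over \<open>f y\<close> is the zero divisor of a form of degree \<open>d\<close>. Concentrated in one point, it has
  multiplicity \<open>d\<close> there.
\<close>

lemma local_degree_single_preimage:
  assumes single: "\<And>z. f z = f y \<Longrightarrow> z = y"
  shows "local_degree f y = d"
proof -
  define x where "x = f y"
  define P where "P = fiber_poly x"
  have P: "P \<noteq> 0" "degree P \<le> d" by (simp_all add: P_def fiber_poly_nonzero degree_fiber_poly)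
  have ne: "chart_poly y P \<noteq> 0" using P by (rule chart_poly_nonzero)
  have root: "t = 0" if "poly (chart_poly y P) t = 0" for t
  proof -
    have "f (local_param y t) = f y" using that f_local_param_eq_iff by (simp add: P_def x_def)
    then have "local_param y t = local_param y 0" using single by simp
    then show ?thesis by (simp only: local_param_inject)
  qed
  have "degree (chart_poly y P) = d"
  proof (cases y)
    case (Fin a)
    have "f Infty \<noteq> x" using single[of Infty] Fin by (auto simp: x_def)
    then have "coeff P d \<noteq> 0" by (simp add: f_eq_iff_Infty P_def)
    then have "degree P = d" using P(2) le_degree[of P d] by linarith
    then show ?thesis by (simp add: Fin chart_poly_def degree_pcompose)
  next
    case Infty
    have "poly P a \<noteq> 0" for a
      using single[of "Fin a"] f_eq_iff_Fin[of a x] Infty by (auto simp: x_def P_def)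
    then have "degree P = 0"
      using alg_closed_imp_poly_has_root[of P] by auto
    then have "coeff P 0 \<noteq> 0" using P(1) by (metis leading_coeff_0_iff)
    then have "coeff (homogenize d P) d \<noteq> 0" by (simp add: coeff_homogenize)
    moreover have "degree (homogenize d P) \<le> d"
      by (rule degree_le) (simp add: coeff_homogenize)
    ultimately show ?thesis by (simp add: Infty chart_poly_def le_antisym le_degree)
  qed
  then show ?thesis
    using order_0_eq_degree[OF ne root] by (simp add: local_degree_eq P_def x_def)
qed

text \<open>
  Since \<open>f\<close> is onto, \<open>f\<close> permutes a finite set that contains its preimage. Its points thus have only
  one preimage each, at which \<open>f\<close> has local degree \<open>d\<close>.
\<close>

lemma no_unramified_backward_invariant:
  assumes A: "finite A" and inv: "\<And>y. f y \<in> A \<Longrightarrow> y \<in> A \<and> local_degree f y = 1"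
  shows "A = {}"
proof (rule ccontr)
  assume "A \<noteq> {}"
  have "A \<subseteq> f ` A"
  proof
    fix x assume "x \<in> A"
    moreover obtain y where "f y = x" using f_surj by blast
    ultimately show "x \<in> f ` A" using inv by blast
  qed
  then have "f ` A = A" by (metis A card_image_le card_seteq finite_imageI)
  then have inj: "inj_on f A" using A by (simp add: eq_card_imp_inj_on)
  obtain x where "x \<in> A" using \<open>A \<noteq> {}\<close> by blast
  then obtain y where y: "f y = x" using f_surj by blast
  have "z = y" if "f z = f y" for z
    using that y inv[of z] inv[of y] \<open>x \<in> A\<close> inj by (metis inj_onD)
  then have "local_degree f y = d" by (rule local_degree_single_preimage)
  moreover have "local_degree f y = 1" using inv y \<open>x \<in> A\<close> by blast
  ultimately show False using d_gt_1 by simp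
qed

lemma finite_backward_invariant:
  assumes A: "finite A" and inv: "\<And>y. f y \<in> A \<Longrightarrow> y \<in> A" and y: "y \<in> A"
  shows "local_degree f y = d"
proof (rule local_degree_single_preimage)
  have "A \<subseteq> f ` A"
  proof
    fix x assume "x \<in> A"
    moreover obtain y where "f y = x" using f_surj by blast
    ultimately show "x \<in> f ` A" using inv by blast
  qed
  then have im: "f ` A = A" by (metis A card_image_le card_seteq finite_imageI)
  then have inj: "inj_on f A" using A by (simp add: eq_card_imp_inj_on)
  fix z assume "f z = f y"
  then show "z = y" using y im inv[of z] inj by (metis imageI inj_onD)
qed

lemma f_P1_analytic_compose:
  assumes h: "P1_analytic h z"
  shows "P1_analytic (\<lambda>w. f (h w)) z"
proof -
  obtain F where F: "F analytic_on {z}" "F z = 0" and Fe: "\<forall>\<^sub>F w in nhds z. h w = local_param (h z) (F w)"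
    using h unfolding P1_analytic_def by blast
  obtain g where g: "g analytic_on {0}" and ge: "\<forall>\<^sub>F t in nhds 0. f (local_param (h z) t) = local_param (f (h z)) (t ^ local_degree f (h z) * g t)"
    using f_local_factor by blast
  have "P1_analytic (\<lambda>t. f (local_param (h z) t)) (F z)"
    unfolding P1_analytic_def
    using ge g F(2) local_degree_ge_1[of "h z"]
    by (intro exI[of _ "\<lambda>t. t ^ local_degree f (h z) * g t"]) (auto intro!: analytic_intros)
  then have "P1_analytic (\<lambda>w. f (local_param (h z) (F w))) z"
    using F(1) by (rule P1_analytic_compose)
  moreover have "\<forall>\<^sub>F w in nhds z. f (h w) = f (local_param (h z) (F w))"
    using Fe by eventually_elim metis
  note P1_analytic_cong[OF this]
  ultimately show ?thesis by simp
qed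

end

section \<open>Fixed points and their multipliers\<close>

text \<open>
  Euler's identity: the top coefficient of the Lagrange interpolation of \<open>H\<close> at the roots of \<open>G\<close>.
\<close>

lemma sum_over_simple_roots:
  fixes G H :: "complex poly"
  assumes simple: "\<And>a. poly G a = 0 \<Longrightarrow> poly (pderiv G) a \<noteq> 0"
    and deg: "degree H < degree G"
  shows "(\<Sum>a | poly G a = 0. poly H a / poly (pderiv G) a) = coeff H (degree G - 1) / lead_coeff G"
    and "card {a. poly G a = 0} = degree G"
proof -
  define Z where "Z = {a. poly G a = 0}"
  define l where "l = lead_coeff G"
  have G: "G \<noteq> 0" using deg by auto
  then have l: "l \<noteq> 0" by (simp add: l_def)
  have fin: "finite Z" unfolding Z_def using G by (rule poly_roots_finite)
  have "rsquarefree G" unfolding rsquarefree_roots using simple by auto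
  then have dec: "smult l (\<Prod>z\<in>Z. [:-z, 1:]) = G"
    unfolding l_def Z_def by (rule complex_poly_decompose_rsquarefree)
  have degprod: "degree (\<Prod>z\<in>A. [:-z, 1:]) = card A" for A :: "complex set"
    by (subst degree_prod_eq_sum_degree) auto
  have monic: "lead_coeff (\<Prod>z\<in>A. [:-z, 1:]) = 1" for A :: "complex set"
    by (simp add: lead_coeff_prod)
  have "degree (smult l (\<Prod>z\<in>Z. [:-z, 1:])) = card Z" using l degprod by simp
  then have cZ: "card Z = degree G" by (simp add: dec)
  then show "card {a. poly G a = 0} = degree G" by (simp add: Z_def)
  define Q where "Q a = (\<Prod>z\<in>Z - {a}. [:-z, 1:])" for a
  have GQ: "G = smult l ([:-a, 1:] * Q a)" if "a \<in> Z" for a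
    unfolding dec[symmetric] Q_def using fin that by (simp add: prod.remove)
  have dG: "poly (pderiv G) a = l * poly (Q a) a" if "a \<in> Z" for a
    by (subst GQ[OF that], simp only: pderiv_smult pderiv_mult poly_smult poly_add poly_mult)
       (simp add: pderiv_pCons)
  have Qa: "poly (Q a) a \<noteq> 0" if "a \<in> Z" for a
    using simple[of a] dG[OF that] that by (auto simp: Z_def)
  have Qb: "poly (Q a) b = 0" if "b \<in> Z" "b \<noteq> a" for a b
    unfolding Q_def poly_prod using that fin by (intro prod_zero) auto
  have degQ: "degree (Q a) = degree G - 1" if "a \<in> Z" for a
    unfolding Q_def degprod using that fin cZ by simp
  have coQ: "coeff (Q a) (degree G - 1) = 1" if "a \<in> Z" for a
    using monic[of "Z - {a}"] degQ[OF that] by (simp add: Q_def)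
  define K where "K = (\<Sum>a\<in>Z. smult (poly H a / poly (Q a) a) (Q a))"
  have "K = H"
  proof (rule poly_eqI_degree[of Z])
    fix b assume b: "b \<in> Z"
    have "poly K b = (\<Sum>a\<in>Z. if a = b then poly H b else 0)"
      unfolding K_def poly_sum using b Qa Qb by (intro sum.cong) auto
    also have "\<dots> = poly H b" using b fin by simp
    finally show "poly K b = poly H b" .
  next
    have "degree K \<le> degree G - 1"
      unfolding K_def using degQ by (intro degree_sum_le fin) (auto intro: order_trans[OF degree_smult_le])
    then show "card Z > degree K" using deg cZ by simp
    show "card Z > degree H" using deg cZ by simp
  qed
  then have "coeff H (degree G - 1) = coeff K (degree G - 1)" by simp
  also have "\<dots> = (\<Sum>a\<in>Z. poly H a / poly (Q a) a)"
    unfolding K_def coeff_sum using coQ by (intro sum.cong) auto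
  finally have "coeff H (degree G - 1) / l = (\<Sum>a\<in>Z. poly H a / (l * poly (Q a) a))"
    by (simp add: sum_divide_distrib mult.commute)
  also have "\<dots> = (\<Sum>a\<in>Z. poly H a / poly (pderiv G) a)"
    by (intro sum.cong) (auto simp: dG)
  finally show "(\<Sum>a | poly G a = 0. poly H a / poly (pderiv G) a) = coeff H (degree G - 1) / lead_coeff G"
    by (simp add: Z_def l_def)
qed

lemma Re_inverse_one_minus:
  assumes "norm \<mu> \<le> 1" "\<mu> \<noteq> (1::complex)"
  shows "Re (1 / (1 - \<mu>)) \<ge> 1 / 2"
proof -
  define w where "w = 1 - \<mu>"
  have w: "w \<noteq> 0" using assms by (simp add: w_def)
  have "norm \<mu> ^ 2 \<le> 1" using assms by (simp add: power_le_one)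
  then have "norm w ^ 2 \<le> 2 * Re w"
    unfolding w_def cmod_power2 by (simp add: power2_eq_square algebra_simps)
  moreover have "norm w ^ 2 > 0" using w by simp
  ultimately have "1 / 2 \<le> Re w / norm w ^ 2" by (simp add: field_simps)
  also have "\<dots> = Re (1 / w)" by (simp add: Re_divide cmod_power2)
  finally show ?thesis by (simp add: w_def)
qed

context rational_map
begin

lemma fixed_point_iff: "f (Fin a) = Fin a \<longleftrightarrow> poly ([:0, 1:] * r - p) a = 0"
  unfolding f_eq_iff_Fin by (simp add: fiber_poly_def) (auto simp: algebra_simps)

text \<open>
  The derivative of \<open>f\<close> at a fixed point, read off from the quotient of the forms \<open>fiber_poly y\<close> and
  \<open>denom_poly y\<close> whose numerator vanishes at \<open>y\<close>.
\<close>

definition multiplier :: "P1 \<Rightarrow> complex" where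
  "multiplier y = poly (pderiv (chart_poly y (fiber_poly y))) 0 / poly (chart_poly y (denom_poly y)) 0"

lemma multiplier_local_form:
  assumes fix_y: "f y = y"
  obtains F where "F analytic_on {0}" "F 0 = 0" "deriv F 0 = multiplier y"
    "\<forall>\<^sub>F t in nhds 0. f (local_param y t) = local_param y (F t)"
proof
  define S where "S = chart_poly y (fiber_poly y)"
  define D where "D = chart_poly y (denom_poly y)"
  have D0: "poly D 0 \<noteq> 0" using denom_nonzero[of y] by (simp add: D_def fix_y)
  have S0: "poly S 0 = 0" using f_eq_iff[of y y] fix_y by (simp add: S_def)
  let ?F = "\<lambda>t. poly S t / poly D t"
  show "?F analytic_on {0}" using D0 by (auto intro!: analytic_intros poly_analytic)
  show "?F 0 = 0" using S0 by simp
  have "(?F has_field_derivative (poly (pderiv S) 0 * poly D 0 - poly S 0 * poly (pderiv D) 0) / (poly D 0 * poly D 0)) (at 0)"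
    by (intro DERIV_divide poly_DERIV D0)
  then show "deriv ?F 0 = multiplier y"
    using D0 S0 by (simp add: DERIV_imp_deriv multiplier_def S_def D_def)
  show "\<forall>\<^sub>F t in nhds 0. f (local_param y t) = local_param y (?F t)"
    using f_local_form[of y] by (simp add: fix_y S_def D_def)
qed

text \<open>
  If every multiplier \<open>\<mu>\<close> were in the closed unit disc and different from \<open>1\<close>, all the fixed points
  would be simple, so there would be \<open>d + 1\<close> of them, each with \<open>Re (1/(1 - \<mu>)) \<ge> 1/2\<close>. But by
  Euler's identity for \<open>G(z) = z r(z) - p(z)\<close> and \<open>H = r\<close> the numbers \<open>1/(1 - \<mu>)\<close> add up to \<open>1\<close>. The
  roots of \<open>G\<close> are the finite fixed points; if infinity is fixed, the degree of \<open>G\<close> is only \<open>d\<close>, and the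
  missing term appears on the other side of the identity.
\<close>

lemma exists_repelling_or_parabolic_fixed_point:
  "\<exists>y. f y = y \<and> (multiplier y = 1 \<or> norm (multiplier y) > 1)"
proof (rule ccontr)
  assume "\<not> ?thesis"
  then have ne1: "multiplier y \<noteq> 1" and le1: "norm (multiplier y) \<le> 1" if "f y = y" for y
    using that by (auto simp: not_less)
  have half: "Re (1 / (1 - multiplier y)) \<ge> 1 / 2" if "f y = y" for y
    using Re_inverse_one_minus ne1 le1 that by blast
  define G where "G = [:0, 1:] * r - p"
  have fixG: "f (Fin a) = Fin a \<longleftrightarrow> poly G a = 0" for a
    unfolding G_def by (rule fixed_point_iff)
  have r0: "poly r a \<noteq> 0" if "poly G a = 0" for a
    using that no_common_root[of a] by (auto simp: G_def)
  have dG: "poly (pderiv G) a = poly r a * (1 - multiplier (Fin a))" if "poly G a = 0" for a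
  proof -
    have "multiplier (Fin a) = (poly (pderiv p) a - a * poly (pderiv r) a) / poly r a"
      by (simp add: multiplier_def chart_poly_def fiber_poly_def denom_poly_def
          pderiv_pcompose poly_pcompose pderiv_diff pderiv_smult pderiv_pCons)
    then show ?thesis
      using r0[OF that] by (simp add: G_def pderiv_diff pderiv_mult pderiv_pCons field_simps)
  qed
  have simple: "poly (pderiv G) a \<noteq> 0" if "poly G a = 0" for a
    using dG[OF that] r0[OF that] ne1[of "Fin a"] fixG[of a] that by simp
  have sum_ge: "Re (coeff r (degree G - 1) / lead_coeff G) \<ge> real (degree G) / 2" if "degree r < degree G"
  proof -
    note S = sum_over_simple_roots[of G r, OF simple that]
    have "real (degree G) / 2 = (\<Sum>a | poly G a = 0. 1 / 2)" using S(2) by simp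
    also have "\<dots> \<le> (\<Sum>a | poly G a = 0. Re (poly r a / poly (pderiv G) a))"
    proof (rule sum_mono)
      fix a assume "a \<in> {a. poly G a = 0}"
      then have a: "poly G a = 0" by simp
      have "poly r a / poly (pderiv G) a = 1 / (1 - multiplier (Fin a))"
        using dG[OF a] r0[OF a] by simp
      then show "1 / 2 \<le> Re (poly r a / poly (pderiv G) a)"
        using half[of "Fin a"] fixG[of a] a by simp
    qed
    also have "\<dots> = Re (coeff r (degree G - 1) / lead_coeff G)"
      using S(1) by (simp add: Re_sum[symmetric] del: Re_sum)
    finally show ?thesis .
  qed
  have coeff_G: "coeff G (Suc n) = coeff r n - coeff p (Suc n)" for n
    by (simp add: G_def)
  show False
  proof (cases "coeff r d = 0")
    case False
    have "coeff G (Suc d) = coeff r d" using degree_le_d by (simp add: coeff_G coeff_eq_0)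
    moreover have "degree G \<le> Suc d"
    proof (rule degree_le, intro allI impI)
      fix i assume "i > Suc d"
      then obtain j where "i = Suc j" "j > d" by (cases i) auto
      then show "coeff G i = 0" using degree_le_d by (simp add: coeff_G coeff_eq_0)
    qed
    ultimately have deg: "degree G = Suc d" using False le_degree[of G "Suc d"] by auto
    have "real (Suc d) / 2 \<le> 1"
      using sum_ge degree_le_d False \<open>coeff G (Suc d) = coeff r d\<close> by (simp add: deg)
    then show False using d_gt_1 by simp
  next
    case True
    then have fixI: "f Infty = Infty" by (simp add: f_eq_iff_Infty fiber_poly_def)
    have pd: "coeff p d \<noteq> 0" using coeff_d True by simp
    obtain m where m: "d = Suc m" using d_gt_1 by (cases d) auto
    have rd: "degree r \<le> m"
    proof -
      have "degree r \<noteq> d" using True d_gt_1 by (metis degree_0 leading_coeff_0_iff not_one_less_zero)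
      then show ?thesis using degree_le_d(2) m by linarith
    qed
    have mult: "multiplier Infty = coeff r m / coeff p d"
      unfolding multiplier_def chart_poly_def fiber_poly_def denom_poly_def
      by (simp add: poly_0_coeff_0 coeff_pderiv coeff_homogenize m)
    have cG: "coeff G d = coeff p d * (multiplier Infty - 1)"
    proof -
      have "coeff G d = coeff r m - coeff p d" by (simp add: m coeff_G)
      then show ?thesis using pd mult by (simp add: field_simps)
    qed
    have "coeff G d \<noteq> 0" using cG pd ne1[OF fixI] by simp
    moreover have "degree G \<le> d"
    proof (rule degree_le, intro allI impI)
      fix i assume "i > d"
      then obtain j where "i = Suc j" "j > m" using m by (cases i) auto
      then show "coeff G i = 0" using rd degree_le_d m by (simp add: coeff_G coeff_eq_0)
    qed
    ultimately have deg: "degree G = d" using le_degree[of G d] by auto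
    have "real d / 2 \<le> Re (coeff r m / coeff G d)"
      using sum_ge rd by (simp add: deg m)
    also have "coeff r m / coeff G d = 1 - 1 / (1 - multiplier Infty)"
    proof -
      have aux: "c * \<mu> / (c * (\<mu> - 1)) = 1 - 1 / (1 - \<mu>)" if "c \<noteq> 0" "\<mu> \<noteq> 1" for c \<mu> :: complex
      proof -
        have "1 - \<mu> \<noteq> 0" "\<mu> - 1 \<noteq> 0" using that by auto
        then show ?thesis using that(1) by (simp add: divide_simps) (simp add: algebra_simps)
      qed
      have "coeff r m = coeff p d * multiplier Infty" using pd mult by simp
      then show ?thesis unfolding cG using aux[OF pd ne1[OF fixI]] by simp
    qed
    also have "Re \<dots> \<le> 1 / 2" using half[OF fixI] by simp
    finally show False using d_gt_1 by simp
  qed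
qed

end

section \<open>Invariant sections of powers of the canonical bundle\<close>

lemma analytic_eventually:
  assumes "F analytic_on {z}"
  shows "\<forall>\<^sub>F w in nhds z. F analytic_on {w}"
proof -
  obtain A where A: "open A" "z \<in> A" "F holomorphic_on A" using assms unfolding analytic_at by blast
  then have "\<forall>w\<in>A. F analytic_on {w}" unfolding analytic_at by blast
  then show ?thesis using A eventually_nhds by blast
qed

lemma analytic_eventually_nonzero:
  assumes "F analytic_on {z}" "F z \<noteq> (0::complex)"
  shows "\<forall>\<^sub>F w in nhds z. F w \<noteq> 0"
  using analytic_tendsto_nhds[OF assms(1)] assms(2) tendsto_imp_eventually_ne by blast

lemma eventually_at_analytic_compose:
  assumes F: "F analytic_on {z}" "F z = x" and ne: "\<forall>\<^sub>F w in at z. F w \<noteq> x" and P: "\<forall>\<^sub>F t in at x. P t"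
  shows "\<forall>\<^sub>F w in at z. P (F w)"
proof -
  have "filterlim F (at x) (at z)"
    using analytic_tendsto[OF F(1)] ne F(2) by (simp add: filterlim_at)
  with P show ?thesis by (rule eventually_compose_filterlim)
qed

lemma meromorphic_factor:
  assumes mero: "h meromorphic_on {z}" and nz: "\<exists>\<^sub>F w in at z. h w \<noteq> 0"
  shows "\<exists>u. u analytic_on {z} \<and> u z \<noteq> 0 \<and> (\<forall>\<^sub>F w in at z. h w = u w * (w - z) powi (zorder h z))"
proof -
  obtain R where R: "zor_poly h z z \<noteq> 0" "R > 0" "zor_poly h z holomorphic_on cball z R"
    "\<forall>w\<in>cball z R - {z}. h w = zor_poly h z w * (w - z) powi (zorder h z) \<and> zor_poly h z w \<noteq> 0"
    using zorder_exist[of h z] mero nz unfolding meromorphic_at_iff by blast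
  have "zor_poly h z analytic_on {z}"
    unfolding analytic_at using R by (intro exI[of _ "ball z R"]) (auto intro: holomorphic_on_subset)
  moreover have "\<forall>\<^sub>F w in at z. w \<in> ball z R - {z}"
    using R(2) by (intro eventually_at_in_open) auto
  then have "\<forall>\<^sub>F w in at z. h w = zor_poly h z w * (w - z) powi (zorder h z)"
    by eventually_elim (use R(4) in auto)
  ultimately show ?thesis using R(1) by blast
qed

lemma meromorphic_frequently_eq:
  assumes "g meromorphic_on {z}" "h meromorphic_on {z}" "\<exists>\<^sub>F w in at z. g w = h w"
  shows "\<forall>\<^sub>F w in at z. g w = h w"
proof -
  have "(\<lambda>w. g w - h w) meromorphic_on {z}" by (intro meromorphic_intros assms)
  then have "\<forall>\<^sub>F w in at z. g w - h w = 0"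
    unfolding meromorphic_at_iff
    using not_essential_frequently_0_imp_eventually_0[of "\<lambda>w. g w - h w" z] assms(3) by simp
  then show ?thesis by eventually_elim simp
qed

text \<open>
  The exceptional points may accumulate at infinity, so the property need not hold in a whole
  punctured neighbourhood of infinity; it does hold at points arbitrarily close to infinity.
\<close>

lemma frequently_inverse_cosparse:
  assumes "\<forall>\<^sub>\<approx>z. P z"
  shows "\<exists>\<^sub>F t in at 0. P (1 / t :: complex)"
  unfolding frequently_def
proof
  assume "\<forall>\<^sub>F t in at 0. \<not> P (1 / t :: complex)"
  then obtain A where A: "open A" "0 \<in> A" "\<And>t. t \<in> A \<Longrightarrow> t \<noteq> 0 \<Longrightarrow> \<not> P (1 / t)"
    unfolding eventually_at_topological by blast
  obtain e where e: "e > 0" "ball 0 e \<subseteq> A" using A openE by blast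
  define s where "s = complex_of_real (e / 2)"
  have s: "s \<noteq> 0" "s \<in> ball 0 e" using e by (auto simp: s_def)
  have "isCont (\<lambda>t. 1 / t) s" using s by (intro continuous_intros) auto
  then have "filterlim (\<lambda>t. 1 / t) (at (1 / s)) (at s)"
    using s by (auto simp: filterlim_at isCont_def eventually_at_filter)
  moreover have "\<forall>\<^sub>F z in at (1 / s). P z"
    using assms eventually_cosparse_imp_eventually_at by blast
  ultimately have "\<forall>\<^sub>F t in at s. P (1 / t)" by (rule eventually_compose_filterlim[rotated])
  moreover have "\<forall>\<^sub>F t in at s. t \<in> ball 0 e - {0}"
    using s by (intro eventually_at_in_open') auto
  ultimately have "\<forall>\<^sub>F t in at s. False"
    by eventually_elim (use A e in auto)
  then show False by simp
qed

locale invariant_section = rational_map +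
  fixes k :: nat and c :: complex and q :: "complex \<Rightarrow> complex"
  assumes k_ge_1: "k \<ge> 1" and c_nonzero: "c \<noteq> 0"
    and mero_q: "meromorphic_section k q" and q_nonzero: "\<not> section_eq q (\<lambda>_. 0)"
    and q_invariant: "section_eq (pullback k f q) (\<lambda>z. c * q z)"
begin

text \<open>
  The pullback of \<open>q\<close> along \<open>h\<close>, divided by \<open>dz^k\<close>. The finite chart suffices, as \<open>h\<close> will take the
  value \<open>Infty\<close> only at isolated points.
\<close>

definition pull :: "(complex \<Rightarrow> P1) \<Rightarrow> complex \<Rightarrow> complex" where
  "pull h z = q (coord (h z)) * deriv (\<lambda>w. coord (h w)) z ^ k"

abbreviation loc :: "P1 \<Rightarrow> complex \<Rightarrow> complex" where
  "loc x \<equiv> pull (local_param x)"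

lemma pull_cong:
  assumes "\<forall>\<^sub>F w in nhds z. h w = g w"
  shows "pull h z = pull g z"
proof -
  have "h z = g z" using assms eventually_nhds_x_imp_x by blast
  moreover have "deriv (\<lambda>w. coord (h w)) z = deriv (\<lambda>w. coord (g w)) z"
    by (rule deriv_cong_ev) (use assms in \<open>auto elim: eventually_mono\<close>)
  ultimately show ?thesis by (simp add: pull_def)
qed

lemma coord_local_param_derivative:
  assumes "t \<noteq> 0"
  shows "(\<lambda>w. coord (local_param x w)) field_differentiable at t"
proof (cases x)
  case (Fin a)
  then show ?thesis by (auto intro!: derivative_intros)
next
  case Infty
  have "(\<lambda>w. 1 / w :: complex) field_differentiable at t"
    using assms by (intro derivative_intros) auto
  moreover have "coord (local_param x w) = 1 / w" for w using Infty by simp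
  ultimately show ?thesis by simp
qed

lemma loc_Fin: "loc (Fin a) t = q (a + t)"
proof -
  have "deriv (\<lambda>w. a + w) t = 1" by (intro DERIV_imp_deriv derivative_eq_intros) auto
  then show ?thesis by (simp add: pull_def)
qed

lemma loc_Infty:
  assumes "t \<noteq> 0"
  shows "loc Infty t = q (1 / t) * (- 1 / t ^ 2) ^ k"
proof -
  have "deriv (\<lambda>w. 1 / w) t = - 1 / t ^ 2"
    using assms by (intro DERIV_imp_deriv) (auto intro!: derivative_eq_intros simp: power2_eq_square)
  moreover have "coord (local_param Infty w) = 1 / w" for w by simp
  ultimately show ?thesis by (simp add: pull_def)
qed

lemma pull_chain:
  assumes F: "F analytic_on {z}" and ne: "\<forall>\<^sub>F w in at z. F w \<noteq> 0"
    and h: "\<forall>\<^sub>F w in nhds z. h w = local_param x (F w)"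
  shows "\<forall>\<^sub>F w in at z. (\<lambda>w. coord (h w)) field_differentiable at w \<and>
           pull h w = loc x (F w) * deriv F w ^ k"
proof -
  have "\<forall>\<^sub>F w in nhds z. \<forall>\<^sub>F v in nhds w. h v = local_param x (F v)"
    using h by (simp add: eventually_eventually)
  then have "\<forall>\<^sub>F w in at z. \<forall>\<^sub>F v in nhds w. h v = local_param x (F v)"
    by (simp add: eventually_nhds_conv_at)
  moreover have "\<forall>\<^sub>F w in at z. F analytic_on {w}"
    using analytic_eventually[OF F] by (simp add: eventually_nhds_conv_at)
  ultimately show ?thesis using ne
  proof eventually_elim
    case (elim w)
    have Fd: "F field_differentiable at w" using elim(2) by (simp add: analytic_on_imp_differentiable_at)
    note cd = coord_local_param_derivative[OF elim(3), of x]
    have ev: "\<forall>\<^sub>F v in nhds w. coord (h v) = ((\<lambda>s. coord (local_param x s)) \<circ> F) v"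
      using elim(1) by eventually_elim simp
    have "((\<lambda>s. coord (local_param x s)) \<circ> F) field_differentiable at w"
      by (rule field_differentiable_compose[OF Fd cd])
    then have "(\<lambda>w. coord (h w)) field_differentiable at w"
      using DERIV_cong_ev[OF refl ev refl] by (simp add: field_differentiable_def o_def)
    moreover have "deriv (\<lambda>w. coord (h w)) w = deriv ((\<lambda>s. coord (local_param x s)) \<circ> F) w"
      by (rule deriv_cong_ev[OF ev refl])
    then have "deriv (\<lambda>w. coord (h w)) w = deriv (\<lambda>s. coord (local_param x s)) (F w) * deriv F w"
      by (simp only: deriv_chain[OF Fd cd])
    moreover have "h w = local_param x (F w)" using elim(1) eventually_nhds_x_imp_x by blast
    ultimately show ?case by (simp add: pull_def power_mult_distrib)
  qed
qed

definition ord :: "P1 \<Rightarrow> int" where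
  "ord x = zorder (loc x) 0"

lemma q_cosparse_nonzero: "\<forall>\<^sub>\<approx>z. q z \<noteq> 0"
  using meromorphic_imp_constant_or_avoid[of q UNIV 0] mero_q q_nonzero
  unfolding meromorphic_section_def section_eq_def by auto

lemma loc_factor:
  "\<exists>u. u analytic_on {0} \<and> u 0 \<noteq> 0 \<and> (\<forall>\<^sub>F t in at 0. loc x t = u t * t powi (ord x))"
proof -
  have "loc x meromorphic_on {0} \<and> (\<exists>\<^sub>F t in at 0. loc x t \<noteq> 0)"
  proof (cases x)
    case (Fin a)
    have "loc x = q \<circ> (\<lambda>t. a + t)" by (simp add: Fin loc_Fin fun_eq_iff)
    moreover have "(q \<circ> (\<lambda>t. a + t)) meromorphic_on {0}"
      unfolding o_def
      by (rule meromorphic_on_compose[of q UNIV]) (use mero_q in \<open>auto simp: meromorphic_section_def intro!: analytic_intros\<close>)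
    moreover have "\<forall>\<^sub>F w in at a. q w \<noteq> 0"
      using q_cosparse_nonzero eventually_cosparse_imp_eventually_at by blast
    then have "\<forall>\<^sub>F t in at 0. q (a + t) \<noteq> 0"
      by (subst (asm) at_to_0) (simp add: eventually_filtermap add.commute)
    ultimately show ?thesis by (auto simp: eventually_frequently)
  next
    case Infty
    have eq: "\<forall>\<^sub>F t in at 0. loc x t = q (1 / t) * (- 1 / t ^ 2) ^ k"
      by (auto simp: eventually_at_filter Infty loc_Infty simp del: local_param.simps)
    have "(\<lambda>t. q (1 / t) * (- 1 / t ^ 2) ^ k) meromorphic_on {0}"
      using mero_q meromorphic_on_subset unfolding meromorphic_section_def by blast
    then have 1: "loc x meromorphic_on {0}"
      using meromorphic_on_cong[of "{0}" "loc x", OF _ refl] eq by auto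
    have "\<exists>\<^sub>F t in at 0. q (1 / t) \<noteq> 0"
      using frequently_inverse_cosparse[OF q_cosparse_nonzero] .
    then have "\<exists>\<^sub>F t in at 0. loc x t \<noteq> 0"
    proof (rule frequently_rev_mp)
      show "\<forall>\<^sub>F t in at 0. q (1 / t) \<noteq> 0 \<longrightarrow> loc x t \<noteq> 0"
        by (auto simp: eventually_at_filter Infty loc_Infty simp del: local_param.simps)
    qed
    with 1 show ?thesis by blast
  qed
  then show ?thesis using meromorphic_factor[of "loc x" 0] by (simp add: ord_def)
qed

lemma meromorphic_loc: "loc x meromorphic_on {0}"
proof -
  obtain u where u: "u analytic_on {0}" "\<forall>\<^sub>F t in at 0. loc x t = u t * t powi (ord x)"
    using loc_factor by blast
  have "(\<lambda>t. u t * t powi (ord x)) meromorphic_on {0}"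
    by (intro meromorphic_intros analytic_on_imp_meromorphic_on u)
  then show ?thesis
    using meromorphic_on_cong[of "{0}" "loc x", OF _ refl] u(2) by auto
qed

text \<open>
  At infinity the invariance of \<open>q\<close> is at first known only off a set that may accumulate there. Both
  sides are meromorphic in the local parameter, so agreement at points tending to it suffices.
\<close>

lemma local_invariance:
  assumes G: "G analytic_on {0}" "G 0 = 0" and ne: "\<forall>\<^sub>F t in at 0. G t \<noteq> 0"
    and f_G: "\<forall>\<^sub>F t in nhds 0. f (local_param x t) = local_param (f x) (G t)"
  shows "\<forall>\<^sub>F t in at 0. loc (f x) (G t) * deriv G t ^ k = c * loc x t"
proof (rule meromorphic_frequently_eq)
  note chain = pull_chain[OF G(1) ne f_G]
  obtain u where u: "u analytic_on {0}" "\<forall>\<^sub>F t in at 0. loc (f x) t = u t * t powi (ord (f x))"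
    using loc_factor by blast
  have "\<forall>\<^sub>F t in at 0. loc (f x) (G t) = u (G t) * G t powi (ord (f x))"
    using eventually_at_analytic_compose[OF G ne u(2)] .
  moreover have "(\<lambda>t. u (G t)) analytic_on {0}"
    using analytic_on_compose_gen[OF G(1), of u "{0}"] u(1) G(2) by (simp add: o_def)
  then have "(\<lambda>t. u (G t) * G t powi (ord (f x)) * deriv G t ^ k) meromorphic_on {0}"
    using G(1) by (intro meromorphic_intros analytic_on_imp_meromorphic_on) (auto intro: analytic_intros)
  ultimately show "(\<lambda>t. loc (f x) (G t) * deriv G t ^ k) meromorphic_on {0}"
    by (subst meromorphic_on_cong[OF _ refl, of _ _ "\<lambda>t. u (G t) * G t powi (ord (f x)) * deriv G t ^ k"])
       (auto elim: eventually_mono)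
  show "(\<lambda>t. c * loc x t) meromorphic_on {0}"
    by (intro meromorphic_intros meromorphic_loc)
  show "\<exists>\<^sub>F t in at 0. loc (f x) (G t) * deriv G t ^ k = c * loc x t"
  proof (cases x)
    case (Fin a)
    have "\<forall>\<^sub>F w in at a. pullback k f q w = c * q w"
      using q_invariant eventually_cosparse_imp_eventually_at unfolding section_eq_def by blast
    then have "\<forall>\<^sub>F t in at 0. pullback k f q (a + t) = c * q (a + t)"
      by (subst (asm) at_to_0) (simp add: eventually_filtermap add.commute)
    then have "\<forall>\<^sub>F t in at 0. loc (f x) (G t) * deriv G t ^ k = c * loc x t"
      using chain
    proof eventually_elim
      case (elim t)
      have "deriv (\<lambda>w. coord (f (Fin (a + w)))) t = deriv (\<lambda>w. coord (f (Fin w))) (a + t)"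
        unfolding deriv_def using DERIV_shift[of "\<lambda>w. coord (f (Fin w))" _ t a] by (simp add: add.commute)
      then have "pull (\<lambda>t. f (local_param x t)) t = pullback k f q (a + t)"
        by (simp add: pull_def pullback_def Fin)
      then show ?case using elim by (simp add: Fin loc_Fin)
    qed
    then show ?thesis by (simp add: eventually_frequently)
  next
    case Infty
    have "\<exists>\<^sub>F t in at 0. pullback k f q (1 / t) = c * q (1 / t)"
      using frequently_inverse_cosparse q_invariant unfolding section_eq_def .
    then show ?thesis
    proof (rule frequently_rev_mp)
      have "\<forall>\<^sub>F t in at 0. t \<noteq> (0::complex)" by (simp add: eventually_at_filter)
      with chain show "\<forall>\<^sub>F t in at 0. pullback k f q (1 / t) = c * q (1 / t) \<longrightarrow>
          loc (f x) (G t) * deriv G t ^ k = c * loc x t"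
      proof eventually_elim
        case (elim t)
        define \<phi> where "\<phi> = (\<lambda>w. coord (f (local_param Infty w)))"
        have d: "\<phi> field_differentiable at (1 / (1 / t))"
          using elim(1) Infty by (simp add: \<phi>_def)
        have "\<forall>\<^sub>F w in nhds (1 / t). coord (f (Fin w)) = (\<phi> \<circ> (\<lambda>w. 1 / w)) w"
        proof -
          have "\<forall>\<^sub>F w in nhds (1 / t). w \<noteq> 0" using elim(2) by (intro t1_space_nhds) auto
          then show ?thesis by eventually_elim (simp add: \<phi>_def)
        qed
        then have "deriv (\<lambda>w. coord (f (Fin w))) (1 / t) = deriv (\<phi> \<circ> (\<lambda>w. 1 / w)) (1 / t)"
          by (rule deriv_cong_ev) simp
        also have "\<dots> = deriv \<phi> (1 / (1 / t)) * deriv (\<lambda>w. 1 / w) (1 / t)"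
          using elim(2) d by (intro deriv_chain) (auto intro!: derivative_intros)
        also have "deriv (\<lambda>w. 1 / w) (1 / t) = - (t ^ 2)"
          using elim(2) by (intro DERIV_imp_deriv) (auto intro!: derivative_eq_intros simp: power2_eq_square)
        finally have D: "deriv \<phi> t = deriv (\<lambda>w. coord (f (Fin w))) (1 / t) * (- 1 / t ^ 2)"
          using elim(2) by simp
        have "pull (\<lambda>t. f (local_param x t)) t = pullback k f q (1 / t) * (- 1 / t ^ 2) ^ k"
        proof -
          have "pull (\<lambda>t. f (local_param x t)) t = q (coord (f (Fin (1 / t)))) * deriv \<phi> t ^ k"
            using elim(2) by (simp add: pull_def \<phi>_def Infty)
          then show ?thesis unfolding D power_mult_distrib by (simp add: pullback_def)
        qed
        then show ?case using elim loc_Infty[OF elim(2)] Infty by (auto simp: mult_ac)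
      qed
    qed
  qed
qed

lemma f_local_coord:
  obtains G where "G analytic_on {0}" "G 0 = 0" "\<forall>\<^sub>F t in at 0. G t \<noteq> 0"
    "\<forall>\<^sub>F t in nhds 0. f (local_param x t) = local_param (f x) (G t)"
    "\<forall>\<^sub>F t in at 0. loc (f x) (G t) * deriv G t ^ k = c * loc x t"
    "\<exists>g. g analytic_on {0} \<and> g 0 \<noteq> 0 \<and> G = (\<lambda>t. t ^ local_degree f x * g t)"
proof -
  obtain g where g: "g analytic_on {0}" "g 0 \<noteq> 0"
    and eq: "\<forall>\<^sub>F t in nhds 0. f (local_param x t) = local_param (f x) (t ^ local_degree f x * g t)"
    using f_local_factor by blast
  define G where "G = (\<lambda>t. t ^ local_degree f x * g t)"
  have G: "G analytic_on {0}" "G 0 = 0"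
    unfolding G_def using g local_degree_ge_1[of x] by (auto intro!: analytic_intros)
  have "\<forall>\<^sub>F t in at 0. g t \<noteq> 0"
    using analytic_eventually_nonzero[OF g] by (simp add: eventually_nhds_conv_at)
  moreover have "\<forall>\<^sub>F t in at 0. t \<noteq> (0::complex)" by (simp add: eventually_at_filter)
  ultimately have ne: "\<forall>\<^sub>F t in at 0. G t \<noteq> 0" by eventually_elim (simp add: G_def)
  have eq': "\<forall>\<^sub>F t in nhds 0. f (local_param x t) = local_param (f x) (G t)"
    using eq by (simp add: G_def)
  show thesis
    by (rule that[OF G ne eq' local_invariance[OF G ne eq']]) (use g G_def in blast)
qed

lemma pull_f_compose:
  assumes F: "F analytic_on {z}" "F z = 0" and ne: "\<forall>\<^sub>F w in at z. F w \<noteq> 0"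
    and h: "\<forall>\<^sub>F w in nhds z. h w = local_param x (F w)"
  shows "\<forall>\<^sub>F w in at z. pull (\<lambda>w. f (h w)) w = c * pull h w"
proof -
  obtain G where G: "G analytic_on {0}" "G 0 = 0" and Gne: "\<forall>\<^sub>F t in at 0. G t \<noteq> 0"
    and fG: "\<forall>\<^sub>F t in nhds 0. f (local_param x t) = local_param (f x) (G t)"
    and inv: "\<forall>\<^sub>F t in at 0. loc (f x) (G t) * deriv G t ^ k = c * loc x t"
    using f_local_coord .
  have GF: "(\<lambda>w. G (F w)) analytic_on {z}"
    using analytic_on_compose_gen[OF F(1), of G "{0}"] G(1) F(2) by (simp add: o_def)
  have GF0: "\<forall>\<^sub>F w in at z. G (F w) \<noteq> 0"
    by (rule eventually_at_analytic_compose[OF F ne Gne])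
  have fh: "\<forall>\<^sub>F w in nhds z. f (h w) = local_param (f x) (G (F w))"
    using eventually_compose_filterlim[OF fG analytic_tendsto_nhds[OF F(1), unfolded F(2)]] h
    by eventually_elim simp
  have "\<forall>\<^sub>F t in at 0. G analytic_on {t}"
    using analytic_eventually[OF G(1)] by (simp add: eventually_nhds_conv_at)
  then have Gan: "\<forall>\<^sub>F w in at z. G analytic_on {F w}"
    by (rule eventually_at_analytic_compose[OF F ne])
  have Fan: "\<forall>\<^sub>F w in at z. F analytic_on {w}"
    using analytic_eventually[OF F(1)] by (simp add: eventually_nhds_conv_at)
  show ?thesis
    using pull_chain[OF GF GF0 fh] pull_chain[OF F(1) ne h] Gan Fan
      eventually_at_analytic_compose[OF F ne inv]
  proof eventually_elim
    case (elim w)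
    have "deriv (\<lambda>w. G (F w)) w = deriv G (F w) * deriv F w"
      using deriv_chain[of F w G] elim(3,4) by (simp add: o_def analytic_on_imp_differentiable_at)
    then have "pull (\<lambda>w. f (h w)) w = (loc (f x) (G (F w)) * deriv G (F w) ^ k) * deriv F w ^ k"
      using elim(1) by (simp add: power_mult_distrib)
    also have "\<dots> = c * pull h w" using elim(2,5) by simp
    finally show ?case .
  qed
qed

text \<open>
  The order of the section, shifted by \<open>k\<close> because \<open>t = s^e\<close> turns \<open>t^a dt^k\<close> into a multiple of
  \<open>s^(e (a + k) - k) ds^k\<close>: ramification of order \<open>e\<close> multiplies \<open>b\<close> by \<open>e\<close>.
\<close>

definition b :: "P1 \<Rightarrow> int" where
  "b x = ord x + int k"

lemma loc_pull_factor:
  assumes g: "g analytic_on {0}" "g 0 \<noteq> 0" and e: "e \<ge> 1"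
  shows "\<exists>V. V analytic_on {0} \<and> V 0 \<noteq> 0 \<and>
     (\<forall>\<^sub>F t in at 0. loc x (t ^ e * g t) * deriv (\<lambda>t. t ^ e * g t) t ^ k = V t * t powi (int e * b x - int k))"
proof -
  define G where "G = (\<lambda>t. t ^ e * g t)"
  obtain u where u: "u analytic_on {0}" "u 0 \<noteq> 0" "\<forall>\<^sub>F t in at 0. loc x t = u t * t powi (ord x)"
    using loc_factor by blast
  have G: "G analytic_on {0}" "G 0 = 0" unfolding G_def using g e by (auto intro!: analytic_intros)
  have gne: "\<forall>\<^sub>F t in at 0. g t \<noteq> 0"
    using analytic_eventually_nonzero[OF g] by (simp add: eventually_nhds_conv_at)
  have tne: "\<forall>\<^sub>F t in at 0. t \<noteq> (0::complex)" by (simp add: eventually_at_filter)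
  have ne: "\<forall>\<^sub>F t in at 0. G t \<noteq> 0" using gne tne by eventually_elim (simp add: G_def)
  have gan: "\<forall>\<^sub>F t in at 0. g analytic_on {t}"
    using analytic_eventually[OF g(1)] by (simp add: eventually_nhds_conv_at)
  \<comment> \<open>\<open>G' t = t^(e-1) (e g t + t g' t)\<close>, so all the powers of \<open>t\<close> split off and \<open>V\<close> is what remains.\<close>
  define V where "V = (\<lambda>t. u (G t) * g t powi (ord x) * (of_nat e * g t + t * deriv g t) ^ k)"
  have "(\<lambda>t. u (G t)) analytic_on {0}"
    using analytic_on_compose_gen[OF G(1), of u "{0}"] u(1) G(2) by (simp add: o_def)
  then have "V analytic_on {0}" unfolding V_def using g by (intro analytic_intros) auto
  moreover have "V 0 \<noteq> 0" unfolding V_def using u(2) g e G(2) by simp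
  moreover have "\<forall>\<^sub>F t in at 0. loc x (G t) * deriv G t ^ k = V t * t powi (int e * b x - int k)"
    using eventually_at_analytic_compose[OF G ne u(3)] gne tne gan
  proof eventually_elim
    case (elim t)
    have "(G has_field_derivative of_nat e * t ^ (e - 1) * g t + t ^ e * deriv g t) (at t)"
      unfolding G_def using analytic_derivI[OF elim(4)] by (auto intro!: derivative_eq_intros)
    then have "deriv G t = of_nat e * t ^ (e - 1) * g t + t ^ e * deriv g t" by (rule DERIV_imp_deriv)
    also have "\<dots> = t ^ (e - 1) * (of_nat e * g t + t * deriv g t)"
      using e by (cases e) (simp_all add: algebra_simps)
    finally have dG: "deriv G t = t ^ (e - 1) * (of_nat e * g t + t * deriv g t)" .
    have "G t powi (ord x) = t powi (int e * ord x) * g t powi (ord x)"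
      by (simp add: G_def power_int_mult_distrib power_int_mult flip: power_int_of_nat)
    moreover have "(t ^ (e - 1)) ^ k = t powi (int e * int k - int k)"
    proof -
      have "int e * int k - int k = int ((e - 1) * k)" using e by (simp add: of_nat_diff algebra_simps)
      then show ?thesis by (simp only: power_int_of_nat power_mult)
    qed
    moreover have "t powi (int e * ord x) * t powi (int e * int k - int k) = t powi (int e * b x - int k)"
      using elim(3) by (simp add: b_def algebra_simps flip: power_int_add)
    ultimately show ?case
      using elim(1) by (simp add: dG V_def power_mult_distrib mult_ac)
  qed
  ultimately show ?thesis unfolding G_def by blast
qed

lemma b_multiplicative: "b y = int (local_degree f y) * b (f y)"
proof -
  obtain G where inv: "\<forall>\<^sub>F t in at 0. loc (f y) (G t) * deriv G t ^ k = c * loc y t"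
    and G: "\<exists>g. g analytic_on {0} \<and> g 0 \<noteq> 0 \<and> G = (\<lambda>t. t ^ local_degree f y * g t)"
    using f_local_coord .
  then obtain g where g: "g analytic_on {0}" "g 0 \<noteq> 0" and Geq: "G = (\<lambda>t. t ^ local_degree f y * g t)"
    by blast
  obtain V where V: "V analytic_on {0}" "V 0 \<noteq> 0"
    and eq: "\<forall>\<^sub>F t in at 0. loc (f y) (G t) * deriv G t ^ k = V t * t powi (int (local_degree f y) * b (f y) - int k)"
    using loc_pull_factor[OF g local_degree_ge_1[of y]] unfolding Geq by blast
  have "zorder (loc y) 0 = int (local_degree f y) * b (f y) - int k"
  proof (rule zorder_eq_if_eventually)
    show "(\<lambda>t. V t / c) analytic_on {0}" using V c_nonzero by (intro analytic_intros) auto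
    show "V 0 / c \<noteq> 0" using V c_nonzero by simp
    show "\<forall>\<^sub>F t in at 0. loc y t = V t / c * (t - 0) powi (int (local_degree f y) * b (f y) - int k)"
      using inv eq by eventually_elim (use c_nonzero in \<open>simp add: field_simps\<close>)
  qed
  then show ?thesis by (simp add: b_def ord_def)
qed

end

section \<open>The orbifold of an invariant section\<close>

lemma eventually_at_nhds:
  assumes "\<forall>\<^sub>F w in at (a :: complex). P w"
  shows "\<forall>\<^sub>F w in at a. \<forall>\<^sub>F v in nhds w. P v"
proof -
  obtain A where A: "open A" "a \<in> A" "\<And>w. w \<in> A \<Longrightarrow> w \<noteq> a \<Longrightarrow> P w"
    using assms unfolding eventually_at_topological by blast
  have op: "open (A - {a})" using A(1) by auto
  have "\<forall>\<^sub>F w in at a. w \<in> A - {a}" using A by (intro eventually_at_in_open) auto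
  then show ?thesis
  proof eventually_elim
    case (elim w)
    then show ?case using op A(3) unfolding eventually_nhds by (intro exI[of _ "A - {a}"]) auto
  qed
qed

lemma eventually_at_shift: "(\<forall>\<^sub>F w in at a. P w) \<longleftrightarrow> (\<forall>\<^sub>F t in at 0. P (a + t))" for a :: complex
  by (subst at_to_0) (simp add: eventually_filtermap add.commute)

lemma eventually_nhds_shift: "(\<forall>\<^sub>F w in nhds a. P w) \<longleftrightarrow> (\<forall>\<^sub>F t in nhds 0. P (a + t))" for a :: complex
  by (subst nhds_to_0) (simp add: eventually_filtermap)

lemma filterlim_inverse_at:
  assumes "t \<noteq> (0::complex)"
  shows "filterlim (\<lambda>z. 1 / z) (at t) (at (1 / t))" "filterlim (\<lambda>z. 1 / z) (nhds t) (nhds (1 / t))"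
proof -
  have "isCont (\<lambda>z. 1 / z) (1 / t)" using assms by (intro continuous_intros) auto
  then have lim: "(\<lambda>z. 1 / z) \<midarrow>1 / t\<rightarrow> t" by (simp add: isCont_def)
  moreover have "\<forall>\<^sub>F z in at (1 / t). 1 / z \<noteq> t"
  proof -
    have "1 / z \<noteq> t" if "z \<noteq> 1 / t" for z using that by auto
    then show ?thesis by (auto simp: eventually_at_filter intro: always_eventually)
  qed
  ultimately show "filterlim (\<lambda>z. 1 / z) (at t) (at (1 / t))" by (simp add: filterlim_at)
  show "filterlim (\<lambda>z. 1 / z) (nhds t) (nhds (1 / t))"
    using lim tendsto_at_iff_tendsto_nhds[of "\<lambda>z. 1 / z" "1 / t"] by simp
qed

context invariant_section
begin

lemma ord_Fin_eq_0:
  assumes q: "\<forall>\<^sub>F z in nhds w. q z = v z" and v: "v analytic_on {w}" "v w \<noteq> 0"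
  shows "ord (Fin w) = 0"
  unfolding ord_def
proof (rule zorder_eq_if_eventually)
  have "(\<lambda>s. w + s) analytic_on {0}" by (intro analytic_intros)
  then show "(\<lambda>s. v (w + s)) analytic_on {0}"
    using analytic_on_compose_gen[of "\<lambda>s. w + s" "{0}" v "{w}"] v(1) by (simp add: o_def)
  show "v (w + 0) \<noteq> 0" using v by simp
  have "\<forall>\<^sub>F s in nhds 0. q (w + s) = v (w + s)" using q by (simp add: eventually_nhds_shift[of _ w])
  then have "\<forall>\<^sub>F s in at 0. q (w + s) = v (w + s)" by (simp add: eventually_nhds_conv_at)
  then show "\<forall>\<^sub>F s in at 0. loc (Fin w) s = v (w + s) * (s - 0) powi 0"
    by eventually_elim (simp add: loc_Fin del: local_param.simps)
qed

lemma q_factor: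
  "\<exists>u. u analytic_on {0} \<and> u 0 \<noteq> 0 \<and> (\<forall>\<^sub>F z in at a. q z = u (z - a) * (z - a) powi (ord (Fin a)))"
proof -
  obtain u where u: "u analytic_on {0}" "u 0 \<noteq> 0" "\<forall>\<^sub>F t in at 0. loc (Fin a) t = u t * t powi (ord (Fin a))"
    using loc_factor by blast
  have "\<forall>\<^sub>F t in at 0. q (a + t) = u (a + t - a) * (a + t - a) powi (ord (Fin a))"
    using u(3) by eventually_elim (simp add: loc_Fin del: local_param.simps)
  then show ?thesis using u(1,2) by (auto simp: eventually_at_shift[of _ a])
qed

lemma q_factor_infinity:
  "\<exists>u. u analytic_on {0} \<and> u 0 \<noteq> 0 \<and>
     (\<forall>\<^sub>F t in at 0. q (1 / t) = u t * t powi (ord Infty + 2 * int k))"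
proof -
  obtain u where u: "u analytic_on {0}" "u 0 \<noteq> 0" "\<forall>\<^sub>F t in at 0. loc Infty t = u t * t powi (ord Infty)"
    using loc_factor by blast
  have tne: "\<forall>\<^sub>F t in at 0. t \<noteq> (0::complex)" by (simp add: eventually_at_filter)
  have "\<forall>\<^sub>F t in at 0. q (1 / t) = (-1) ^ k * u t * t powi (ord Infty + 2 * int k)"
    using u(3) tne
  proof eventually_elim
    case (elim t)
    have "(- 1 / t ^ 2) ^ k * ((-1) ^ k * t ^ (2 * k)) = 1"
    proof -
      have "(- 1 / t ^ 2) ^ k * ((-1) ^ k * t ^ (2 * k)) = ((- 1 / t ^ 2) * (-1) * t ^ 2) ^ k"
        by (simp only: power_mult_distrib power_mult mult.assoc)
      then show ?thesis using elim(2) by simp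
    qed
    then have "q (1 / t) = loc Infty t * ((-1) ^ k * t ^ (2 * k))"
      using loc_Infty[OF elim(2)] by (simp del: local_param.simps)
    also have "t ^ (2 * k) = t powi (2 * int k)"
      using power_int_of_nat[of t "2 * k"] by simp
    finally show ?case using elim by (simp add: power_int_add del: local_param.simps)
  qed
  moreover have "(\<lambda>t. (-1) ^ k * u t) analytic_on {0}" using u by (intro analytic_intros)
  ultimately show ?thesis using u(2) by (intro exI[of _ "\<lambda>t. (-1) ^ k * u t"]) simp
qed

lemma ord_near: "\<forall>\<^sub>F t in at 0. ord (local_param x t) = 0"
proof (cases x)
  case (Fin a)
  obtain u where u: "u analytic_on {0}" "u 0 \<noteq> 0" "\<forall>\<^sub>F z in at a. q z = u (z - a) * (z - a) powi (ord (Fin a))"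
    using q_factor by blast
  have "\<forall>\<^sub>F t in at 0. u analytic_on {t}" "\<forall>\<^sub>F t in at 0. u t \<noteq> 0"
    using analytic_eventually[OF u(1)] analytic_eventually_nonzero[OF u(1,2)]
    by (simp_all add: eventually_nhds_conv_at)
  then have "\<forall>\<^sub>F w in at a. u analytic_on {w - a}" "\<forall>\<^sub>F w in at a. u (w - a) \<noteq> 0"
    by (simp_all add: eventually_at_shift[of _ a])
  moreover have "\<forall>\<^sub>F w in at a. w \<noteq> a" by (simp add: eventually_at_filter)
  ultimately have "\<forall>\<^sub>F w in at a. ord (Fin w) = 0"
    using eventually_at_nhds[OF u(3)]
  proof eventually_elim
    case (elim w)
    have "(\<lambda>z. z - a) analytic_on {w}" by (intro analytic_intros)
    then have "(\<lambda>z. u (z - a)) analytic_on {w}"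
      using analytic_on_compose_gen[of "\<lambda>z. z - a" "{w}" u "{w - a}"] elim(1) by (simp add: o_def)
    then show ?case using elim
      by (intro ord_Fin_eq_0[OF elim(4)]) (auto intro!: analytic_intros)
  qed
  then show ?thesis by (simp add: Fin eventually_at_shift[of _ a])
next
  case Infty
  let ?m = "ord Infty + 2 * int k"
  obtain u where u: "u analytic_on {0}" "u 0 \<noteq> 0" "\<forall>\<^sub>F t in at 0. q (1 / t) = u t * t powi ?m"
    using q_factor_infinity by blast
  have "\<forall>\<^sub>F t in at 0. u analytic_on {t}" "\<forall>\<^sub>F t in at 0. u t \<noteq> 0"
    using analytic_eventually[OF u(1)] analytic_eventually_nonzero[OF u(1,2)]
    by (simp_all add: eventually_nhds_conv_at)
  moreover have "\<forall>\<^sub>F t in at 0. t \<noteq> (0::complex)" by (simp add: eventually_at_filter)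
  ultimately have "\<forall>\<^sub>F t in at 0. ord (Fin (1 / t)) = 0"
    using eventually_at_nhds[OF u(3)]
  proof eventually_elim
    case (elim t)
    let ?v = "\<lambda>z. u (1 / z) * (1 / z) powi ?m"
    have "(\<lambda>z. 1 / z) analytic_on {1 / t}" using elim(3) by (intro analytic_intros) auto
    then have "(\<lambda>z. u (1 / z)) analytic_on {1 / t}"
      using analytic_on_compose_gen[of "\<lambda>z. 1 / z" "{1 / t}" u "{t}"] elim(1) by (simp add: o_def)
    then have "?v analytic_on {1 / t}" using elim(3) by (auto intro!: analytic_intros)
    moreover have "?v (1 / t) \<noteq> 0" using elim by simp
    moreover have "\<forall>\<^sub>F z in nhds (1 / t). q z = ?v z"
      using eventually_compose_filterlim[OF elim(4) filterlim_inverse_at(2)[OF elim(3)]]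
      by eventually_elim simp
    ultimately show ?case by (intro ord_Fin_eq_0)
  qed
  moreover have "\<forall>\<^sub>F t in at 0. t \<noteq> (0::complex)" by (simp add: eventually_at_filter)
  ultimately show ?thesis by eventually_elim (simp add: Infty)
qed

lemma finite_ord: "finite {x. ord x \<noteq> 0}"
proof -
  define S where "S = {a. ord (Fin a) \<noteq> 0}"
  obtain e where e: "e > 0" "\<And>t. t \<noteq> 0 \<Longrightarrow> norm t < e \<Longrightarrow> ord (Fin (1 / t)) = 0"
    using ord_near[of Infty] unfolding eventually_at dist_norm by force
  have "S \<subseteq> cball 0 (1 / e)"
  proof
    fix a assume a: "a \<in> S"
    show "a \<in> cball 0 (1 / e)"
    proof (rule ccontr)
      assume "a \<notin> cball 0 (1 / e)"
      then have "norm a > 1 / e" by simp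
      moreover have "1 / e > 0" using e by simp
      ultimately have "norm a > 0" by linarith
      moreover have "1 < e * norm a" using \<open>norm a > 1 / e\<close> e(1) by (simp add: field_simps)
      ultimately have na: "norm a > 0" "1 < e * norm a" .
      have "a \<noteq> 0" using na(1) by auto
      moreover have "norm (1 / a) < e" using na by (simp add: norm_divide pos_divide_less_eq)
      ultimately have "ord (Fin a) = 0" using e(2)[of "1 / a"] by simp
      then show False using a by (simp add: S_def)
    qed
  qed
  moreover have "\<not> z islimpt S" for z
  proof -
    have "\<forall>\<^sub>F w in at z. w \<notin> S"
      using ord_near[of "Fin z"] by (simp add: S_def eventually_at_shift[of _ z])
    then show ?thesis by (simp add: islimpt_conv_frequently_at frequently_def)
  qed
  ultimately have "finite S"
    using finite_not_islimpt_in_compact[of "cball 0 (1 / e)" S] by (simp add: Int_absorb1)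
  moreover have "{x. ord x \<noteq> 0} \<subseteq> insert Infty (Fin ` S)"
  proof
    fix x assume "x \<in> {x. ord x \<noteq> 0}"
    then show "x \<in> insert Infty (Fin ` S)" by (cases x) (auto simp: S_def)
  qed
  ultimately show ?thesis using finite_subset by blast
qed

lemma finite_singular: "finite {x. b x \<noteq> int k}"
  using finite_ord by (simp add: b_def)

lemma local_degree_pos: "int (local_degree f y) \<ge> 1"
  using local_degree_ge_1[of y] by simp

text \<open>
  Going back along \<open>f\<close> multiplies \<open>b\<close> by local degrees. If the maximum of \<open>b\<close> were greater than \<open>k\<close>, the
  points where it is attained would have unramified preimages of the same kind only.
\<close>

lemma b_le_k: "b x \<le> int k"
proof (rule ccontr)
  assume gt: "\<not> b x \<le> int k"
  define M where "M = Max (b ` {x. b x \<noteq> int k})"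
  have max: "b y \<le> M" if "b y \<noteq> int k" for y
    unfolding M_def using finite_singular that by auto
  have M: "M > int k" using max[of x] gt by simp
  have "{y. b y = M} = {}"
  proof (rule no_unramified_backward_invariant)
    show "finite {y. b y = M}" using M by (intro finite_subset[OF _ finite_singular]) auto
    fix y assume "f y \<in> {y. b y = M}"
    then have b_y: "b y = int (local_degree f y) * M" using b_multiplicative[of y] by simp
    then have "b y \<ge> M" using M local_degree_pos[of y] mult_right_mono[of 1 "int (local_degree f y)" M] by simp
    then have "b y = M" using max[of y] M by simp
    then show "y \<in> {y. b y = M} \<and> local_degree f y = 1" using b_y M by simp
  qed
  moreover have "M \<in> b ` {x. b x \<noteq> int k}"
    unfolding M_def using finite_singular gt by (intro Max_in) (auto intro: exI[of _ x])
  ultimately show False by blast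
qed

text \<open>
  The same argument for a negative minimum, as a negative \<open>b\<close> decreases when it is multiplied.
\<close>

lemma b_ge_0: "b x \<ge> 0"
proof (rule ccontr)
  assume lt: "\<not> b x \<ge> 0"
  define M where "M = Min (b ` {x. b x \<noteq> int k})"
  have min: "b y \<ge> M" if "b y \<noteq> int k" for y
    unfolding M_def using finite_singular that by auto
  have M: "M < 0" using min[of x] lt by simp
  have "{y. b y = M} = {}"
  proof (rule no_unramified_backward_invariant)
    show "finite {y. b y = M}" using M by (intro finite_subset[OF _ finite_singular]) auto
    fix y assume "f y \<in> {y. b y = M}"
    then have b_y: "b y = int (local_degree f y) * M" using b_multiplicative[of y] by simp
    then have "b y \<le> M" using M local_degree_pos[of y] mult_right_mono_neg[of 1 "int (local_degree f y)" M] by simp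
    then have "b y = M" using min[of y] M by simp
    then show "y \<in> {y. b y = M} \<and> local_degree f y = 1" using b_y M by simp
  qed
  moreover have "M \<in> b ` {x. b x \<noteq> int k}"
    unfolding M_def using finite_singular lt by (intro Min_in) (auto intro: exI[of _ x])
  ultimately show False by blast
qed

text \<open>
  Points with \<open>b\<close> nonzero and not dividing \<open>k\<close> have only preimages of the same kind, so again those
  with the largest \<open>b\<close> form a backward invariant set without ramified preimages.
\<close>

lemma b_dvd_k:
  assumes "b x \<noteq> 0"
  shows "b x dvd int k"
proof (rule ccontr)
  assume nd: "\<not> b x dvd int k"
  define B where "B = {x. b x \<noteq> 0 \<and> \<not> b x dvd int k}"
  have finB: "finite B" unfolding B_def by (rule finite_subset[OF _ finite_singular]) auto
  have x: "x \<in> B" using assms nd by (simp add: B_def)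
  define M where "M = Max (b ` B)"
  have max: "b y \<le> M" if "y \<in> B" for y
    unfolding M_def using finB that by auto
  have M: "M > 0" using max[OF x] b_ge_0[of x] assms by simp
  have "{y \<in> B. b y = M} = {}"
  proof (rule no_unramified_backward_invariant)
    show "finite {y \<in> B. b y = M}" using finB by simp
    fix y assume fy: "f y \<in> {y \<in> B. b y = M}"
    then have b_y: "b y = int (local_degree f y) * M" using b_multiplicative[of y] by simp
    have "\<not> M dvd int k" using fy by (auto simp: B_def)
    then have "\<not> b y dvd int k" using b_y dvd_mult_right by metis
    moreover have ge: "b y \<ge> M" using b_y M local_degree_pos[of y] mult_right_mono[of 1 "int (local_degree f y)" M] by simp
    ultimately have "y \<in> B" using M by (simp add: B_def)
    moreover from max[OF this] ge have "b y = M" by simp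
    ultimately show "y \<in> {y \<in> B. b y = M} \<and> local_degree f y = 1" using b_y M by simp
  qed
  moreover have "M \<in> b ` B" unfolding M_def using finB x by (intro Max_in) auto
  ultimately show False by blast
qed

text \<open>
  Preimages of a point outside the post-critical set are unramified and again outside that set.
\<close>

lemma b_not_postcritical:
  assumes "x \<notin> postcritical f"
  shows "b x = int k"
proof -
  have "{x. x \<notin> postcritical f \<and> b x \<noteq> int k} = {}"
  proof (rule no_unramified_backward_invariant)
    show "finite {x. x \<notin> postcritical f \<and> b x \<noteq> int k}"
      by (rule finite_subset[OF _ finite_singular]) auto
    fix y assume fy: "f y \<in> {x. x \<notin> postcritical f \<and> b x \<noteq> int k}"
    have "y \<notin> postcritical f"
    proof
      assume "y \<in> postcritical f"
      then obtain n w where n: "n > 0" "w \<in> ramification f" "y = (f ^^ n) w"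
        by (auto simp: postcritical_def)
      then have "f y = (f ^^ Suc n) w" by simp
      then have "f y \<in> postcritical f" using n(2) unfolding postcritical_def by blast
      then show False using fy by simp
    qed
    moreover have "y \<notin> ramification f"
    proof
      assume "y \<in> ramification f"
      moreover have "f y = (f ^^ 1) y" by simp
      ultimately have "f y \<in> postcritical f" unfolding postcritical_def by blast
      then show False using fy by simp
    qed
    then have e: "local_degree f y = 1" using local_degree_ge_1[of y] by (simp add: ramification_def)
    moreover have "b y = b (f y)" using b_multiplicative[of y] e by simp
    ultimately show "y \<in> {x. x \<notin> postcritical f \<and> b x \<noteq> int k} \<and> local_degree f y = 1"
      using fy by simp
  qed
  then show ?thesis using assms by blast
qed

definition nu :: "P1 \<Rightarrow> enat" where
  "nu x = (if b x = 0 then \<infinity> else enat (nat (int k div b x)))"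

lemma nu_eq_1_iff: "nu x = 1 \<longleftrightarrow> b x = int k"
proof (cases "b x = 0")
  case True
  then show ?thesis using k_ge_1 by (simp add: nu_def)
next
  case False
  then obtain m where m: "int k = b x * m" using b_dvd_k by blast
  have "int k div b x = m" using m False by simp
  then show ?thesis using False m k_ge_1 by (auto simp: nu_def one_enat_def)
qed

lemma nu_positive: "b x \<noteq> 0 \<Longrightarrow> int k div b x \<ge> 1"
proof -
  assume "b x \<noteq> 0"
  then have "b x > 0" using b_ge_0[of x] by simp
  then show ?thesis using b_le_k[of x] pos_imp_zdiv_pos_iff[of "b x" "int k"] by simp
qed

lemma preserves_orbifold_nu: "preserves_orbifold f nu"
  unfolding preserves_orbifold_def
proof (intro conjI allI impI ballI)
  show "orbifold nu"
    unfolding orbifold_def nu_eq_1_iff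
  proof (intro conjI allI)
    fix x show "1 \<le> nu x" using nu_positive[of x] by (auto simp: nu_def one_enat_def)
  qed (rule finite_singular)
  show "nu x = 1" if "x \<notin> postcritical f" for x
    using b_not_postcritical[OF that] by (simp add: nu_eq_1_iff)
  fix x y assume "y \<in> f -` {x}"
  then have x: "x = f y" by simp
  define e where "e = local_degree f y"
  have e: "e > 0" using local_degree_ge_1[of y] by (simp add: e_def)
  have b_y: "b y = int e * b x" using b_multiplicative[of y] by (simp add: x e_def)
  show "nu x dvd nu y * enat (local_degree f y)"
  proof (cases "b x = 0")
    case True
    then have "nu x = \<infinity>" "nu y = \<infinity>" using b_y by (simp_all add: nu_def)
    moreover have "\<infinity> * enat e = \<infinity>" using e by (simp add: enat_0_iff)
    ultimately show ?thesis by (simp add: e_def)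
  next
    case False
    then have "b y \<noteq> 0" using b_y e by simp
    then obtain m where m: "int k = b y * m" using b_dvd_k by blast
    have "int k div b y = m" using m \<open>b y \<noteq> 0\<close> by simp
    moreover have "int k div b x = int e * m" using m False by (simp add: b_y)
    moreover have "m \<ge> 0" using nu_positive[OF \<open>b y \<noteq> 0\<close>] calculation(1) by simp
    ultimately have "nu x = nu y * enat e"
      using False \<open>b y \<noteq> 0\<close> by (simp add: nu_def nat_mult_distrib mult.commute)
    then show ?thesis by (simp add: e_def)
  qed
qed

text \<open>
  The divisor of a section of the \<open>k\<close>-th power has degree \<open>-2k\<close>. As \<open>b \<le> k\<close>, the section has no zeros,
  so clearing the poles of \<open>q\<close> in the plane by a polynomial leaves an entire function without zeros, which behaves like \<open>z^(-M)\<close> at infinity for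
  an integer \<open>M\<close>. By Liouville's theorem, applied to it or to its inverse, \<open>M = 0\<close>.
\<close>

lemma degree_formula: "(\<Sum>x | b x \<noteq> int k. int k - b x) = 2 * int k"
proof -
  define S where "S = {a. ord (Fin a) \<noteq> 0}"
  have "Fin ` S \<subseteq> {x. ord x \<noteq> 0}" by (auto simp: S_def)
  then have "finite (Fin ` S)" using finite_ord finite_subset by blast
  then have finS: "finite S" by (rule finite_imageD) (simp add: inj_on_def)
  define n where "n a = nat (- ord (Fin a))" for a
  have n: "int (n a) = - ord (Fin a)" for a using b_le_k[of "Fin a"] by (simp add: n_def b_def)
  define E where "E z = q z * (\<Prod>a\<in>S. (z - a) ^ n a)" for z
  have E_local: "\<exists>v. v analytic_on {a} \<and> v a \<noteq> 0 \<and> (\<forall>\<^sub>F z in at a. E z = v z)" for a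
  proof -
    obtain u where u: "u analytic_on {0}" "u 0 \<noteq> 0" "\<forall>\<^sub>F z in at a. q z = u (z - a) * (z - a) powi (ord (Fin a))"
      using q_factor by blast
    define v where "v z = u (z - a) * (\<Prod>a'\<in>S - {a}. (z - a') ^ n a')" for z
    have "(\<lambda>z. z - a) analytic_on {a}" by (intro analytic_intros)
    then have "(\<lambda>z. u (z - a)) analytic_on {a}"
      using analytic_on_compose_gen[of "\<lambda>z. z - a" "{a}" u "{0}"] u(1) by (simp add: o_def)
    then have "v analytic_on {a}" unfolding v_def by (intro analytic_intros) auto
    moreover have "v a \<noteq> 0" unfolding v_def using u(2) finS by auto
    moreover have "\<forall>\<^sub>F z in at a. z \<noteq> a" by (simp add: eventually_at_filter)
    with u(3) have "\<forall>\<^sub>F z in at a. E z = v z"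
    proof eventually_elim
      case (elim z)
      have "(\<Prod>a\<in>S. (z - a) ^ n a) = (z - a) ^ n a * (\<Prod>a'\<in>S - {a}. (z - a') ^ n a')"
      proof (cases "a \<in> S")
        case True
        then show ?thesis using finS by (simp add: prod.remove)
      next
        case False
        then have "n a = 0" by (simp add: S_def n_def)
        then show ?thesis using False by simp
      qed
      moreover have "(z - a) powi (ord (Fin a)) * (z - a) ^ n a = 1"
      proof -
        have "(z - a) powi (ord (Fin a)) * (z - a) ^ n a = (z - a) powi (ord (Fin a) + int (n a))"
          using elim(2) by (simp add: power_int_add)
        then show ?thesis by (simp add: n)
      qed
      ultimately show ?case by (simp add: E_def v_def elim(1))
    qed
    ultimately show ?thesis by blast
  qed
  \<comment> \<open>\<open>E\<close> may have the wrong value at isolated points.\<close>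
  define H where "H = remove_sings E"
  have H_eqI: "H z = v z" if "\<forall>\<^sub>F w in at z. E w = v w" "v analytic_on {z}" for z v
    unfolding H_def
  proof (rule remove_sings_eqI)
    show "E \<midarrow>z\<rightarrow> v z"
      using analytic_tendsto[OF that(2)] that(1) by (simp add: tendsto_cong)
  qed
  have H: "H analytic_on {a}" "H a \<noteq> 0" for a
  proof -
    obtain v where v: "v analytic_on {a}" "v a \<noteq> 0" "\<forall>\<^sub>F z in at a. E z = v z" using E_local by blast
    have "\<forall>\<^sub>F w in at a. H w = v w"
    proof -
      have "\<forall>\<^sub>F w in at a. v analytic_on {w}"
        using analytic_eventually[OF v(1)] by (simp add: eventually_nhds_conv_at)
      with eventually_at_nhds[OF v(3)] show ?thesis
      proof eventually_elim
        case (elim w)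
        have "\<forall>\<^sub>F z in at w. E z = v z" using elim(1) by (simp add: eventually_nhds_conv_at)
        from H_eqI[OF this elim(2)] show ?case .
      qed
    qed
    moreover have "H a = v a" by (rule H_eqI) fact+
    ultimately have "\<forall>\<^sub>F w in nhds a. H w = v w" by (simp add: eventually_nhds_conv_at)
    then show "H analytic_on {a}" using v(1) analytic_at_cong by metis
    show "H a \<noteq> 0" using \<open>H a = v a\<close> v(2) by simp
  qed
  have holH: "H holomorphic_on UNIV"
    using H(1) analytic_on_analytic_at analytic_imp_holomorphic by blast
  define N where "N = (\<Sum>a\<in>S. int (n a))"
  define M where "M = ord Infty + 2 * int k - N"
  obtain u where u: "u analytic_on {0}" "u 0 \<noteq> 0" "\<forall>\<^sub>F t in at 0. q (1 / t) = u t * t powi (ord Infty + 2 * int k)"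
    using q_factor_infinity by blast
  define W where "W t = u t * (\<Prod>a\<in>S. (1 - a * t) ^ n a)" for t
  have W: "W analytic_on {0}" "W 0 \<noteq> 0"
    unfolding W_def using u by (auto intro!: analytic_intros)
  have tne: "\<forall>\<^sub>F t in at 0. t \<noteq> (0::complex)" by (simp add: eventually_at_filter)
  have EW: "\<forall>\<^sub>F t in at 0. E (1 / t) = W t * t powi M"
    using u(3) tne
  proof eventually_elim
    case (elim t)
    have "(\<Prod>a\<in>S. (1 / t - a) ^ n a) = (\<Prod>a\<in>S. (1 - a * t) ^ n a * t powi (- int (n a)))"
    proof (rule prod.cong)
      fix a
      have "1 / t - a = (1 - a * t) * inverse t" using elim(2) by (simp add: field_simps)
      then show "(1 / t - a) ^ n a = (1 - a * t) ^ n a * t powi (- int (n a))"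
        by (simp add: power_mult_distrib power_int_minus power_inverse)
    qed simp
    also have "\<dots> = (\<Prod>a\<in>S. (1 - a * t) ^ n a) * (\<Prod>a\<in>S. t powi (- int (n a)))"
      by (rule prod.distrib)
    also have "(\<Prod>a\<in>S. t powi (- int (n a))) = t powi (- N)"
      unfolding N_def using finS by (induction S) (use elim(2) in \<open>simp_all add: power_int_diff power_int_minus field_simps power_int_add\<close>)
    finally have P: "(\<Prod>a\<in>S. (1 / t - a) ^ n a) = (\<Prod>a\<in>S. (1 - a * t) ^ n a) * t powi (- N)" .
    have "t powi M = t powi (ord Infty + 2 * int k) * t powi (- N)"
      unfolding M_def using elim(2) by (simp flip: power_int_add)
    then show ?case by (simp add: E_def elim(1) P W_def)
  qed
  have HW: "\<forall>\<^sub>F t in at 0. H (1 / t) = W t * t powi M"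
  proof -
    have "\<forall>\<^sub>F t in at 0. W analytic_on {t}"
      using analytic_eventually[OF W(1)] by (simp add: eventually_nhds_conv_at)
    with eventually_at_nhds[OF EW] tne show ?thesis
    proof eventually_elim
      case (elim t)
      let ?v = "\<lambda>z. W (1 / z) * (1 / z) powi M"
      have "(\<lambda>z. 1 / z) analytic_on {1 / t}" using elim(2) by (intro analytic_intros) auto
      then have "(\<lambda>z. W (1 / z)) analytic_on {1 / t}"
        using analytic_on_compose_gen[of "\<lambda>z. 1 / z" "{1 / t}" W "{t}"] elim(3) by (simp add: o_def)
      then have v: "?v analytic_on {1 / t}" using elim(2) by (auto intro!: analytic_intros)
      have "\<forall>\<^sub>F z in nhds (1 / t). E z = ?v z"
        using eventually_compose_filterlim[OF elim(1) filterlim_inverse_at(2)[OF elim(2)]]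
        by eventually_elim simp
      then have "\<forall>\<^sub>F z in at (1 / t). E z = ?v z" by (simp add: eventually_nhds_conv_at)
      from H_eqI[OF this v] show ?case by simp
    qed
  qed
  have "M = 0"
  proof (rule ccontr)
    assume "M \<noteq> 0"
    have powM: "((\<lambda>t::complex. t powi m) \<longlongrightarrow> 0) (at 0)" if "m > 0" for m
    proof -
      have "((\<lambda>t::complex. t ^ nat m) \<longlongrightarrow> 0 ^ nat m) (at 0)" by (intro tendsto_intros)
      moreover have "(0::complex) ^ nat m = 0" using that by (intro zero_power) simp
      ultimately show ?thesis using that by (simp add: power_int_def)
    qed
    show False
    proof (cases "M > 0")
      case True
      have "((\<lambda>t. W t * t powi M) \<longlongrightarrow> W 0 * 0) (at 0)"
        by (intro tendsto_mult analytic_tendsto W powM True)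
      then have "((\<lambda>t. H (1 / t)) \<longlongrightarrow> 0) (at 0)" using HW by (simp add: tendsto_cong)
      then have "(H \<longlongrightarrow> 0) at_infinity" using lim_at_infinity_0[of H] by (simp add: inverse_eq_divide o_def)
      then show False using Liouville_weak_0[OF holH] H(2) by blast
    next
      case False
      have "((\<lambda>t. inverse (W t) * t powi (- M)) \<longlongrightarrow> inverse (W 0) * 0) (at 0)"
        using False \<open>M \<noteq> 0\<close> W by (intro tendsto_mult tendsto_inverse analytic_tendsto W powM) auto
      moreover have "\<forall>\<^sub>F t in at 0. inverse (H (1 / t)) = inverse (W t) * t powi (- M)"
        using HW by eventually_elim (simp add: power_int_minus)
      ultimately have "((\<lambda>t. inverse (H (1 / t))) \<longlongrightarrow> 0) (at 0)" by (simp add: tendsto_cong)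
      then have "((\<lambda>z. inverse (H z)) \<longlongrightarrow> 0) at_infinity"
        using lim_at_infinity_0[of "\<lambda>z. inverse (H z)"] by (simp add: inverse_eq_divide o_def)
      moreover have "(\<lambda>z. inverse (H z)) holomorphic_on UNIV"
        using holH H(2) by (intro holomorphic_intros) auto
      ultimately have "inverse (H 0) = 0" by (intro Liouville_weak_0)
      then show False using H(2)[of 0] by simp
    qed
  qed
  then have N: "N = ord Infty + 2 * int k" by (simp add: M_def)
  have "(\<Sum>x | b x \<noteq> int k. int k - b x) = (\<Sum>x\<in>insert Infty (Fin ` S). int k - b x)"
  proof (rule sum.mono_neutral_left)
    show "{x. b x \<noteq> int k} \<subseteq> insert Infty (Fin ` S)"
    proof
      fix x assume "x \<in> {x. b x \<noteq> int k}"
      then show "x \<in> insert Infty (Fin ` S)" by (cases x) (auto simp: S_def b_def)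
    qed
  qed (use finS in auto)
  also have "\<dots> = (int k - b Infty) + (\<Sum>x\<in>Fin ` S. int k - b x)"
    using finS by (intro sum.insert) auto
  also have "(\<Sum>x\<in>Fin ` S. int k - b x) = (\<Sum>a\<in>S. int (n a))"
    by (subst sum.reindex) (auto simp: inj_on_def n b_def)
  also have "\<dots> = N" by (simp add: N_def)
  finally show ?thesis by (simp add: N b_def)
qed

end

section \<open>Normal forms and developing maps\<close>

lemma analytic_comp:
  assumes "F analytic_on {z}" "G analytic_on {F z}"
  shows "(\<lambda>w. G (F w)) analytic_on {z}"
  using analytic_on_compose_gen[OF assms(1), of G "{F z}"] assms(2) by (simp add: o_def)

lemma eventually_analytic_comp:
  assumes "F analytic_on {z}" "\<forall>\<^sub>F t in nhds (F z). P t"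
  shows "\<forall>\<^sub>F w in nhds z. P (F w)"
  using assms(2) analytic_tendsto_nhds[OF assms(1)] by (rule eventually_compose_filterlim)

lemma deriv_comp:
  assumes "F analytic_on {z}" "G analytic_on {F z}"
  shows "deriv (\<lambda>w. G (F w)) z = deriv G (F z) * deriv F z"
  using deriv_chain[of F z G] assms by (simp add: o_def analytic_on_imp_differentiable_at)

lemma analytic_root:
  assumes g: "g analytic_on {z}" "g z \<noteq> (0::complex)" and n: "n \<ge> 1"
  shows "\<exists>\<rho>. \<rho> analytic_on {z} \<and> \<rho> z \<noteq> 0 \<and> (\<forall>\<^sub>F w in nhds z. \<rho> w ^ n = g w)"
proof -
  obtain a where a: "a \<noteq> 0" "g z = a ^ n"
    using exists_complex_root_nonzero[OF g(2)] n by (metis not_one_le_zero)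
  define L where "L w = Ln (g w / g z)" for w
  define \<rho> where "\<rho> w = a * exp (L w / of_nat n)" for w
  have "(\<lambda>w. g w / g z) analytic_on {z}" using g by (intro analytic_intros) auto
  then have "L analytic_on {z}"
    unfolding L_def using g(2) by (intro analytic_on_ln) auto
  then have "\<rho> analytic_on {z}" unfolding \<rho>_def using n by (intro analytic_intros) auto
  moreover have "\<rho> z \<noteq> 0" using a by (simp add: \<rho>_def)
  moreover have "\<forall>\<^sub>F w in nhds z. \<rho> w ^ n = g w"
    using analytic_eventually_nonzero[OF g]
  proof eventually_elim
    case (elim w)
    have "exp (L w / of_nat n) ^ n = exp (L w)"
      using n by (simp flip: exp_of_nat_mult)
    also have "\<dots> = g w / g z" using elim g(2) by (simp add: L_def)
    finally show ?case using g(2) by (simp add: \<rho>_def power_mult_distrib flip: a(2))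
  qed
  ultimately show ?thesis by blast
qed

lemma analytic_eq_if_deriv_eq:
  assumes F: "F analytic_on {z}" and G: "G analytic_on {z}" and z: "F z = G z"
    and d: "\<forall>\<^sub>F w in nhds z. deriv F w = deriv G w"
  shows "\<forall>\<^sub>F w in nhds z. F w = (G w :: complex)"
proof -
  have "\<forall>\<^sub>F w in nhds z. ((\<lambda>w. F w - G w) has_field_derivative 0) (at w)"
    using d analytic_eventually[OF F] analytic_eventually[OF G]
  proof eventually_elim
    case (elim w)
    show ?case using DERIV_diff[OF analytic_derivI[OF elim(2)] analytic_derivI[OF elim(3)]] elim(1) by simp
  qed
  then obtain e where e: "e > 0" "\<And>w. dist w z < e \<Longrightarrow> ((\<lambda>w. F w - G w) has_field_derivative 0) (at w)"
    unfolding eventually_nhds_metric by blast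
  have "\<exists>a. \<forall>w\<in>ball z e. F w - G w = a"
    by (rule has_field_derivative_zero_constant)
       (use e in \<open>auto simp: dist_commute intro: has_field_derivative_at_within\<close>)
  then obtain a where a: "\<And>w. w \<in> ball z e \<Longrightarrow> F w - G w = a" by blast
  have "a = 0" using a[of z] e z by simp
  then show ?thesis using a e unfolding eventually_nhds_metric
    by (intro exI[of _ e]) (auto simp: dist_commute)
qed

lemma analytic_primitive:
  assumes "v analytic_on {z}"
  shows "\<exists>V. V analytic_on {z} \<and> V z = 0 \<and> (\<forall>\<^sub>F w in nhds z. deriv V w = v w)"
proof -
  obtain A where A: "open A" "z \<in> A" "v holomorphic_on A" using assms unfolding analytic_at by blast
  obtain e where e: "e > 0" "ball z e \<subseteq> A" using A openE by blast
  then have "v holomorphic_on ball z e" using A holomorphic_on_subset by blast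
  then obtain g where g: "\<And>w. w \<in> ball z e \<Longrightarrow> (g has_field_derivative v w) (at w within ball z e)"
    using holomorphic_convex_primitive'[of "ball z e" v] by auto
  then have g': "(g has_field_derivative v w) (at w)" if "w \<in> ball z e" for w
    using g[OF that] at_within_open[OF that open_ball] by simp
  define V where "V w = g w - g z" for w
  have V: "(V has_field_derivative v w) (at w)" if "w \<in> ball z e" for w
    unfolding V_def using g'[OF that] by (auto intro!: derivative_eq_intros)
  have "V holomorphic_on ball z e" using V unfolding holomorphic_on_open[OF open_ball] by blast
  then have "V analytic_on {z}" using e analytic_at by (metis centre_in_ball open_ball)
  moreover have "\<forall>\<^sub>F w in nhds z. w \<in> ball z e" using e by (intro eventually_nhds_in_open) auto
  then have "\<forall>\<^sub>F w in nhds z. deriv V w = v w" by eventually_elim (use V DERIV_imp_deriv in blast)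
  moreover have "V z = 0" by (simp add: V_def)
  ultimately show ?thesis by blast
qed

lemma analytic_local_inverse:
  assumes V: "V analytic_on {0}" "V 0 = 0" "deriv V 0 \<noteq> 0"
  shows "\<exists>W. W analytic_on {0} \<and> W 0 = 0 \<and> (\<forall>\<^sub>F z in nhds 0. V (W z) = z) \<and> (\<forall>\<^sub>F s in nhds 0. W (V s) = s)"
proof -
  obtain A where A: "open A" "0 \<in> A" "V holomorphic_on A" using V(1) unfolding analytic_at by blast
  obtain r where r: "r > 0" "ball 0 r \<subseteq> A" "inj_on V (ball 0 r)"
    using has_complex_derivative_locally_injective[OF A(3,2,1) V(3)] by blast
  have hol: "V holomorphic_on ball 0 r" using A(3) r(2) by (rule holomorphic_on_subset)
  obtain W where W: "W holomorphic_on (V ` ball 0 r)" "\<And>z. z \<in> ball 0 r \<Longrightarrow> W (V z) = z"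
    using holomorphic_has_inverse[OF hol open_ball r(3)] by blast
  have op: "open (V ` ball 0 r)" by (rule open_mapping_thm3[OF hol open_ball r(3)])
  have z: "0 \<in> V ` ball 0 r" using V(2) r(1) by (metis centre_in_ball imageI)
  have "W analytic_on {0}" unfolding analytic_at using op z W(1) by blast
  moreover have "W 0 = 0" using W(2)[of 0] V(2) r(1) by simp
  moreover have "\<forall>\<^sub>F z in nhds 0. z \<in> V ` ball 0 r" using op z by (rule eventually_nhds_in_open)
  then have "\<forall>\<^sub>F z in nhds 0. V (W z) = z" by eventually_elim (use W(2) in force)
  moreover have "\<forall>\<^sub>F z in nhds 0. z \<in> ball (0::complex) r" using r(1) by (intro eventually_nhds_in_open) auto
  then have "\<forall>\<^sub>F s in nhds 0. W (V s) = s" by eventually_elim (use W(2) in force)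
  ultimately show ?thesis by blast
qed

lemma analytic_zero_factor:
  assumes H: "H analytic_on {0}" "H 0 = (0::complex)" and ne: "\<forall>\<^sub>F z in at 0. H z \<noteq> 0"
  shows "\<exists>e\<ge>1. \<exists>g. g analytic_on {0} \<and> g 0 \<noteq> 0 \<and> (\<forall>\<^sub>F z in nhds 0. H z = z ^ e * g z)"
proof -
  obtain g where g: "g analytic_on {0}" "g 0 \<noteq> 0" and eq: "\<forall>\<^sub>F z in at 0. H z = g z * (z - 0) powi zorder H 0"
    using meromorphic_factor[OF analytic_on_imp_meromorphic_on[OF H(1)]] ne
    by (auto simp: eventually_frequently)
  have lim: "H \<midarrow>0\<rightarrow> 0" using analytic_tendsto[OF H(1)] H(2) by simp
  have pos: "zorder H 0 > 0"
  proof (rule ccontr)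
    assume "\<not> zorder H 0 > 0"
    then have "((\<lambda>z::complex. z ^ nat (- zorder H 0) * H z) \<longlongrightarrow> 0 ^ nat (- zorder H 0) * 0) (at 0)"
      by (intro tendsto_intros lim)
    moreover have "\<forall>\<^sub>F z in at 0. z \<noteq> (0::complex)" by (simp add: eventually_at_filter)
    with eq have "\<forall>\<^sub>F z in at 0. z ^ nat (- zorder H 0) * H z = g z"
    proof eventually_elim
      case (elim z)
      have "z ^ nat (- zorder H 0) = z powi (- zorder H 0)"
        using \<open>\<not> zorder H 0 > 0\<close> by (simp add: power_int_def)
      then show ?case using elim by (simp add: power_int_minus)
    qed
    ultimately have "g \<midarrow>0\<rightarrow> 0" by (simp add: tendsto_cong)
    then have "g 0 = 0" using analytic_tendsto[OF g(1)] by (rule tendsto_unique[rotated, symmetric, OF _ _]) simp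
    then show False using g by simp
  qed
  define e where "e = nat (zorder H 0)"
  have e: "e \<ge> 1" "zorder H 0 = int e" using pos by (simp_all add: e_def)
  have "\<forall>\<^sub>F z in at 0. H z = z ^ e * g z" using eq by eventually_elim (simp add: e(2))
  moreover have "H 0 = 0 ^ e * g 0" using H(2) e(1) by simp
  ultimately have "\<forall>\<^sub>F z in nhds 0. H z = z ^ e * g z" by (simp add: eventually_nhds_conv_at)
  then show ?thesis using e(1) g by blast
qed

text \<open>
  A continuous function with values among the finitely many \<open>k\<close>-th roots of a number is locally constant.
\<close>

lemma analytic_power_const:
  assumes m: "m analytic_on {z}" and k: "k \<ge> 1" and eq: "\<forall>\<^sub>F w in at z. m w ^ k = (C::complex)"
  shows "m z ^ k = C" "\<forall>\<^sub>F w in nhds z. m w = m z"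
proof -
  have "(\<lambda>w. m w ^ k) \<midarrow>z\<rightarrow> m z ^ k" by (intro tendsto_intros analytic_tendsto m)
  moreover have "(\<lambda>w. m w ^ k) \<midarrow>z\<rightarrow> C" using eq by (rule tendsto_eventually)
  ultimately show mz: "m z ^ k = C" by (rule tendsto_unique[rotated]) simp
  define R where "R = {w. w ^ k = C} - {m z}"
  have "monom 1 k - [:C:] \<noteq> 0"
  proof
    assume "monom 1 k - [:C:] = 0"
    then have "degree (monom (1::complex) k) = degree [:C:]" by simp
    then show False using k by (simp add: degree_monom_eq)
  qed
  then have "finite {w. poly (monom 1 k - [:C:]) w = 0}" by (rule poly_roots_finite)
  then have "finite R" by (rule rev_finite_subset) (auto simp: R_def poly_monom)
  then have "open (- R)" by (simp add: finite_imp_closed open_Compl)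
  moreover have "m z \<in> - R" by (simp add: R_def)
  ultimately have "\<forall>\<^sub>F t in nhds (m z). t \<in> - R" by (rule eventually_nhds_in_open)
  then have "\<forall>\<^sub>F w in nhds z. m w \<in> - R" by (rule eventually_analytic_comp[OF m])
  then have "\<forall>\<^sub>F w in at z. m w \<in> - R" by (simp add: eventually_nhds_conv_at)
  with eq have "\<forall>\<^sub>F w in at z. m w = m z" by eventually_elim (auto simp: R_def)
  then show "\<forall>\<^sub>F w in nhds z. m w = m z" by (simp add: eventually_nhds_conv_at)
qed

context invariant_section
begin

definition wt :: "P1 \<Rightarrow> nat" where
  "wt x = nat (int k div b x)"

lemma wt:
  assumes "b x \<noteq> 0"
  shows "wt x \<ge> 1" and "int (wt x) * b x = int k" and "nu x = enat (wt x)"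
proof -
  have "int (wt x) = int k div b x" using nu_positive[OF assms] by (simp add: wt_def)
  then show "int (wt x) * b x = int k" using b_dvd_k[OF assms] by simp
  show "wt x \<ge> 1" using nu_positive[OF assms] by (simp add: wt_def)
  show "nu x = enat (wt x)" using assms by (simp add: nu_def wt_def)
qed

text \<open>
  On the cyclic cover \<open>t = s^n\<close> of degree \<open>n = \<nu>(x)\<close> the section has neither zero nor pole, so it is the
  \<open>k\<close>-th power of a nonvanishing form. As this form is \<open>\<rho>(s^n) ds\<close>, it is equivariant under the
  deck rotations \<open>s \<mapsto> \<eta> s\<close> of the cover.
\<close>

lemma cyclic_cover_form:
  assumes bx: "b x \<noteq> 0"
  obtains \<rho> where "\<rho> analytic_on {0}" "\<rho> 0 \<noteq> 0"
    "\<And>h z. h analytic_on {z} \<Longrightarrow> h z = 0 \<Longrightarrow> \<forall>\<^sub>F w in at z. h w \<noteq> 0 \<Longrightarrow>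
       \<forall>\<^sub>F w in at z. loc x (h w ^ wt x) * deriv (\<lambda>w. h w ^ wt x) w ^ k = (\<rho> (h w ^ wt x) * deriv h w) ^ k"
proof -
  define n where "n = wt x"
  have n: "n \<ge> 1" "int n * b x = int k" using wt[OF bx] by (simp_all add: n_def)
  obtain u where u: "u analytic_on {0}" "u 0 \<noteq> 0" "\<forall>\<^sub>F t in at 0. loc x t = u t * t powi (ord x)"
    using loc_factor by blast
  have "(\<lambda>t. of_nat n ^ k * u t) analytic_on {0}" using u(1) by (intro analytic_intros)
  then obtain \<rho> where \<rho>: "\<rho> analytic_on {0}" "\<rho> 0 \<noteq> 0" "\<forall>\<^sub>F t in nhds 0. \<rho> t ^ k = of_nat n ^ k * u t"
    using analytic_root[of "\<lambda>t. of_nat n ^ k * u t" 0 k] u(2) n(1) k_ge_1 by auto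
  show thesis
  proof (rule that[OF \<rho>(1,2)], fold n_def)
    fix h z assume h: "h analytic_on {z}" "h z = 0" and ne: "\<forall>\<^sub>F w in at z. h w \<noteq> 0"
    have hn: "(\<lambda>w. h w ^ n) analytic_on {z}" using h by (intro analytic_intros)
    have hn0: "h z ^ n = 0" using h(2) n(1) by simp
    have ne': "\<forall>\<^sub>F w in at z. h w ^ n \<noteq> 0" using ne by eventually_elim simp
    have ra: "\<forall>\<^sub>F w in at z. \<rho> (h w ^ n) ^ k = of_nat n ^ k * u (h w ^ n)"
      using eventually_analytic_comp[OF hn, of "\<lambda>t. \<rho> t ^ k = of_nat n ^ k * u t"] \<rho>(3) hn0
      by (simp add: eventually_nhds_conv_at)
    have ha: "\<forall>\<^sub>F w in at z. h analytic_on {w}"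
      using analytic_eventually[OF h(1)] by (simp add: eventually_nhds_conv_at)
    show "\<forall>\<^sub>F w in at z. loc x (h w ^ n) * deriv (\<lambda>w. h w ^ n) w ^ k = (\<rho> (h w ^ n) * deriv h w) ^ k"
      using eventually_at_analytic_compose[OF hn hn0 ne' u(3)] ra ne ha
    proof eventually_elim
      case (elim w)
      have "deriv (\<lambda>w. h w ^ n) w = of_nat n * h w ^ (n - 1) * deriv h w"
        by (rule DERIV_imp_deriv) (use analytic_derivI[OF elim(4)] in \<open>auto intro!: derivative_eq_intros\<close>)
      moreover have "(h w ^ n) powi (ord x) * (h w ^ (n - 1)) ^ k = 1"
      proof -
        have "(h w ^ n) powi (ord x) * (h w ^ (n - 1)) ^ k = h w powi (int n * ord x + int ((n - 1) * k))"
          using elim(3) by (simp add: power_int_add power_int_mult flip: power_mult)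
        also have "int n * ord x + int ((n - 1) * k) = 0"
          using n by (simp add: b_def algebra_simps of_nat_diff)
        finally show ?thesis by simp
      qed
      ultimately show ?case using elim(1,2)
        by (simp add: power_mult_distrib mult_ac)
    qed
  qed
qed

text \<open>
  If \<open>H\<close> vanishes to order \<open>e\<close>, the pullback has order \<open>e b - k\<close>; it is constant, so \<open>e b = k\<close>.
\<close>

lemma constant_pull_order:
  assumes H: "H analytic_on {0}" "H 0 = 0" and ne: "\<forall>\<^sub>F z in at 0. H z \<noteq> 0" and C: "C \<noteq> 0"
    and eq: "\<forall>\<^sub>F z in at 0. loc x (H z) * deriv H z ^ k = C"
  shows "\<exists>e\<ge>1. \<exists>g. g analytic_on {0} \<and> g 0 \<noteq> 0 \<and> (\<forall>\<^sub>F z in nhds 0. H z = z ^ e * g z) \<and>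
           int e * b x = int k"
proof -
  obtain e g where e: "e \<ge> 1" and g: "g analytic_on {0}" "g 0 \<noteq> 0"
    and Hg: "\<forall>\<^sub>F z in nhds 0. H z = z ^ e * g z"
    using analytic_zero_factor[OF H ne] by blast
  have "\<forall>\<^sub>F z in nhds 0. \<forall>\<^sub>F y in nhds z. H y = y ^ e * g y"
    using Hg by (simp add: eventually_eventually)
  then have "\<forall>\<^sub>F z in nhds 0. H z = z ^ e * g z \<and> deriv H z = deriv (\<lambda>z. z ^ e * g z) z"
    by eventually_elim (auto intro: deriv_cong_ev dest: eventually_nhds_x_imp_x)
  then have Hg': "\<forall>\<^sub>F z in at 0. H z = z ^ e * g z \<and> deriv H z = deriv (\<lambda>z. z ^ e * g z) z"
    by (simp add: eventually_nhds_conv_at)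
  obtain U where U: "U analytic_on {0}" "U 0 \<noteq> 0"
    and pf: "\<forall>\<^sub>F t in at 0. loc x (t ^ e * g t) * deriv (\<lambda>t. t ^ e * g t) t ^ k = U t * t powi (int e * b x - int k)"
    using loc_pull_factor[OF g e] by blast
  have "zorder (\<lambda>_. C) 0 = int e * b x - int k"
    by (rule zorder_eq_if_eventually[OF U]) (use eq Hg' pf in eventually_elim, auto)
  moreover have "zorder (\<lambda>_::complex. C) 0 = 0"
    by (rule zorder_eq_if_eventually[of "\<lambda>_. C"]) (use C in auto)
  ultimately have "int e * b x = int k" by simp
  then show ?thesis using e g Hg by blast
qed

text \<open>
  In the coordinate \<open>z\<close> with \<open>t = W(z)^n\<close>, the section becomes \<open>dz^k\<close>. The last clause says that this
  is the only way to obtain a constant multiple of \<open>dz^k\<close>, up to scaling \<open>z\<close>; the clause before it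
  describes the symmetry of this coordinate.
\<close>

definition normal_form :: "P1 \<Rightarrow> (complex \<Rightarrow> complex) \<Rightarrow> bool" where
  "normal_form x W \<longleftrightarrow> W analytic_on {0} \<and> W 0 = 0 \<and> deriv W 0 \<noteq> 0 \<and>
     (\<forall>\<^sub>F z in at 0. loc x (W z ^ wt x) * deriv (\<lambda>z. W z ^ wt x) z ^ k = 1) \<and>
     (\<forall>\<eta>. \<eta> ^ wt x = 1 \<longrightarrow> (\<forall>\<^sub>F z in nhds 0. W (\<eta> * z) = \<eta> * W z)) \<and>
     (\<forall>H C. H analytic_on {0} \<longrightarrow> H 0 = 0 \<longrightarrow> (\<forall>\<^sub>F z in at 0. H z \<noteq> 0) \<longrightarrow> C \<noteq> 0 \<longrightarrow>
        (\<forall>\<^sub>F z in at 0. loc x (H z) * deriv H z ^ k = C) \<longrightarrow>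
        (\<exists>\<alpha>. \<alpha> ^ k = C \<and> (\<forall>\<^sub>F z in nhds 0. H z = W (\<alpha> * z) ^ wt x)))"

text \<open>
  \<open>W\<close> is the inverse of the primitive \<open>V\<close> of the form on the cyclic cover. If \<open>H = h^n\<close> pulls \<open>q\<close> back to
  a constant, then \<open>(V \<circ> h)'^k\<close> is constant, so \<open>V \<circ> h\<close> is linear.
\<close>

lemma exists_normal_form:
  assumes bx: "b x \<noteq> 0"
  shows "\<exists>W. normal_form x W"
proof -
  define n where "n = wt x"
  have n: "n \<ge> 1" "int n * b x = int k" using wt[OF bx] by (simp_all add: n_def)
  obtain \<rho> where \<rho>: "\<rho> analytic_on {0}" "\<rho> 0 \<noteq> 0"
    and form: "\<And>h z. h analytic_on {z} \<Longrightarrow> h z = 0 \<Longrightarrow> \<forall>\<^sub>F w in at z. h w \<noteq> 0 \<Longrightarrow>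
       \<forall>\<^sub>F w in at z. loc x (h w ^ n) * deriv (\<lambda>w. h w ^ n) w ^ k = (\<rho> (h w ^ n) * deriv h w) ^ k"
    using cyclic_cover_form[OF bx] unfolding n_def by blast
  define v where "v s = \<rho> (s ^ n)" for s
  have "(\<lambda>s. s ^ n) analytic_on {0}" by (intro analytic_intros)
  then have v: "v analytic_on {0}" unfolding v_def
    by (rule analytic_comp) (use \<rho>(1) n(1) in \<open>simp add: power_0_left\<close>)
  have v0: "v 0 \<noteq> 0" using \<rho>(2) n(1) by (simp add: v_def power_0_left)
  obtain V where V: "V analytic_on {0}" "V 0 = 0" and dV: "\<forall>\<^sub>F s in nhds 0. deriv V s = v s"
    using analytic_primitive[OF v] by blast
  have dV0: "deriv V 0 = v 0" using dV eventually_nhds_x_imp_x by blast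
  then obtain W where W: "W analytic_on {0}" "W 0 = 0" and VW: "\<forall>\<^sub>F z in nhds 0. V (W z) = z"
    and WV: "\<forall>\<^sub>F s in nhds 0. W (V s) = s"
    using analytic_local_inverse[OF V] v0 by auto
  have chainW: "\<forall>\<^sub>F z in nhds 0. v (W z) * deriv W z = 1"
  proof -
    have "\<forall>\<^sub>F z in nhds 0. V analytic_on {W z}" "\<forall>\<^sub>F z in nhds 0. deriv V (W z) = v (W z)"
      using eventually_analytic_comp[OF W(1)] analytic_eventually[OF V(1)] dV W(2) by auto
    moreover have "\<forall>\<^sub>F z in nhds 0. \<forall>\<^sub>F y in nhds z. V (W y) = y"
      using VW by (simp add: eventually_eventually)
    ultimately show ?thesis using analytic_eventually[OF W(1)]
    proof eventually_elim
      case (elim z)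
      have "deriv (\<lambda>y. V (W y)) z = deriv (\<lambda>y. y) z" by (rule deriv_cong_ev[OF elim(3) refl])
      then show ?case using deriv_comp[OF elim(4,1)] elim(2) by simp
    qed
  qed
  have dW0: "deriv W 0 \<noteq> 0" using eventually_nhds_x_imp_x[OF chainW] by auto
  have Wne: "\<forall>\<^sub>F z in at 0. W z \<noteq> 0"
  proof -
    have "\<forall>\<^sub>F z in at 0. V (W z) = z" using VW by (simp add: eventually_nhds_conv_at)
    moreover have "\<forall>\<^sub>F z in at 0. z \<noteq> (0::complex)" by (simp add: eventually_at_filter)
    ultimately show ?thesis by eventually_elim (use V(2) in auto)
  qed
  have 1: "\<forall>\<^sub>F z in at 0. loc x (W z ^ n) * deriv (\<lambda>z. W z ^ n) z ^ k = 1"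
  proof -
    have "\<forall>\<^sub>F z in at 0. v (W z) * deriv W z = 1" using chainW by (simp add: eventually_nhds_conv_at)
    with form[OF W Wne] show ?thesis by eventually_elim (simp add: v_def)
  qed
  have 2: "\<forall>\<^sub>F z in nhds 0. W (\<eta> * z) = \<eta> * W z" if \<eta>: "\<eta> ^ n = 1" for \<eta>
  proof -
    have mult: "(\<lambda>s. \<eta> * s) analytic_on {z}" for z by (intro analytic_intros)
    \<comment> \<open>Both sides have the derivative \<open>\<eta> v(s)\<close>, because \<open>v(s)\<close> depends on \<open>s^n\<close> only.\<close>
    have V\<eta>: "\<forall>\<^sub>F s in nhds 0. V (\<eta> * s) = \<eta> * V s"
    proof (rule analytic_eq_if_deriv_eq)
      show "(\<lambda>s. V (\<eta> * s)) analytic_on {0}" using analytic_comp[OF mult, of V 0] V(1) by simp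
      show "(\<lambda>s. \<eta> * V s) analytic_on {0}" using V(1) by (intro analytic_intros)
      show "V (\<eta> * 0) = \<eta> * V 0" using V(2) by simp
      have "\<forall>\<^sub>F s in nhds 0. deriv V (\<eta> * s) = v (\<eta> * s)" "\<forall>\<^sub>F s in nhds 0. V analytic_on {\<eta> * s}"
        using eventually_analytic_comp[OF mult[of 0]] dV analytic_eventually[OF V(1)] by auto
      then show "\<forall>\<^sub>F s in nhds 0. deriv (\<lambda>s. V (\<eta> * s)) s = deriv (\<lambda>s. \<eta> * V s) s"
        using dV analytic_eventually[OF V(1)]
      proof eventually_elim
        case (elim s)
        have "deriv (\<lambda>s. V (\<eta> * s)) s = deriv V (\<eta> * s) * deriv (\<lambda>s. \<eta> * s) s"
          by (rule deriv_comp[OF mult elim(2)])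
        also have "deriv (\<lambda>s. \<eta> * s) s = \<eta>" by (rule DERIV_imp_deriv) (auto intro!: derivative_eq_intros)
        also have "deriv V (\<eta> * s) = v s" using elim(1) \<eta> by (simp add: v_def power_mult_distrib)
        also have "v s * \<eta> = deriv (\<lambda>s. \<eta> * V s) s"
          using elim(3) analytic_derivI[OF elim(4)]
          by (intro DERIV_imp_deriv[symmetric]) (auto intro!: derivative_eq_intros)
        finally show ?case .
      qed
    qed
    have "\<forall>\<^sub>F z in nhds 0. V (\<eta> * W z) = \<eta> * V (W z)"
      using eventually_analytic_comp[OF W(1)] V\<eta> W(2) by simp
    moreover have "(\<lambda>z. \<eta> * W z) analytic_on {0}" using W(1) by (intro analytic_intros)
    from eventually_analytic_comp[OF this, of "\<lambda>s. W (V s) = s"]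
    have "\<forall>\<^sub>F z in nhds 0. W (V (\<eta> * W z)) = \<eta> * W z" using WV W(2) by simp
    ultimately show ?thesis using VW by eventually_elim simp
  qed
  have 3: "\<exists>\<alpha>. \<alpha> ^ k = C \<and> (\<forall>\<^sub>F z in nhds 0. H z = W (\<alpha> * z) ^ n)"
    if H: "H analytic_on {0}" "H 0 = 0" and ne: "\<forall>\<^sub>F z in at 0. H z \<noteq> 0" and C: "C \<noteq> 0"
      and eq: "\<forall>\<^sub>F z in at 0. loc x (H z) * deriv H z ^ k = C" for H C
  proof -
    obtain e g where e: "e \<ge> 1" and g: "g analytic_on {0}" "g 0 \<noteq> 0"
      and Hg: "\<forall>\<^sub>F z in nhds 0. H z = z ^ e * g z" and "int e * b x = int k"
      using constant_pull_order[OF H ne C eq] by blast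
    then have "int e * b x = int n * b x" using n(2) by simp
    then have en: "e = n" using bx by simp
    obtain \<gamma> where \<gamma>: "\<gamma> analytic_on {0}" "\<gamma> 0 \<noteq> 0" "\<forall>\<^sub>F z in nhds 0. \<gamma> z ^ n = g z"
      using analytic_root[OF g n(1)] by blast
    define h where "h z = z * \<gamma> z" for z
    have h: "h analytic_on {0}" "h 0 = 0" unfolding h_def using \<gamma>(1) by (auto intro!: analytic_intros)
    have Hh: "\<forall>\<^sub>F z in nhds 0. H z = h z ^ n"
      using Hg \<gamma>(3) by eventually_elim (simp add: en h_def power_mult_distrib)
    have hne: "\<forall>\<^sub>F z in at 0. h z \<noteq> 0"
    proof -
      have "\<forall>\<^sub>F z in at 0. H z = h z ^ n" using Hh by (simp add: eventually_nhds_conv_at)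
      with ne show ?thesis by eventually_elim (use n(1) in auto)
    qed
    have "\<forall>\<^sub>F z in nhds 0. \<forall>\<^sub>F y in nhds z. H y = h y ^ n"
      using Hh by (simp add: eventually_eventually)
    then have "\<forall>\<^sub>F z in nhds 0. H z = h z ^ n \<and> deriv H z = deriv (\<lambda>z. h z ^ n) z"
      by eventually_elim (auto intro: deriv_cong_ev dest: eventually_nhds_x_imp_x)
    then have Hh': "\<forall>\<^sub>F z in at 0. H z = h z ^ n \<and> deriv H z = deriv (\<lambda>z. h z ^ n) z"
      by (simp add: eventually_nhds_conv_at)
    have Vh: "(\<lambda>z. V (h z)) analytic_on {0}" using analytic_comp[OF h(1), of V] V(1) h(2) by simp
    define m where "m = deriv (\<lambda>z. V (h z))"
    have m: "m analytic_on {0}" unfolding m_def using Vh by (rule analytic_deriv)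
    have "\<forall>\<^sub>F z in nhds 0. V analytic_on {h z}" "\<forall>\<^sub>F z in nhds 0. deriv V (h z) = v (h z)"
      using eventually_analytic_comp[OF h(1)] analytic_eventually[OF V(1)] dV h(2) by auto
    then have "\<forall>\<^sub>F z in nhds 0. m z = v (h z) * deriv h z"
      using analytic_eventually[OF h(1)]
    proof eventually_elim
      case (elim z)
      show ?case using deriv_comp[OF elim(3,1)] elim(2) by (simp add: m_def)
    qed
    then have "\<forall>\<^sub>F z in at 0. m z = v (h z) * deriv h z" by (simp add: eventually_nhds_conv_at)
    with form[OF h hne] eq Hh' have "\<forall>\<^sub>F z in at 0. m z ^ k = C"
      by eventually_elim (simp add: v_def)
    \<comment> \<open>Hence the derivative \<open>m\<close> of \<open>V \<circ> h\<close> is constant near \<open>0\<close>.\<close>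
    note m_const = analytic_power_const[OF m k_ge_1 this]
    define \<alpha> where "\<alpha> = m 0"
    have "\<forall>\<^sub>F z in nhds 0. V (h z) = \<alpha> * z"
    proof (rule analytic_eq_if_deriv_eq[OF Vh])
      show "(\<lambda>z. \<alpha> * z) analytic_on {0}" by (intro analytic_intros)
      show "V (h 0) = \<alpha> * 0" using h V by simp
      have "deriv (\<lambda>z. \<alpha> * z) z = \<alpha>" for z by (rule DERIV_imp_deriv) (auto intro!: derivative_eq_intros)
      then show "\<forall>\<^sub>F z in nhds 0. deriv (\<lambda>z. V (h z)) z = deriv (\<lambda>z. \<alpha> * z) z"
        using m_const(2) by (simp add: m_def \<alpha>_def)
    qed
    moreover have "\<forall>\<^sub>F z in nhds 0. W (V (h z)) = h z"
      using eventually_analytic_comp[OF h(1), of "\<lambda>s. W (V s) = s"] WV h(2) by simp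
    ultimately have "\<forall>\<^sub>F z in nhds 0. H z = W (\<alpha> * z) ^ n"
      using Hh by eventually_elim simp
    then show ?thesis using m_const(1) \<alpha>_def by blast
  qed
  have "normal_form x W"
    unfolding normal_form_def n_def[symmetric]
  proof (intro conjI allI impI)
    fix \<eta> :: complex assume "\<eta> ^ n = 1"
    then show "\<forall>\<^sub>F z in nhds 0. W (\<eta> * z) = \<eta> * W z" by (rule 2)
  next
    fix H C assume "H analytic_on {0}" "H 0 = 0" "\<forall>\<^sub>F z in at 0. H z \<noteq> 0" "C \<noteq> 0"
      "\<forall>\<^sub>F z in at 0. loc x (H z) * deriv H z ^ k = C"
    then show "\<exists>\<alpha>. \<alpha> ^ k = C \<and> (\<forall>\<^sub>F z in nhds 0. H z = W (\<alpha> * z) ^ n)" by (rule 3)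
  qed (rule W dW0 1)+
  then show ?thesis by (rule exI[of "normal_form x" W])
qed

end

section \<open>Uniformization by linearization at a repelling fixed point\<close>

text \<open>
  Change of local parameter: at \<open>t \<noteq> 0\<close> the parameter at infinity is compared with the one at \<open>1/t\<close>.
\<close>

lemma P1_analytic_local_param_at: "P1_analytic (local_param x) t"
proof (cases x)
  case (Fin a)
  show ?thesis unfolding P1_analytic_def
    by (rule exI[of _ "\<lambda>s. s - t"]) (auto simp: Fin intro!: analytic_intros always_eventually)
next
  case Infty
  show ?thesis
  proof (cases "t = 0")
    case True
    then show ?thesis using P1_analytic_local_param by simp
  next
    case False
    have "\<forall>\<^sub>F s in nhds t. s \<noteq> 0" using False by (intro t1_space_nhds) auto
    then have "\<forall>\<^sub>F s in nhds t. local_param x s = local_param (local_param x t) (1 / s - 1 / t)"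
      by eventually_elim (simp add: Infty False)
    then show ?thesis unfolding P1_analytic_def
      using False by (intro exI[of _ "\<lambda>s. 1 / s - 1 / t"]) (auto intro!: analytic_intros)
  qed
qed

lemma P1_analytic_eventually:
  assumes "P1_analytic h z"
  shows "\<forall>\<^sub>F w in nhds z. P1_analytic h w"
proof -
  obtain F where F: "F analytic_on {z}" and Fe: "\<forall>\<^sub>F w in nhds z. h w = local_param (h z) (F w)"
    using assms unfolding P1_analytic_def by blast
  have "\<forall>\<^sub>F w in nhds z. \<forall>\<^sub>F v in nhds w. h v = local_param (h z) (F v)"
    using Fe by (simp add: eventually_eventually)
  then show ?thesis using analytic_eventually[OF F]
  proof eventually_elim
    case (elim w)
    have "P1_analytic (\<lambda>v. local_param (h z) (F v)) w"
      by (rule P1_analytic_compose[OF P1_analytic_local_param_at elim(2)])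
    then show ?case using P1_analytic_cong[OF elim(1)] by simp
  qed
qed

context rational_map
begin

lemma finite_fixed_points: "finite {y. f y = y}"
proof -
  define G where "G = [:0, 1:] * r - p"
  have fixG: "f (Fin a) = Fin a \<longleftrightarrow> poly G a = 0" for a
    unfolding G_def by (rule fixed_point_iff)
  have "G \<noteq> 0"
  proof
    assume "G = 0"
    then have p: "p = [:0, 1:] * r" by (simp add: G_def)
    then have "r dvd p" by (simp only: dvd_triv_right)
    then have "is_unit r" using coprime by (metis coprime_absorb_right coprime_commute)
    then have "r \<noteq> 0" "degree r = 0" using is_unit_iff_degree not_is_unit_0 by metis+
    then have "degree p = 1" unfolding p by (subst degree_mult_eq) auto
    then show False using \<open>degree r = 0\<close> d_eq d_gt_1 by simp
  qed
  then have "finite {a. poly G a = 0}" by (rule poly_roots_finite)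
  then have "finite (insert Infty (Fin ` {a. poly G a = 0}))" by simp
  moreover have "{y. f y = y} \<subseteq> insert Infty (Fin ` {a. poly G a = 0})"
  proof
    fix y assume "y \<in> {y. f y = y}"
    then show "y \<in> insert Infty (Fin ` {a. poly G a = 0})" by (cases y) (auto simp: fixG)
  qed
  ultimately show ?thesis using finite_subset by blast
qed

lemma not_locally_identity: "\<not> (\<forall>\<^sub>F t in nhds 0. f (local_param y t) = local_param y t)"
proof
  assume eq: "\<forall>\<^sub>F t in nhds 0. f (local_param y t) = local_param y t"
  have "finite (local_param y -` {y. f y = y})"
    by (rule finite_vimageI[OF finite_fixed_points]) (simp add: inj_on_def local_param_inject)
  then have "finite {t. f (local_param y t) = local_param y t}" by (simp add: vimage_def)
  then have "\<forall>\<^sub>F t in at 0. t \<notin> {t. f (local_param y t) = local_param y t}"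
    using islimpt_finite islimpt_iff_eventually by blast
  moreover have "\<forall>\<^sub>F t in at 0. f (local_param y t) = local_param y t"
    using eq by (simp add: eventually_nhds_conv_at)
  ultimately have "\<forall>\<^sub>F t in at (0::complex). False" by eventually_elim simp
  then show False by simp
qed

end

context invariant_section
begin

text \<open>
  The pullback of \<open>q\<close> along \<open>h\<close> is \<open>C dz^k\<close> near \<open>z\<close>.
\<close>

definition flat_at :: "complex \<Rightarrow> (complex \<Rightarrow> P1) \<Rightarrow> complex \<Rightarrow> bool" where
  "flat_at C h z \<longleftrightarrow> P1_analytic h z \<and> (\<forall>\<^sub>F w in at z. pull h w = C)"

lemma flat_at_local:
  assumes "flat_at C h z" and C: "C \<noteq> 0"
  obtains F where "F analytic_on {z}" "F z = 0" "\<forall>\<^sub>F w in at z. F w \<noteq> 0"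
    "\<forall>\<^sub>F w in nhds z. h w = local_param (h z) (F w)"
    "\<forall>\<^sub>F w in at z. loc (h z) (F w) * deriv F w ^ k = C"
proof -
  obtain F where F: "F analytic_on {z}" "F z = 0" and Fe: "\<forall>\<^sub>F w in nhds z. h w = local_param (h z) (F w)"
    using assms unfolding flat_at_def P1_analytic_def by blast
  have pullC: "\<forall>\<^sub>F w in at z. pull h w = C" using assms unfolding flat_at_def by blast
  have ne: "\<forall>\<^sub>F w in at z. F w \<noteq> 0"
  proof (rule ccontr)
    assume "\<not> ?thesis"
    then have "\<exists>\<^sub>F w in at z. F w = 0" by (simp add: frequently_def)
    then have "\<forall>\<^sub>F w in nhds z. F w = 0"
      by (intro analytic_frequently_eq[of F z "\<lambda>_. 0"] F) auto
    with Fe have "\<forall>\<^sub>F w in nhds z. h w = h z" by eventually_elim simp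
    then have "\<forall>\<^sub>F w in nhds z. \<forall>\<^sub>F v in nhds w. h v = h z" by (simp add: eventually_eventually)
    then have "\<forall>\<^sub>F w in at z. \<forall>\<^sub>F v in nhds w. h v = h z" by (simp add: eventually_nhds_conv_at)
    with pullC have "\<forall>\<^sub>F w in at z. False"
    proof eventually_elim
      case (elim w)
      have "pull h w = pull (\<lambda>_. h z) w" by (rule pull_cong[OF elim(2)])
      also have "\<dots> = 0" using k_ge_1 by (simp add: pull_def)
      finally show ?case using elim(1) C by simp
    qed
    then show False by simp
  qed
  have "\<forall>\<^sub>F w in at z. loc (h z) (F w) * deriv F w ^ k = C"
    using pull_chain[OF F(1) ne Fe] pullC by eventually_elim simp
  then show thesis using that F ne Fe by blast
qed

lemma flat_at_cong:
  assumes "\<forall>\<^sub>F w in nhds z. h w = g w"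
  shows "flat_at C h z \<longleftrightarrow> flat_at C g z"
proof -
  have "\<forall>\<^sub>F w in nhds z. \<forall>\<^sub>F v in nhds w. h v = g v" using assms by (simp add: eventually_eventually)
  then have "\<forall>\<^sub>F w in at z. \<forall>\<^sub>F v in nhds w. h v = g v" by (simp add: eventually_nhds_conv_at)
  then have "\<forall>\<^sub>F w in at z. pull h w = pull g w" by eventually_elim (rule pull_cong)
  then have "(\<forall>\<^sub>F w in at z. pull h w = C) \<longleftrightarrow> (\<forall>\<^sub>F w in at z. pull g w = C)"
    by (rule eventually_cong) simp
  then show ?thesis unfolding flat_at_def using P1_analytic_cong[OF assms] by simp
qed

lemma flat_at_eventually:
  assumes "flat_at C h z"
  shows "\<forall>\<^sub>F w in nhds z. flat_at C h w"
proof -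
  have "\<forall>\<^sub>F w in at z. \<forall>\<^sub>F v in nhds w. pull h v = C"
    using assms eventually_at_nhds unfolding flat_at_def by blast
  moreover have "\<forall>\<^sub>F w in at z. P1_analytic h w"
    using P1_analytic_eventually assms unfolding flat_at_def by (simp add: eventually_nhds_conv_at)
  ultimately have "\<forall>\<^sub>F w in at z. flat_at C h w"
    by eventually_elim (simp add: flat_at_def eventually_nhds_conv_at)
  then show ?thesis using assms by (simp add: eventually_nhds_conv_at)
qed

lemma flat_at_f:
  assumes "flat_at C h z" "C \<noteq> 0"
  shows "flat_at (c * C) (\<lambda>w. f (h w)) z"
proof -
  obtain F where F: "F analytic_on {z}" "F z = 0" "\<forall>\<^sub>F w in at z. F w \<noteq> 0"
    "\<forall>\<^sub>F w in nhds z. h w = local_param (h z) (F w)"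
    using flat_at_local[OF assms] by blast
  have "\<forall>\<^sub>F w in at z. pull (\<lambda>w. f (h w)) w = c * C"
    using pull_f_compose[OF F] assms(1) unfolding flat_at_def by (auto elim: eventually_elim2)
  then show ?thesis using f_P1_analytic_compose assms(1) unfolding flat_at_def by blast
qed

lemma flat_at_iterate:
  assumes "flat_at C h z" "C \<noteq> 0"
  shows "flat_at (c ^ m * C) (\<lambda>w. (f ^^ m) (h w)) z"
proof (induction m)
  case 0
  then show ?case using assms by simp
next
  case (Suc m)
  then show ?case using flat_at_f[OF Suc] assms(2) c_nonzero by (simp add: mult.assoc)
qed

lemma flat_at_affine:
  assumes h: "flat_at C h (\<omega> * z + \<beta>)" and C: "C \<noteq> 0" and \<omega>: "\<omega> \<noteq> 0"
  shows "flat_at (C * \<omega> ^ k) (\<lambda>w. h (\<omega> * w + \<beta>)) z"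
proof -
  define A where "A w = \<omega> * w + \<beta>" for w
  have A: "A analytic_on {z}" for z unfolding A_def by (intro analytic_intros)
  have dA: "deriv A w = \<omega>" for w
    unfolding A_def by (rule DERIV_imp_deriv) (auto intro!: derivative_eq_intros)
  have Ane: "\<forall>\<^sub>F w in at z. A w \<noteq> A z"
    using \<omega> by (auto simp: A_def eventually_at_filter)
  obtain F where F: "F analytic_on {A z}" "F (A z) = 0" "\<forall>\<^sub>F w in at (A z). F w \<noteq> 0"
    "\<forall>\<^sub>F w in nhds (A z). h w = local_param (h (A z)) (F w)"
    "\<forall>\<^sub>F w in at (A z). loc (h (A z)) (F w) * deriv F w ^ k = C"
    using flat_at_local[OF h C] unfolding A_def by blast
  have FA: "(\<lambda>w. F (A w)) analytic_on {z}" by (rule analytic_comp[OF A F(1)])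
  have "P1_analytic (\<lambda>w. h (A w)) z"
    using P1_analytic_compose[OF _ A, of h z] h by (simp add: flat_at_def A_def)
  moreover have "\<forall>\<^sub>F w in at z. pull (\<lambda>w. h (A w)) w = C * \<omega> ^ k"
  proof -
    have 1: "\<forall>\<^sub>F w in at z. F (A w) \<noteq> 0"
      by (rule eventually_at_analytic_compose[OF A refl Ane F(3)])
    have 2: "\<forall>\<^sub>F w in nhds z. h (A w) = local_param (h (A z)) (F (A w))"
      by (rule eventually_analytic_comp[OF A F(4)])
    have 3: "\<forall>\<^sub>F w in at z. loc (h (A z)) (F (A w)) * deriv F (A w) ^ k = C"
      by (rule eventually_at_analytic_compose[OF A refl Ane F(5)])
    have "\<forall>\<^sub>F w in nhds z. F analytic_on {A w}"
      by (rule eventually_analytic_comp[OF A analytic_eventually[OF F(1)]])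
    then have 4: "\<forall>\<^sub>F w in at z. F analytic_on {A w}" by (simp add: eventually_nhds_conv_at)
    show ?thesis using pull_chain[OF FA 1 2] 3 4
    proof eventually_elim
      case (elim w)
      have "deriv (\<lambda>w. F (A w)) w = deriv F (A w) * \<omega>"
        using deriv_comp[OF A elim(3)] dA by simp
      then show ?case using elim(1,2) by (auto simp: power_mult_distrib mult_ac)
    qed
  qed
  ultimately show ?thesis by (simp add: flat_at_def A_def)
qed

lemma boundary_local_degree:
  assumes "b y = 0"
  shows "local_degree f y = d"
proof (rule finite_backward_invariant)
  show "finite {y. b y = 0}"
    by (rule finite_subset[OF _ finite_singular]) (use k_ge_1 in auto)
  show "f z \<in> {y. b y = 0} \<Longrightarrow> z \<in> {y. b y = 0}" for z using b_multiplicative[of z] by simp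
qed (use assms in simp)

text \<open>
  The points with \<open>b = 0\<close> form a finite backward invariant set, so they are totally ramified; in
  particular they are superattracting if fixed.
\<close>

lemma multiplier_boundary:
  assumes "f y = y" "b y = 0"
  shows "multiplier y = 0"
proof -
  obtain F where F: "F analytic_on {0}" "F 0 = 0" "deriv F 0 = multiplier y"
    "\<forall>\<^sub>F t in nhds 0. f (local_param y t) = local_param y (F t)"
    using multiplier_local_form[OF assms(1)] by blast
  obtain g where g: "g analytic_on {0}"
    and ge: "\<forall>\<^sub>F t in nhds 0. f (local_param y t) = local_param (f y) (t ^ local_degree f y * g t)"
    using f_local_factor by blast
  have "\<forall>\<^sub>F t in nhds 0. F t = t ^ d * g t"
    using F(4) ge by eventually_elim (simp add: assms boundary_local_degree local_param_inject)
  then have "deriv F 0 = deriv (\<lambda>t. t ^ d * g t) 0" by (rule deriv_cong_ev) simp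
  also have "((\<lambda>t. t ^ d * g t) has_field_derivative 0) (at 0)"
    using analytic_derivI[OF g] d_gt_1 by (auto intro!: derivative_eq_intros simp: power_0_left)
  then have "deriv (\<lambda>t. t ^ d * g t) 0 = 0" by (rule DERIV_imp_deriv)
  finally show ?thesis using F(3) by simp
qed

text \<open>
  At a fixed point of finite weight, \<open>f\<close> composed with the normal form \<open>\<phi>\<close> again pulls \<open>q\<close> back to
  a constant, hence equals \<open>\<phi>(\<alpha> z)\<close>. Comparing leading terms gives \<open>\<alpha>^n\<close> as the multiplier. If this is
  \<open>1\<close>, the symmetry of the normal form shows that \<open>f\<close> is the identity near the fixed point.
\<close>

lemma exists_linearization:
  "\<exists>\<phi> \<alpha>. flat_at 1 \<phi> 0 \<and> (\<forall>\<^sub>F z in nhds 0. f (\<phi> z) = \<phi> (\<alpha> * z)) \<and> \<alpha> ^ k = c \<and> norm \<alpha> > 1"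
proof -
  obtain x where fx: "f x = x" and mult: "multiplier x = 1 \<or> norm (multiplier x) > 1"
    using exists_repelling_or_parabolic_fixed_point by blast
  have bx: "b x \<noteq> 0" using multiplier_boundary[OF fx] mult by auto
  define n where "n = wt x"
  have n: "n \<ge> 1" using wt[OF bx] by (simp add: n_def)
  obtain W where "normal_form x W" using exists_normal_form[OF bx] by blast
  then have W: "W analytic_on {0}" "W 0 = 0" "deriv W 0 \<noteq> 0"
    and W1: "\<forall>\<^sub>F z in at 0. loc x (W z ^ n) * deriv (\<lambda>z. W z ^ n) z ^ k = 1"
    and Wsym: "\<And>\<eta>. \<eta> ^ n = 1 \<Longrightarrow> \<forall>\<^sub>F z in nhds 0. W (\<eta> * z) = \<eta> * W z"
    and Wuniq: "\<And>H C. H analytic_on {0} \<Longrightarrow> H 0 = 0 \<Longrightarrow> (\<forall>\<^sub>F z in at 0. H z \<noteq> 0) \<Longrightarrow> C \<noteq> 0 \<Longrightarrow>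
        (\<forall>\<^sub>F z in at 0. loc x (H z) * deriv H z ^ k = C) \<Longrightarrow>
        (\<exists>\<alpha>. \<alpha> ^ k = C \<and> (\<forall>\<^sub>F z in nhds 0. H z = W (\<alpha> * z) ^ n))"
    unfolding normal_form_def n_def by blast+
  define H0 where "H0 z = W z ^ n" for z
  have H0: "H0 analytic_on {0}" "H0 0 = 0" unfolding H0_def using W n by (auto intro!: analytic_intros)
  have H0ne: "\<forall>\<^sub>F z in at 0. H0 z \<noteq> 0"
  proof (rule ccontr)
    assume "\<not> ?thesis"
    then have "\<exists>\<^sub>F z in at 0. W z = 0" using n by (simp add: frequently_def H0_def)
    then have "\<forall>\<^sub>F z in nhds 0. W z = 0" by (intro analytic_frequently_eq[of W 0 "\<lambda>_. 0"] W) auto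
    then have "deriv W 0 = deriv (\<lambda>_. 0) 0" by (rule deriv_cong_ev) simp
    then show False using W(3) by simp
  qed
  define \<phi> where "\<phi> z = local_param x (H0 z)" for z
  have \<phi>_ev: "\<forall>\<^sub>F z in nhds 0. \<phi> z = local_param x (H0 z)" by (simp add: \<phi>_def)
  have flat: "flat_at 1 \<phi> 0"
  proof -
    have "P1_analytic \<phi> 0" unfolding \<phi>_def
      by (rule P1_analytic_compose[OF P1_analytic_local_param_at H0(1)])
    moreover have "\<forall>\<^sub>F z in at 0. pull \<phi> z = 1"
      using pull_chain[OF H0(1) H0ne \<phi>_ev] W1 by eventually_elim (simp add: H0_def)
    ultimately show ?thesis by (simp add: flat_at_def)
  qed
  obtain F where F: "F analytic_on {0}" "F 0 = 0" "deriv F 0 = multiplier x"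
    and fF: "\<forall>\<^sub>F t in nhds 0. f (local_param x t) = local_param x (F t)"
    using multiplier_local_form[OF fx] by blast
  have fphi: "\<forall>\<^sub>F z in nhds 0. f (\<phi> z) = local_param x (F (H0 z))"
    using eventually_analytic_comp[OF H0(1)] fF H0(2) by (simp add: \<phi>_def)
  have FH: "(\<lambda>z. F (H0 z)) analytic_on {0}" using analytic_comp[OF H0(1)] F(1) H0(2) by simp
  obtain F' where F': "F' analytic_on {0}" "F' 0 = 0" "\<forall>\<^sub>F w in at 0. F' w \<noteq> 0"
    "\<forall>\<^sub>F w in nhds 0. f (\<phi> w) = local_param (f (\<phi> 0)) (F' w)"
    "\<forall>\<^sub>F w in at 0. loc (f (\<phi> 0)) (F' w) * deriv F' w ^ k = c * 1"
    using flat_at_local[OF flat_at_f[OF flat]] c_nonzero by auto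
  have phi0: "f (\<phi> 0) = x" using H0(2) fx by (simp add: \<phi>_def)
  obtain \<alpha> where \<alpha>: "\<alpha> ^ k = c" "\<forall>\<^sub>F z in nhds 0. F' z = W (\<alpha> * z) ^ n"
    using Wuniq[OF F'(1,2,3) c_nonzero] F'(5) phi0 by auto
  have conj: "\<forall>\<^sub>F z in nhds 0. f (\<phi> z) = \<phi> (\<alpha> * z)"
    using F'(4)[unfolded phi0] \<alpha>(2) by eventually_elim (simp add: \<phi>_def H0_def)
  have FW: "\<forall>\<^sub>F z in nhds 0. F (H0 z) = W (\<alpha> * z) ^ n"
    using conj fphi by eventually_elim (simp add: \<phi>_def H0_def local_param_inject)
  \<comment> \<open>Compare the leading terms of \<open>F(W(z)^n) = W(\<alpha> z)^n\<close> at \<open>0\<close>.\<close>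
  have mult_eq: "multiplier x = \<alpha> ^ n"
  proof -
    have "filterlim H0 (at 0) (at 0)"
      using analytic_tendsto[OF H0(1)] H0(2) H0ne by (simp add: filterlim_at)
    moreover have "((\<lambda>t. F t / t) \<longlongrightarrow> multiplier x) (at 0)"
      using analytic_derivI[OF F(1), of UNIV] F(2,3) by (simp add: has_field_derivative_iff)
    ultimately have "((\<lambda>z. F (H0 z) / H0 z) \<longlongrightarrow> multiplier x) (at 0)"
      by (rule filterlim_compose[rotated])
    moreover have "\<forall>\<^sub>F z in at 0. F (H0 z) / H0 z = ((W (\<alpha> * z) / z) / (W z / z)) ^ n"
    proof -
      have "\<forall>\<^sub>F z in at 0. F (H0 z) = W (\<alpha> * z) ^ n" using FW by (simp add: eventually_nhds_conv_at)
      moreover have "\<forall>\<^sub>F z in at 0. z \<noteq> (0::complex)" by (simp add: eventually_at_filter)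
      ultimately show ?thesis by eventually_elim (simp add: H0_def power_divide)
    qed
    ultimately have 1: "((\<lambda>z. ((W (\<alpha> * z) / z) / (W z / z)) ^ n) \<longlongrightarrow> multiplier x) (at 0)"
      by (simp add: tendsto_cong)
    have "((\<lambda>z. W z / z) \<longlongrightarrow> deriv W 0) (at 0)"
      using analytic_derivI[OF W(1), of UNIV] W(2) by (simp add: has_field_derivative_iff)
    moreover have "((\<lambda>z. W (\<alpha> * z) / z) \<longlongrightarrow> deriv W 0 * \<alpha>) (at 0)"
    proof -
      have "((\<lambda>z. \<alpha> * z) has_field_derivative \<alpha>) (at 0)" by (auto intro!: derivative_eq_intros)
      then have "((\<lambda>z. W (\<alpha> * z)) has_field_derivative deriv W 0 * \<alpha>) (at 0)"
        using DERIV_chain2[of W "deriv W 0" "\<lambda>z. \<alpha> * z" 0 \<alpha>] analytic_derivI[OF W(1), of UNIV] by simp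
      then show ?thesis using W(2) by (simp add: has_field_derivative_iff)
    qed
    ultimately have "((\<lambda>z. ((W (\<alpha> * z) / z) / (W z / z)) ^ n) \<longlongrightarrow> (deriv W 0 * \<alpha> / deriv W 0) ^ n) (at 0)"
      using W(3) by (intro tendsto_intros)
    from tendsto_unique[OF _ 1 this] show ?thesis using W(3) by simp
  qed
  have "norm \<alpha> > 1"
  proof (cases "multiplier x = 1")
    case True
    then have "\<forall>\<^sub>F z in nhds 0. W (\<alpha> * z) = \<alpha> * W z" using mult_eq Wsym by simp
    with FW have "\<forall>\<^sub>F z in nhds 0. F (H0 z) = H0 z"
      by eventually_elim (use True mult_eq in \<open>simp add: H0_def power_mult_distrib\<close>)
    then have eqH: "\<forall>\<^sub>F z in at 0. F (H0 z) = H0 z" by (simp add: eventually_nhds_conv_at)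
    have "\<exists>\<^sub>F t in at 0. F t = t"
      unfolding frequently_def
    proof
      assume "\<forall>\<^sub>F t in at 0. F t \<noteq> t"
      then have "\<forall>\<^sub>F z in at 0. F (H0 z) \<noteq> H0 z" by (rule eventually_at_analytic_compose[OF H0 H0ne])
      with eqH have "\<forall>\<^sub>F z in at (0::complex). False" by eventually_elim simp
      then show False by simp
    qed
    then have "\<forall>\<^sub>F t in nhds 0. F t = t" by (intro analytic_frequently_eq F analytic_intros)
    with fF have "\<forall>\<^sub>F t in nhds 0. f (local_param x t) = local_param x t" by eventually_elim simp
    then show ?thesis using not_locally_identity by blast
  next
    case False
    then have "norm \<alpha> ^ n > 1" using mult mult_eq by (simp add: norm_power)
    then show ?thesis using power_le_one[of "norm \<alpha>" n] by (meson norm_ge_zero not_le)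
  qed
  then show ?thesis using flat conj \<alpha>(1) by blast
qed

text \<open>
  \<open>\<Theta>(z) = f^m(\<phi>(z / \<alpha>^m))\<close> for all \<open>m\<close> so large that \<open>z / \<alpha>^m\<close> is in the disc on which the
  linearization \<open>\<phi>\<close> is defined; the functional equation of \<open>\<phi>\<close> makes this independent of \<open>m\<close>.
\<close>

lemma exists_uniformization:
  "\<exists>\<Theta> \<alpha>. (\<forall>z. flat_at 1 \<Theta> z) \<and> (\<forall>z. f (\<Theta> z) = \<Theta> (\<alpha> * z)) \<and> norm \<alpha> > 1"
proof -
  obtain \<phi> \<alpha> where flat: "flat_at 1 \<phi> 0" and conj: "\<forall>\<^sub>F z in nhds 0. f (\<phi> z) = \<phi> (\<alpha> * z)"
    and \<alpha>k: "\<alpha> ^ k = c" and \<alpha>: "norm \<alpha> > 1"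
    using exists_linearization by blast
  have \<alpha>0: "\<alpha> \<noteq> 0" using \<alpha> by auto
  have "\<forall>\<^sub>F z in nhds 0. flat_at 1 \<phi> z \<and> f (\<phi> z) = \<phi> (\<alpha> * z)"
    using flat_at_eventually[OF flat] conj by eventually_elim simp
  then obtain \<epsilon> where \<epsilon>: "\<epsilon> > 0" and near: "\<And>z. norm z < \<epsilon> \<Longrightarrow> flat_at 1 \<phi> z"
    "\<And>z. norm z < \<epsilon> \<Longrightarrow> f (\<phi> z) = \<phi> (\<alpha> * z)"
    unfolding eventually_nhds_metric by auto
  define E where "E m z = (f ^^ m) (\<phi> (z / \<alpha> ^ m))" for m z
  have small: "\<exists>m. norm (z / \<alpha> ^ m) < \<epsilon>" for z
  proof -
    have "norm \<alpha> > 0" using \<alpha> by linarith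
    then have "norm (1 / \<alpha>) < 1" using \<alpha> by (simp add: norm_divide divide_less_eq)
    then have "(\<lambda>m. (1 / \<alpha>) ^ m) \<longlonglongrightarrow> 0" by (rule LIMSEQ_power_zero)
    then have "(\<lambda>m. z * (1 / \<alpha>) ^ m) \<longlonglongrightarrow> z * 0" by (rule tendsto_mult_left)
    then have "\<forall>\<^sub>F m in sequentially. norm (z * (1 / \<alpha>) ^ m) < \<epsilon>"
      using \<epsilon> by (simp add: tendsto_iff dist_norm)
    then show ?thesis by (auto simp: power_divide dest: eventually_happens)
  qed
  have decr: "norm (z / \<alpha> ^ Suc m) \<le> norm (z / \<alpha> ^ m)" for z m
    using \<alpha> \<alpha>0 mult_right_mono[of 1 "norm \<alpha>" "norm z"]
    by (simp add: norm_divide norm_mult norm_power field_simps)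
  have stepE: "E (Suc m) z = E m z" if "norm (z / \<alpha> ^ m) < \<epsilon>" for m z
  proof -
    have "f (\<phi> (z / \<alpha> ^ Suc m)) = \<phi> (\<alpha> * (z / \<alpha> ^ Suc m))"
      by (rule near(2)) (use decr[of z m] that in linarith)
    also have "\<alpha> * (z / \<alpha> ^ Suc m) = z / \<alpha> ^ m" using \<alpha>0 by simp
    finally show ?thesis by (simp add: E_def funpow_swap1 del: power_Suc)
  qed
  have stable: "norm (z / \<alpha> ^ (m + j)) < \<epsilon> \<and> E (m + j) z = E m z" if "norm (z / \<alpha> ^ m) < \<epsilon>" for m j z
  proof (induction j)
    case 0
    then show ?case using that by simp
  next
    case (Suc j)
    then show ?case using stepE[of z "m + j"] decr[of z "m + j"] by simp
  qed
  define \<Theta> where "\<Theta> z = E (LEAST m. norm (z / \<alpha> ^ m) < \<epsilon>) z" for z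
  have \<Theta>: "\<Theta> z = E m z" if "norm (z / \<alpha> ^ m) < \<epsilon>" for z m
  proof -
    define l where "l = (LEAST m. norm (z / \<alpha> ^ m) < \<epsilon>)"
    have "l \<le> m" unfolding l_def using that by (rule Least_le)
    moreover have "norm (z / \<alpha> ^ l) < \<epsilon>" unfolding l_def by (rule LeastI_ex[OF small])
    ultimately show ?thesis using stable[of z l "m - l"] by (simp add: \<Theta>_def l_def)
  qed
  have "f (\<Theta> z) = \<Theta> (\<alpha> * z)" for z
  proof -
    obtain m where m: "norm (z / \<alpha> ^ m) < \<epsilon>" using small by blast
    have eq: "\<alpha> * z / \<alpha> ^ Suc m = z / \<alpha> ^ m" using \<alpha>0 by simp
    have "\<Theta> (\<alpha> * z) = E (Suc m) (\<alpha> * z)" by (rule \<Theta>) (simp only: eq m)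
    also have "\<dots> = f (E m z)" unfolding E_def eq by simp
    finally show ?thesis using \<Theta>[OF m] by simp
  qed
  moreover have "flat_at 1 \<Theta> z" for z
  proof -
    obtain m where m: "norm (z / \<alpha> ^ m) < \<epsilon>" using small by blast
    have 1: "flat_at 1 \<phi> ((1 / \<alpha> ^ m) * z + 0)" using near(1)[OF m] by simp
    have "flat_at (1 * (1 / \<alpha> ^ m) ^ k) (\<lambda>w. \<phi> ((1 / \<alpha> ^ m) * w + 0)) z"
      by (rule flat_at_affine[OF 1]) (use \<alpha>0 in auto)
    from flat_at_iterate[OF this, of m]
    have "flat_at (c ^ m * (1 / \<alpha> ^ m) ^ k) (E m) z" using \<alpha>0 by (simp add: E_def[abs_def])
    also have "c ^ m * (1 / \<alpha> ^ m) ^ k = 1"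
      unfolding \<alpha>k[symmetric] using \<alpha>0 by (simp add: power_divide flip: power_mult) (simp add: mult.commute)
    finally have 2: "flat_at 1 (E m) z" .
    have "isCont (\<lambda>w. norm (w / \<alpha> ^ m)) z" using \<alpha>0 by (intro continuous_intros) auto
    then have "filterlim (\<lambda>w. norm (w / \<alpha> ^ m)) (nhds (norm (z / \<alpha> ^ m))) (nhds z)"
      using tendsto_at_iff_tendsto_nhds[of "\<lambda>w. norm (w / \<alpha> ^ m)" z] by (simp only: isCont_def)
    then have "\<forall>\<^sub>F w in nhds z. norm (w / \<alpha> ^ m) < \<epsilon>" using m by (rule order_tendstoD(2))
    then have "\<forall>\<^sub>F w in nhds z. \<Theta> w = E m w" by eventually_elim (rule \<Theta>)
    then show ?thesis using 2 flat_at_cong by simp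
  qed
  ultimately show ?thesis using \<alpha> by blast
qed

end

section \<open>Fibres, stabilizers and periods of the uniformization\<close>

text \<open>
  An affine coordinate on the complement of \<open>x\<close>; at \<open>x\<close> itself its value is a dummy.
\<close>

definition away_coord :: "P1 \<Rightarrow> P1 \<Rightarrow> complex" where
  "away_coord x y = (case x of Infty \<Rightarrow> coord y
     | Fin a \<Rightarrow> (case y of Infty \<Rightarrow> 0 | Fin w \<Rightarrow> 1 / (w - a)))"

lemma away_coord_inject:
  assumes "y \<noteq> x" "z \<noteq> x" "away_coord x y = away_coord x z"
  shows "y = z"
  using assms by (cases x; cases y; cases z) (auto simp: away_coord_def)

lemma away_coord_analytic:
  assumes h: "P1_analytic h z" and ne: "h z \<noteq> x"
  shows "(\<lambda>w. away_coord x (h w)) analytic_on {z}"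
proof -
  obtain F where F: "F analytic_on {z}" "F z = 0" and Fe: "\<forall>\<^sub>F w in nhds z. h w = local_param (h z) (F w)"
    using h unfolding P1_analytic_def by blast
  have lim: "filterlim F (nhds 0) (nhds z)" using analytic_tendsto_nhds[OF F(1)] F(2) by simp
  have "\<exists>g. g analytic_on {z} \<and> (\<forall>\<^sub>F w in nhds z. away_coord x (h w) = g w)"
  proof (cases x)
    case x: Infty
    then obtain a where a: "h z = Fin a" using ne by (cases "h z") auto
    have "\<forall>\<^sub>F w in nhds z. away_coord x (h w) = a + F w"
      using Fe by eventually_elim (simp add: a x away_coord_def)
    moreover have "(\<lambda>w. a + F w) analytic_on {z}" by (intro analytic_intros F)
    ultimately show ?thesis by blast
  next
    case x: (Fin a)
    show ?thesis
    proof (cases "h z")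
      case Infty
      have "filterlim (\<lambda>w. 1 - a * F w) (nhds (1 - a * 0)) (nhds z)" by (intro tendsto_intros lim)
      then have "\<forall>\<^sub>F w in nhds z. 1 - a * F w \<noteq> 0"
        using tendsto_imp_eventually_ne[of "\<lambda>w. 1 - a * F w" 1 "nhds z" 0] by simp
      with Fe have "\<forall>\<^sub>F w in nhds z. away_coord x (h w) = F w / (1 - a * F w)"
        by eventually_elim (auto simp: Infty x away_coord_def field_simps)
      moreover have "(\<lambda>w. F w / (1 - a * F w)) analytic_on {z}"
        by (intro analytic_intros F) (use F(2) in auto)
      ultimately show ?thesis by blast
    next
      case (Fin c)
      then have "c \<noteq> a" using ne x by simp
      have "\<forall>\<^sub>F w in nhds z. away_coord x (h w) = 1 / (c + F w - a)"
        using Fe by eventually_elim (simp add: Fin x away_coord_def)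
      moreover have "(\<lambda>w. 1 / (c + F w - a)) analytic_on {z}"
        by (intro analytic_intros F) (use F(2) \<open>c \<noteq> a\<close> in auto)
      ultimately show ?thesis by blast
    qed
  qed
  then show ?thesis using analytic_at_cong by metis
qed

lemma away_coord_entire:
  assumes h: "\<And>z. P1_analytic h z" and x: "x \<notin> range h"
  shows "(\<lambda>w. away_coord x (h w)) holomorphic_on UNIV"
proof -
  have "(\<lambda>w. away_coord x (h w)) analytic_on {z}" for z
    by (rule away_coord_analytic[OF h]) (use x in auto)
  then show ?thesis using analytic_on_analytic_at analytic_imp_holomorphic by blast
qed

lemma little_Picard_P1:
  assumes h: "\<And>z. P1_analytic h z" and x: "x \<notin> range h" "y \<notin> range h" "u \<notin> range h"
    and ne: "x \<noteq> y" "x \<noteq> u" "y \<noteq> u"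
  shows "h z = h w"
proof -
  let ?g = "\<lambda>w. away_coord x (h w)"
  have avoid: "?g w \<noteq> away_coord x v" if "v \<noteq> x" "v \<notin> range h" for v w
    using that x(1) away_coord_inject by (metis rangeI)
  have "away_coord x y \<noteq> away_coord x u"
    using away_coord_inject ne by metis
  moreover have "range ?g \<inter> {away_coord x y, away_coord x u} = {}"
  proof -
    have "away_coord x y \<noteq> ?g w" "away_coord x u \<noteq> ?g w" for w
      using avoid[of y w] avoid[of u w] ne x(2,3) by metis+
    then show ?thesis by (intro equals0I) (metis IntE imageE insertE singletonD)
  qed
  ultimately obtain c where "?g = (\<lambda>_. c)"
    using little_Picard[OF away_coord_entire[OF h x(1)]] by blast
  then have "?g z = ?g w" by metis
  then show ?thesis using away_coord_inject x(1) by (metis rangeI)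
qed

context invariant_section
begin

text \<open>
  The constant \<open>C\<close> is left open and a translation part \<open>\<beta>\<close> is admitted, so that the notion is stable
  under affine changes of the variable.
\<close>

definition uniformizes :: "(complex \<Rightarrow> P1) \<Rightarrow> complex \<Rightarrow> complex \<Rightarrow> bool" where
  "uniformizes \<Theta> \<alpha> \<beta> \<longleftrightarrow> (\<exists>C. C \<noteq> 0 \<and> (\<forall>z. flat_at C \<Theta> z)) \<and>
     (\<forall>z. f (\<Theta> z) = \<Theta> (\<alpha> * z + \<beta>)) \<and> norm \<alpha> > 1"

lemma uniformizes_affine:
  assumes U: "uniformizes \<Theta> \<alpha> \<beta>" and w: "w \<noteq> 0"
  shows "uniformizes (\<lambda>z. \<Theta> (w * z + z0)) \<alpha> ((\<alpha> * z0 + \<beta> - z0) / w)"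
proof -
  obtain C where C: "C \<noteq> 0" "\<And>z. flat_at C \<Theta> z" using U unfolding uniformizes_def by blast
  have "flat_at (C * w ^ k) (\<lambda>z. \<Theta> (w * z + z0)) z" for z
    by (rule flat_at_affine[OF C(2,1) w])
  moreover have "C * w ^ k \<noteq> 0" using C w by simp
  moreover have "w * (\<alpha> * z + (\<alpha> * z0 + \<beta> - z0) / w) + z0 = \<alpha> * (w * z + z0) + \<beta>" for z
    using w by (simp add: field_simps)
  ultimately show ?thesis using U unfolding uniformizes_def by metis
qed

definition deck :: "(complex \<Rightarrow> P1) \<Rightarrow> (complex \<Rightarrow> complex) set" where
  "deck \<Theta> = {\<gamma>. \<exists>\<omega> t. \<omega> \<noteq> 0 \<and> \<gamma> = (\<lambda>z. \<omega> * z + t) \<and> (\<forall>z. \<Theta> (\<omega> * z + t) = \<Theta> z)}"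

definition periods :: "(complex \<Rightarrow> P1) \<Rightarrow> complex set" where
  "periods \<Theta> = {t. \<forall>z. \<Theta> (z + t) = \<Theta> z}"

definition rotations :: "(complex \<Rightarrow> P1) \<Rightarrow> complex set" where
  "rotations \<Theta> = {\<omega>. \<omega> \<noteq> 0 \<and> (\<exists>t. \<forall>z. \<Theta> (\<omega> * z + t) = \<Theta> z)}"

context
  fixes \<Theta> \<alpha> \<beta>
  assumes U: "uniformizes \<Theta> \<alpha> \<beta>"
begin

lemma \<Theta>_analytic: "P1_analytic \<Theta> z"
  using U unfolding uniformizes_def flat_at_def by blast

lemma \<Theta>_conj: "f (\<Theta> z) = \<Theta> (\<alpha> * z + \<beta>)"
  using U unfolding uniformizes_def by blast

lemma \<alpha>_norm: "norm \<alpha> > 1"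
  using U unfolding uniformizes_def by blast

lemma \<Theta>_local:
  obtains C F where "C \<noteq> 0" "F analytic_on {0}" "F 0 = 0" "\<forall>\<^sub>F u in at 0. F u \<noteq> 0"
    "\<forall>\<^sub>F u in nhds 0. \<Theta> (z + u) = local_param (\<Theta> z) (F u)"
    "\<forall>\<^sub>F u in at 0. loc (\<Theta> z) (F u) * deriv F u ^ k = C"
    "\<And>z. flat_at C \<Theta> z"
proof -
  obtain C where C: "C \<noteq> 0" "\<And>z. flat_at C \<Theta> z" using U unfolding uniformizes_def by blast
  have "flat_at (C * 1 ^ k) (\<lambda>u. \<Theta> (1 * u + z)) 0"
    by (rule flat_at_affine[OF C(2,1)]) simp
  then have "flat_at C (\<lambda>u. \<Theta> (u + z)) 0" by simp
  from flat_at_local[OF this C(1)] obtain F where "F analytic_on {0}" "F 0 = 0" "\<forall>\<^sub>F u in at 0. F u \<noteq> 0"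
    "\<forall>\<^sub>F u in nhds 0. \<Theta> (u + z) = local_param (\<Theta> (0 + z)) (F u)"
    "\<forall>\<^sub>F u in at 0. loc (\<Theta> (0 + z)) (F u) * deriv F u ^ k = C" by blast
  then show thesis using that C by (simp add: add.commute)
qed

lemma b_\<Theta>: "b (\<Theta> z) \<noteq> 0"
proof -
  obtain C F where "C \<noteq> 0" "F analytic_on {0}" "F 0 = 0" "\<forall>\<^sub>F u in at 0. F u \<noteq> 0"
    "\<forall>\<^sub>F u in at 0. loc (\<Theta> z) (F u) * deriv F u ^ k = C"
    using \<Theta>_local by blast
  then obtain e where "int e * b (\<Theta> z) = int k" using constant_pull_order by blast
  then show ?thesis using k_ge_1 by auto
qed

lemma \<Theta>_normal_form:
  assumes W: "normal_form x W"
  shows "\<exists>C\<noteq>0. \<forall>z. \<Theta> z = x \<longrightarrow> (\<exists>a. a ^ k = C \<and> (\<forall>\<^sub>F u in nhds 0. \<Theta> (z + u) = local_param x (W (a * u) ^ wt x)))"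
proof -
  obtain C where C: "C \<noteq> 0" "\<And>z. flat_at C \<Theta> z" using U unfolding uniformizes_def by blast
  have "\<exists>a. a ^ k = C \<and> (\<forall>\<^sub>F u in nhds 0. \<Theta> (z + u) = local_param x (W (a * u) ^ wt x))" if z: "\<Theta> z = x" for z
  proof -
    have "flat_at (C * 1 ^ k) (\<lambda>u. \<Theta> (1 * u + z)) 0"
      by (rule flat_at_affine[OF C(2,1)]) simp
    then have "flat_at C (\<lambda>u. \<Theta> (u + z)) 0" by simp
    from flat_at_local[OF this C(1)] obtain F where F: "F analytic_on {0}" "F 0 = 0" "\<forall>\<^sub>F u in at 0. F u \<noteq> 0"
      and eq: "\<forall>\<^sub>F u in nhds 0. \<Theta> (u + z) = local_param (\<Theta> (0 + z)) (F u)"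
      and inv: "\<forall>\<^sub>F u in at 0. loc (\<Theta> (0 + z)) (F u) * deriv F u ^ k = C" by blast
    have "\<exists>a. a ^ k = C \<and> (\<forall>\<^sub>F u in nhds 0. F u = W (a * u) ^ wt x)"
      using W F C(1) inv z unfolding normal_form_def by simp
    then obtain a where a: "a ^ k = C" "\<forall>\<^sub>F u in nhds 0. F u = W (a * u) ^ wt x" by blast
    have "\<forall>\<^sub>F u in nhds 0. \<Theta> (z + u) = local_param x (W (a * u) ^ wt x)"
      using eq a(2) by eventually_elim (simp add: z add.commute)
    then show ?thesis using a(1) by blast
  qed
  then show ?thesis using C(1) by blast
qed

lemma affine_identity:
  assumes "\<forall>\<^sub>F u in nhds 0. \<Theta> (w + \<omega> * u) = \<Theta> (z + u)"
  shows "\<Theta> (w + \<omega> * u) = \<Theta> (z + u)"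
proof -
  have "(\<lambda>u. \<Theta> (w + \<omega> * u)) = (\<lambda>u. \<Theta> (z + u))"
  proof (rule P1_analytic_identity)
    show "P1_analytic (\<lambda>u. \<Theta> (w + \<omega> * u)) v" for v
      by (rule P1_analytic_compose[OF \<Theta>_analytic]) (intro analytic_intros)
    show "P1_analytic (\<lambda>u. \<Theta> (z + u)) v" for v
      by (rule P1_analytic_compose[OF \<Theta>_analytic]) (intro analytic_intros)
  qed (rule assms)
  then show ?thesis by (rule fun_cong)
qed

text \<open>
  Near two points of a fibre, \<open>\<Theta>\<close> is given by the same normal form up to scaling the variable by \<open>a\<close>
  and \<open>a'\<close>. So the two germs are related by a rotation, and the identity theorem makes the relation global.
\<close>

lemma fibre_transitive:
  assumes "\<Theta> z = \<Theta> w"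
  shows "\<exists>\<omega>. \<omega> \<noteq> 0 \<and> (\<forall>u. \<Theta> (w + \<omega> * u) = \<Theta> (z + u))"
proof -
  obtain W where W: "normal_form (\<Theta> z) W" using exists_normal_form[OF b_\<Theta>] by blast
  obtain C where C: "C \<noteq> 0" and N: "\<And>y. \<Theta> y = \<Theta> z \<Longrightarrow>
      \<exists>a. a ^ k = C \<and> (\<forall>\<^sub>F u in nhds 0. \<Theta> (y + u) = local_param (\<Theta> z) (W (a * u) ^ wt (\<Theta> z)))"
    using \<Theta>_normal_form[OF W] by blast
  obtain a where a: "a ^ k = C" "\<forall>\<^sub>F u in nhds 0. \<Theta> (z + u) = local_param (\<Theta> z) (W (a * u) ^ wt (\<Theta> z))"
    using N by blast
  obtain a' where a': "a' ^ k = C" "\<forall>\<^sub>F u in nhds 0. \<Theta> (w + u) = local_param (\<Theta> z) (W (a' * u) ^ wt (\<Theta> z))"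
    using N[of w] assms by auto
  have ne: "a \<noteq> 0" "a' \<noteq> 0" using a(1) a'(1) C k_ge_1 by (auto simp: power_0_left)
  have "(\<lambda>u. a / a' * u) analytic_on {0}" by (intro analytic_intros)
  from eventually_analytic_comp[OF this, of "\<lambda>u. \<Theta> (w + u) = local_param (\<Theta> z) (W (a' * u) ^ wt (\<Theta> z))"]
  have "\<forall>\<^sub>F u in nhds 0. \<Theta> (w + a / a' * u) = local_param (\<Theta> z) (W (a' * (a / a' * u)) ^ wt (\<Theta> z))"
    using a'(2) by simp
  with a(2) have "\<forall>\<^sub>F u in nhds 0. \<Theta> (w + a / a' * u) = \<Theta> (z + u)"
    by eventually_elim (use ne in simp)
  from affine_identity[OF this] show ?thesis using ne by (intro exI[of _ "a / a'"]) auto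
qed

text \<open>
  In the normal form \<open>W^n\<close> with \<open>W\<close> injective and \<open>W(\<eta> z) = \<eta> W(z)\<close>, the rotations that leave \<open>W^n\<close>
  unchanged are those by \<open>n\<close>-th roots of unity.
\<close>

lemma stabilizer:
  "(\<forall>u. \<Theta> (z + \<omega> * u) = \<Theta> (z + u)) \<longleftrightarrow> \<omega> ^ wt (\<Theta> z) = 1"
proof -
  define n where "n = wt (\<Theta> z)"
  obtain W where W: "normal_form (\<Theta> z) W" using exists_normal_form[OF b_\<Theta>] by blast
  then have Wan: "W analytic_on {0}" "W 0 = 0" "deriv W 0 \<noteq> 0"
    and Wsym: "\<And>\<eta>. \<eta> ^ n = 1 \<Longrightarrow> \<forall>\<^sub>F z in nhds 0. W (\<eta> * z) = \<eta> * W z"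
    unfolding normal_form_def n_def by blast+
  obtain C where C: "C \<noteq> 0" and N: "\<And>y. \<Theta> y = \<Theta> z \<Longrightarrow>
      \<exists>a. a ^ k = C \<and> (\<forall>\<^sub>F u in nhds 0. \<Theta> (y + u) = local_param (\<Theta> z) (W (a * u) ^ n))"
    using \<Theta>_normal_form[OF W] unfolding n_def by blast
  obtain a where a: "a ^ k = C" and loc_z: "\<forall>\<^sub>F u in nhds 0. \<Theta> (z + u) = local_param (\<Theta> z) (W (a * u) ^ n)"
    using N by blast
  have a0: "a \<noteq> 0" using a C k_ge_1 by auto
  have "(\<lambda>u. \<omega> * u) analytic_on {0}" by (intro analytic_intros)
  from eventually_analytic_comp[OF this, of "\<lambda>u. \<Theta> (z + u) = local_param (\<Theta> z) (W (a * u) ^ n)"]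
  have loc_\<omega>: "\<forall>\<^sub>F u in nhds 0. \<Theta> (z + \<omega> * u) = local_param (\<Theta> z) (W (a * (\<omega> * u)) ^ n)"
    using loc_z by simp
  show ?thesis
    unfolding n_def[symmetric]
  proof
    assume eq: "\<forall>u. \<Theta> (z + \<omega> * u) = \<Theta> (z + u)"
    from loc_z loc_\<omega> have "\<forall>\<^sub>F u in nhds 0. W (a * (\<omega> * u)) ^ n = W (a * u) ^ n"
      by eventually_elim (use eq in \<open>metis local_param_inject\<close>)
    then have "\<forall>\<^sub>F u in at 0. W (a * (\<omega> * u)) ^ n = W (a * u) ^ n"
      by (simp add: eventually_nhds_conv_at)
    then have ev: "\<forall>\<^sub>F u in at 0. (W (a * (\<omega> * u)) / u) ^ n = (W (a * u) / u) ^ n"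
      by eventually_elim (simp add: power_divide)
    have lim: "((\<lambda>u. (W (s * u) / u) ^ n) \<longlongrightarrow> (deriv W 0 * s) ^ n) (at 0)" for s
    proof -
      have "((\<lambda>z. s * z) has_field_derivative s) (at 0)" by (auto intro!: derivative_eq_intros)
      then have "((\<lambda>z. W (s * z)) has_field_derivative deriv W 0 * s) (at 0)"
        using DERIV_chain2[of W "deriv W 0" "\<lambda>z. s * z" 0 s] analytic_derivI[OF Wan(1), of UNIV] by simp
      then have "((\<lambda>u. W (s * u) / u) \<longlongrightarrow> deriv W 0 * s) (at 0)" using Wan(2) by (simp add: has_field_derivative_iff)
      then show ?thesis by (rule tendsto_power)
    qed
    have "((\<lambda>u. (W (a * u) / u) ^ n) \<longlongrightarrow> (deriv W 0 * (a * \<omega>)) ^ n) (at 0)"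
      using lim[of "a * \<omega>"] ev by (simp add: tendsto_cong mult.assoc)
    from tendsto_unique[OF _ this lim[of a]] show "\<omega> ^ n = 1"
      using Wan(3) a0 by (simp add: power_mult_distrib)
  next
    assume \<omega>: "\<omega> ^ n = 1"
    have "(\<lambda>u. a * u) analytic_on {0}" by (intro analytic_intros)
    from eventually_analytic_comp[OF this, of "\<lambda>s. W (\<omega> * s) = \<omega> * W s"]
    have "\<forall>\<^sub>F u in nhds 0. W (\<omega> * (a * u)) = \<omega> * W (a * u)" using Wsym[OF \<omega>] by simp
    with loc_z loc_\<omega> have "\<forall>\<^sub>F u in nhds 0. \<Theta> (z + \<omega> * u) = \<Theta> (z + u)"
      by eventually_elim (use \<omega> in \<open>simp add: mult.left_commute power_mult_distrib\<close>)
    then show "\<forall>u. \<Theta> (z + \<omega> * u) = \<Theta> (z + u)" using affine_identity by blast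
  qed
qed

lemma linear_part_root_of_unity:
  assumes "\<omega> \<noteq> 0" and inv: "\<And>z. \<Theta> (\<omega> * z + t) = \<Theta> z"
  shows "\<omega> ^ k = 1"
proof -
  obtain C where C: "C \<noteq> 0" "\<And>z. flat_at C \<Theta> z" using U unfolding uniformizes_def by blast
  have "flat_at (C * \<omega> ^ k) (\<lambda>z. \<Theta> (\<omega> * z + t)) 0" by (rule flat_at_affine[OF C(2,1) assms(1)])
  then have "flat_at (C * \<omega> ^ k) \<Theta> 0" by (simp add: inv)
  then have "\<forall>\<^sub>F w in at 0. pull \<Theta> w = C * \<omega> ^ k" "\<forall>\<^sub>F w in at 0. pull \<Theta> w = C"
    using C(2)[of 0] unfolding flat_at_def by blast+
  then have "\<forall>\<^sub>F w in at (0::complex). C * \<omega> ^ k = C" by eventually_elim simp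
  then have "C * \<omega> ^ k = C" by simp
  then show ?thesis using C(1) by simp
qed

lemma \<Theta>_isolated: "\<exists>e>0. \<forall>u. 0 < norm u \<and> norm u < e \<longrightarrow> \<Theta> (z + u) \<noteq> \<Theta> z"
proof -
  obtain F where ne: "\<forall>\<^sub>F u in at 0. F u \<noteq> 0" and F: "\<forall>\<^sub>F u in nhds 0. \<Theta> (z + u) = local_param (\<Theta> z) (F u)"
    using \<Theta>_local by blast
  have "\<forall>\<^sub>F u in at 0. \<Theta> (z + u) = local_param (\<Theta> z) (F u)" using F by (simp add: eventually_nhds_conv_at)
  with ne have "\<forall>\<^sub>F u in at 0. \<Theta> (z + u) \<noteq> \<Theta> z"
    by eventually_elim (metis local_param_0 local_param_inject)
  then show ?thesis unfolding eventually_at dist_norm by simp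
qed

lemma \<Theta>_nonconstant: "\<exists>z w. \<Theta> z \<noteq> \<Theta> w"
proof -
  obtain e where e: "e > 0" "\<And>u. 0 < norm u \<and> norm u < e \<Longrightarrow> \<Theta> (0 + u) \<noteq> \<Theta> 0"
    using \<Theta>_isolated by blast
  have "norm (complex_of_real (e / 2)) = e / 2" using e(1) by (simp add: norm_divide)
  then have "\<Theta> (0 + complex_of_real (e / 2)) \<noteq> \<Theta> 0" using e(1) by (intro e(2)) (simp only:, simp)
  then show ?thesis by blast
qed

text \<open>
  Besides the boundary, the omitted values form a backward invariant set \<open>A\<close>, finite by Picard's
  theorem. Then \<open>A\<close> would be totally ramified, and going back from a point of \<open>A\<close> where \<open>b\<close> is maximal
  would increase \<open>b\<close>.
\<close>

lemma range_\<Theta>: "range \<Theta> = {x. b x \<noteq> 0}"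
proof
  show "range \<Theta> \<subseteq> {x. b x \<noteq> 0}" using b_\<Theta> by blast
  define A where "A = {x. b x \<noteq> 0 \<and> x \<notin> range \<Theta>}"
  have inv: "y \<in> A" if "f y \<in> A" for y
  proof -
    have "b y \<noteq> 0" using that b_multiplicative[of y] local_degree_pos[of y] by (simp add: A_def)
    moreover have "y \<notin> range \<Theta>"
    proof
      assume "y \<in> range \<Theta>"
      then obtain z where "y = \<Theta> z" by blast
      then have "f y = \<Theta> (\<alpha> * z + \<beta>)" using \<Theta>_conj by simp
      then show False using that by (simp add: A_def)
    qed
    ultimately show ?thesis by (simp add: A_def)
  qed
  have "finite A"
  proof (rule ccontr)
    assume "infinite A"
    then obtain B where B: "B \<subseteq> A" "card B = 3" using infinite_arbitrarily_large by blast
    then obtain x y u where "x \<in> A" "y \<in> A" "u \<in> A" "x \<noteq> y" "x \<noteq> u" "y \<noteq> u"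
      by (auto simp: card_3_iff)
    then have "\<Theta> z = \<Theta> w" for z w
      by (intro little_Picard_P1[of \<Theta> x y u] \<Theta>_analytic) (auto simp: A_def)
    then show False using \<Theta>_nonconstant by blast
  qed
  have "A = {}"
  proof (rule ccontr)
    assume ne: "A \<noteq> {}"
    have "Max (b ` A) \<in> b ` A" using \<open>finite A\<close> ne by simp
    then obtain x where x: "x \<in> A" "b x = Max (b ` A)" by auto
    obtain y where y: "f y = x" using f_surj by blast
    have yA: "y \<in> A" using inv y x(1) by blast
    have deg: "local_degree f y = d" using finite_backward_invariant[OF \<open>finite A\<close> inv yA] .
    have "b y \<le> b x" using yA \<open>finite A\<close> x(2) by simp
    moreover have "b y = int d * b x" using b_multiplicative[of y] deg y by simp
    moreover have "b x > 0" using x(1) b_ge_0[of x] by (simp add: A_def)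
    ultimately show False using d_gt_1 by simp
  qed
  then show "{x. b x \<noteq> 0} \<subseteq> range \<Theta>" unfolding A_def by blast
qed

lemma fibre_iff_deck: "\<Theta> z = \<Theta> w \<longleftrightarrow> (\<exists>\<gamma>\<in>deck \<Theta>. w = \<gamma> z)"
proof
  assume "\<Theta> z = \<Theta> w"
  then obtain \<omega> where \<omega>: "\<omega> \<noteq> 0" "\<And>u. \<Theta> (w + \<omega> * u) = \<Theta> (z + u)" using fibre_transitive by blast
  have "\<Theta> (\<omega> * y + (w - \<omega> * z)) = \<Theta> y" for y
    using \<omega>(2)[of "y - z"] by (simp add: algebra_simps)
  then have "(\<lambda>y. \<omega> * y + (w - \<omega> * z)) \<in> deck \<Theta>" using \<omega>(1) unfolding deck_def by blast
  then show "\<exists>\<gamma>\<in>deck \<Theta>. w = \<gamma> z" by (rule rev_bexI) simp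
qed (auto simp: deck_def)

lemma card_stabilizer: "card {\<gamma>\<in>deck \<Theta>. \<gamma> z = z} = wt (\<Theta> z)"
proof -
  define n where "n = wt (\<Theta> z)"
  have n: "n \<ge> 1" unfolding n_def by (rule wt(1)[OF b_\<Theta>])
  have "bij_betw (\<lambda>\<omega> y. \<omega> * y + (z - \<omega> * z)) {\<omega>. \<omega> ^ n = 1} {\<gamma>\<in>deck \<Theta>. \<gamma> z = z}"
    unfolding bij_betw_def
  proof
    show "inj_on (\<lambda>\<omega> y. \<omega> * y + (z - \<omega> * z)) {\<omega>. \<omega> ^ n = 1}"
    proof (rule inj_onI)
      fix \<omega> \<omega>' :: complex
      assume "(\<lambda>y. \<omega> * y + (z - \<omega> * z)) = (\<lambda>y. \<omega>' * y + (z - \<omega>' * z))"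
      from fun_cong[OF this, of "z + 1"] show "\<omega> = \<omega>'" by (simp add: algebra_simps)
    qed
    show "(\<lambda>\<omega> y. \<omega> * y + (z - \<omega> * z)) ` {\<omega>. \<omega> ^ n = 1} = {\<gamma>\<in>deck \<Theta>. \<gamma> z = z}"
    proof (intro equalityI subsetI)
      fix \<gamma> assume "\<gamma> \<in> (\<lambda>\<omega> y. \<omega> * y + (z - \<omega> * z)) ` {\<omega>. \<omega> ^ n = 1}"
      then obtain \<omega> where \<omega>: "\<omega> ^ n = 1" and \<gamma>: "\<gamma> = (\<lambda>y. \<omega> * y + (z - \<omega> * z))" by blast
      have st: "\<Theta> (z + \<omega> * u) = \<Theta> (z + u)" for u using stabilizer \<omega> n_def by blast
      have "\<Theta> (\<omega> * y + (z - \<omega> * z)) = \<Theta> y" for y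
        using st[of "y - z"] by (simp add: algebra_simps)
      moreover have "\<omega> \<noteq> 0" using \<omega> n by (auto simp: power_0_left)
      ultimately show "\<gamma> \<in> {\<gamma>\<in>deck \<Theta>. \<gamma> z = z}" unfolding \<gamma> deck_def by auto
    next
      fix \<gamma> assume "\<gamma> \<in> {\<gamma>\<in>deck \<Theta>. \<gamma> z = z}"
      then obtain \<omega> t where \<gamma>: "\<gamma> = (\<lambda>z. \<omega> * z + t)" "\<omega> \<noteq> 0" and inv: "\<And>y. \<Theta> (\<omega> * y + t) = \<Theta> y"
        and fix_z: "\<omega> * z + t = z" unfolding deck_def by auto
      have t: "t = z - \<omega> * z" using fix_z by (simp add: algebra_simps)
      have "\<Theta> (z + \<omega> * u) = \<Theta> (z + u)" for u
        using inv[of "z + u"] by (simp add: t algebra_simps)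
      then have "\<omega> ^ n = 1" using stabilizer n_def by blast
      then show "\<gamma> \<in> (\<lambda>\<omega> y. \<omega> * y + (z - \<omega> * z)) ` {\<omega>. \<omega> ^ n = 1}"
        unfolding \<gamma> t by blast
    qed
  qed
  then have "card {\<omega>::complex. \<omega> ^ n = 1} = card {\<gamma>\<in>deck \<Theta>. \<gamma> z = z}" by (rule bij_betw_same_card)
  then show ?thesis using card_complex_roots_unity[OF n] by (simp add: n_def)
qed

lemma orbifold_quotient: "orbifold_quotient_map (deck \<Theta>) nu \<Theta>"
  unfolding orbifold_quotient_map_def
proof (intro conjI allI)
  show "holomorphic_to_P1 \<Theta>" by (rule P1_analytic_imp_holomorphic) (rule \<Theta>_analytic)
  show "range \<Theta> = UNIV - boundary_points nu"
    unfolding range_\<Theta> boundary_points_def nu_def by auto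
  show "\<Theta> z = \<Theta> w \<longleftrightarrow> (\<exists>\<gamma>\<in>deck \<Theta>. w = \<gamma> z)" for z w by (rule fibre_iff_deck)
  show "enat (card {\<gamma>\<in>deck \<Theta>. \<gamma> z = z}) = nu (\<Theta> z)" for z
    using wt(3)[OF b_\<Theta>] by (simp add: card_stabilizer)
qed

lemma zero_period: "0 \<in> periods \<Theta>" by (simp add: periods_def)

lemma diff_period: "s \<in> periods \<Theta> \<Longrightarrow> t \<in> periods \<Theta> \<Longrightarrow> s - t \<in> periods \<Theta>"
  unfolding periods_def mem_Collect_eq
proof
  fix z assume s: "\<forall>z. \<Theta> (z + s) = \<Theta> z" and t: "\<forall>z. \<Theta> (z + t) = \<Theta> z"
  have "\<Theta> (z + (s - t)) = \<Theta> (z - t + s)" by (simp add: algebra_simps)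
  also have "\<dots> = \<Theta> (z - t + t)" using s t by metis
  finally show "\<Theta> (z + (s - t)) = \<Theta> z" by simp
qed

lemma periods_discrete: "\<exists>e>0. \<forall>t\<in>periods \<Theta>. norm t < e \<longrightarrow> t = 0"
proof -
  obtain e where e: "e > 0" "\<And>u. 0 < norm u \<and> norm u < e \<Longrightarrow> \<Theta> (0 + u) \<noteq> \<Theta> 0"
    using \<Theta>_isolated by blast
  have "t = 0" if "t \<in> periods \<Theta>" "norm t < e" for t
  proof -
    have "\<Theta> (0 + t) = \<Theta> 0" using that(1) unfolding periods_def by blast
    then show ?thesis using e(2)[of t] that(2) zero_less_norm_iff[of t] by blast
  qed
  then show ?thesis using e(1) by blast
qed

text \<open>
  Conjugating a translation by an affine map multiplies it by the linear part of that map.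
\<close>

lemma rotate_period:
  assumes "\<omega> \<in> rotations \<Theta>" "t \<in> periods \<Theta>"
  shows "\<omega> * t \<in> periods \<Theta>" "t / \<omega> \<in> periods \<Theta>"
proof -
  obtain s where \<omega>: "\<omega> \<noteq> 0" and s: "\<And>z. \<Theta> (\<omega> * z + s) = \<Theta> z"
    using assms(1) unfolding rotations_def by blast
  have t: "\<Theta> (z + t) = \<Theta> z" for z using assms(2) by (simp add: periods_def)
  have "\<Theta> (z + \<omega> * t) = \<Theta> z" for z
  proof -
    define y where "y = (z - s) / \<omega>"
    have y: "\<omega> * y + s = z" using \<omega> by (simp add: y_def)
    have "z + \<omega> * t = \<omega> * (y + t) + s" by (simp add: y[symmetric] algebra_simps)
    then have "\<Theta> (z + \<omega> * t) = \<Theta> (\<omega> * (y + t) + s)" by (simp only:)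
    also have "\<dots> = \<Theta> (\<omega> * y + s)" by (simp only: s t)
    finally show ?thesis by (simp only: y)
  qed
  then show "\<omega> * t \<in> periods \<Theta>" by (simp add: periods_def)
  have "\<Theta> (z + t / \<omega>) = \<Theta> z" for z
  proof -
    have "\<Theta> (z + t / \<omega>) = \<Theta> (\<omega> * (z + t / \<omega>) + s)" by (simp only: s)
    also have "\<dots> = \<Theta> ((\<omega> * z + s) + t)" using \<omega> by (simp add: algebra_simps)
    also have "\<dots> = \<Theta> z" by (simp only: s t)
    finally show ?thesis .
  qed
  then show "t / \<omega> \<in> periods \<Theta>" by (simp add: periods_def)
qed

lemma \<alpha>_nonzero: "\<alpha> \<noteq> 0" using \<alpha>_norm by auto

lemma scale_period:
  assumes "t \<in> periods \<Theta>"
  shows "\<alpha> * t \<in> periods \<Theta>"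
proof -
  have t: "\<Theta> (z + t) = \<Theta> z" for z using assms by (simp add: periods_def)
  have "\<Theta> (z + \<alpha> * t) = \<Theta> z" for z
  proof -
    define y where "y = (z - \<beta>) / \<alpha>"
    have y: "\<alpha> * y + \<beta> = z" using \<alpha>_nonzero by (simp add: y_def)
    have "\<Theta> (z + \<alpha> * t) = \<Theta> (\<alpha> * (y + t) + \<beta>)" by (simp add: y[symmetric] algebra_simps)
    also have "\<dots> = f (\<Theta> (y + t))" by (simp only: \<Theta>_conj)
    also have "\<dots> = f (\<Theta> y)" by (simp only: t)
    finally show ?thesis by (simp only: \<Theta>_conj y)
  qed
  then show ?thesis by (simp add: periods_def)
qed

text \<open>
  The commutator of the rotation by \<open>\<omega>\<close> with \<open>z \<mapsto> \<alpha> z + \<beta>\<close>.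
\<close>

lemma rotation_shift_period:
  assumes \<omega>: "\<And>z. \<Theta> (\<omega> * z) = \<Theta> z" and "\<omega> \<noteq> 0"
  shows "(1 - \<omega>) * \<beta> \<in> periods \<Theta>"
proof -
  have "\<Theta> (z + (1 - \<omega>) * \<beta>) = \<Theta> z" for z
  proof -
    define y where "y = (z - \<omega> * \<beta>) / (\<omega> * \<alpha>)"
    have y: "\<omega> * (\<alpha> * y + \<beta>) = z" using \<alpha>_nonzero assms(2) by (simp add: y_def field_simps)
    have "z + (1 - \<omega>) * \<beta> = \<alpha> * (\<omega> * y) + \<beta>" by (simp add: y[symmetric] algebra_simps)
    then have "\<Theta> (z + (1 - \<omega>) * \<beta>) = f (\<Theta> (\<omega> * y))" by (simp only: \<Theta>_conj)
    also have "\<dots> = \<Theta> (\<omega> * (\<alpha> * y + \<beta>))" by (simp only: \<omega> \<Theta>_conj)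
    finally show ?thesis by (simp only: y)
  qed
  then show ?thesis by (simp add: periods_def)
qed

lemma rotations_roots: "\<omega> \<in> rotations \<Theta> \<Longrightarrow> \<omega> ^ k = 1"
  unfolding rotations_def using linear_part_root_of_unity by blast

lemma finite_rotations: "finite (rotations \<Theta>)"
  using finite_roots_unity[of k, where 'a = complex] k_ge_1 rotations_roots
  by (metis (mono_tags, lifting) mem_Collect_eq rev_finite_subset subsetI)

lemma same_rotation:
  assumes "\<And>z. \<Theta> (\<omega> * z + s) = \<Theta> z" "\<And>z. \<Theta> (\<omega> * z + t) = \<Theta> z" "\<omega> \<noteq> 0"
  shows "s - t \<in> periods \<Theta>"
proof -
  have "\<Theta> (z + (s - t)) = \<Theta> z" for z
  proof -
    define y where "y = (z - t) / \<omega>"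
    have y: "\<omega> * y + t = z" using assms(3) by (simp add: y_def)
    have "z + (s - t) = \<omega> * y + s" by (simp add: y[symmetric])
    then have "\<Theta> (z + (s - t)) = \<Theta> (\<omega> * y + s)" by (simp only:)
    also have "\<dots> = \<Theta> (\<omega> * y + t)" by (simp only: assms)
    finally show ?thesis by (simp only: y)
  qed
  then show ?thesis by (simp add: periods_def)
qed

text \<open>
  Otherwise an element of the deck group is determined by its linear part, so the group is finite, say
  of order \<open>N\<close>, and the fibres of \<open>\<Theta>\<close> over points of weight \<open>1\<close> have exactly \<open>N\<close> elements. Such a point
  \<open>x\<close> has two different preimages \<open>y1\<close>, \<open>y2\<close> under \<open>f\<close>, again of weight \<open>1\<close>, and \<open>z \<mapsto> \<alpha> z + \<beta>\<close> maps
  the \<open>2 N\<close> points over them injectively into the fibre over \<open>x\<close>.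
\<close>

lemma periods_nontrivial: "periods \<Theta> \<noteq> {0}"
proof
  assume P: "periods \<Theta> = {0}"
  define rot where "rot \<gamma> = \<gamma> 1 - \<gamma> 0" for \<gamma> :: "complex \<Rightarrow> complex"
  have "inj_on rot (deck \<Theta>)"
  proof (rule inj_onI)
    fix \<gamma> \<delta> assume "\<gamma> \<in> deck \<Theta>" "\<delta> \<in> deck \<Theta>" "rot \<gamma> = rot \<delta>"
    then obtain \<omega> s t where "\<gamma> = (\<lambda>z. \<omega> * z + s)" "\<delta> = (\<lambda>z. \<omega> * z + t)" "\<omega> \<noteq> 0"
      "\<And>z. \<Theta> (\<omega> * z + s) = \<Theta> z" "\<And>z. \<Theta> (\<omega> * z + t) = \<Theta> z"
      unfolding deck_def rot_def by auto
    moreover from this have "s - t \<in> periods \<Theta>" by (intro same_rotation)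
    ultimately show "\<gamma> = \<delta>" using P by simp
  qed
  moreover have "rot ` deck \<Theta> \<subseteq> rotations \<Theta>"
  proof
    fix \<omega> assume "\<omega> \<in> rot ` deck \<Theta>"
    then obtain \<gamma> where \<gamma>: "\<gamma> \<in> deck \<Theta>" "\<omega> = rot \<gamma>" by blast
    then obtain \<eta> t where "\<eta> \<noteq> 0" "\<gamma> = (\<lambda>z. \<eta> * z + t)" "\<forall>z. \<Theta> (\<eta> * z + t) = \<Theta> z"
      unfolding deck_def by blast
    moreover from this have "\<omega> = \<eta>" using \<gamma>(2) by (simp add: rot_def)
    ultimately show "\<omega> \<in> rotations \<Theta>" unfolding rotations_def by blast
  qed
  ultimately have fin: "finite (deck \<Theta>)" using finite_rotations finite_subset finite_image_iff by metis
  define N where "N = card (deck \<Theta>)"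
  have fibre: "\<Theta> -` {\<Theta> z} = (\<lambda>\<gamma>. \<gamma> z) ` deck \<Theta>" for z
  proof -
    have "\<Theta> -` {\<Theta> z} = {w. \<Theta> z = \<Theta> w}" by auto
    also have "\<dots> = (\<lambda>\<gamma>. \<gamma> z) ` deck \<Theta>" unfolding fibre_iff_deck by auto
    finally show ?thesis .
  qed
  have card_fibre: "card (\<Theta> -` {x}) = N" if bx: "b x = int k" for x
  proof -
    have "b x \<noteq> 0" using bx k_ge_1 by simp
    then obtain z where z: "x = \<Theta> z" using range_\<Theta> by blast
    have "wt x = 1" using bx k_ge_1 by (simp add: wt_def)
    have "inj_on (\<lambda>\<gamma>. \<gamma> z) (deck \<Theta>)"
    proof (rule inj_onI)
      fix \<gamma> \<delta> assume "\<gamma> \<in> deck \<Theta>" "\<delta> \<in> deck \<Theta>" and eq: "\<gamma> z = \<delta> z"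
      then obtain \<omega> s \<omega>' t where \<gamma>: "\<gamma> = (\<lambda>z. \<omega> * z + s)" "\<omega> \<noteq> 0" "\<And>z. \<Theta> (\<omega> * z + s) = \<Theta> z"
        and \<delta>: "\<delta> = (\<lambda>z. \<omega>' * z + t)" "\<omega>' \<noteq> 0" "\<And>z. \<Theta> (\<omega>' * z + t) = \<Theta> z"
        unfolding deck_def by blast
      have eq': "\<omega> * z + s = \<omega>' * z + t" using eq \<gamma>(1) \<delta>(1) by simp
      define y where "y = \<omega>' * z + t"
      have "\<Theta> y = x" unfolding y_def z \<delta>(3) ..
      have "\<Theta> (y + (\<omega> / \<omega>') * u) = \<Theta> (y + u)" for u
      proof -
        have "y + (\<omega> / \<omega>') * u = \<omega> * (z + u / \<omega>') + s" using eq' by (simp add: y_def algebra_simps)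
        moreover have "y + u = \<omega>' * (z + u / \<omega>') + t" using \<delta>(2) by (simp add: y_def algebra_simps)
        ultimately show ?thesis by (simp only: \<gamma>(3) \<delta>(3))
      qed
      then have "(\<omega> / \<omega>') ^ wt (\<Theta> y) = 1" using stabilizer by blast
      then have "\<omega> = \<omega>'" using \<open>wt x = 1\<close> \<open>\<Theta> y = x\<close> \<delta>(2) by simp
      then show "\<gamma> = \<delta>" using eq' \<gamma>(1) \<delta>(1) by simp
    qed
    then show ?thesis unfolding z fibre N_def by (rule card_image)
  qed
  \<comment> \<open>The count is now applied to a point \<open>x\<close> of weight \<open>1\<close> and two of its preimages.\<close>
  have finf: "finite (\<Theta> -` {\<Theta> z})" for z unfolding fibre using fin by simp
  have "infinite (UNIV :: P1 set)"
  proof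
    assume "finite (UNIV :: P1 set)"
    then have "finite (range Fin)" by (rule rev_finite_subset) simp
    then have "finite (UNIV :: complex set)" by (rule finite_imageD) (simp add: inj_on_def)
    then show False by (simp add: infinite_UNIV_char_0)
  qed
  then have "\<exists>x. x \<notin> {x. b x \<noteq> int k}" using finite_singular by (metis UNIV_eq_I)
  then obtain x where x: "b x = int k" by blast
  have pre: "b y = int k \<and> local_degree f y = 1" if "f y = x" for y
  proof -
    have "b y = int (local_degree f y) * int k" using b_multiplicative[of y] that x by simp
    moreover from this have "int (local_degree f y) * int k \<le> 1 * int k" using b_le_k[of y] by simp
    then have "local_degree f y = 1" using k_ge_1 local_degree_ge_1[of y] by (simp add: mult_le_cancel_right)
    ultimately show ?thesis by simp
  qed
  obtain y1 where y1: "f y1 = x" using f_surj by blast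
  obtain y2 where y2: "f y2 = x" "y2 \<noteq> y1"
  proof -
    have "local_degree f y1 \<noteq> d" using pre[OF y1] d_gt_1 by simp
    then show thesis using local_degree_single_preimage[of y1] y1 that by blast
  qed
  obtain z1 z2 where z: "y1 = \<Theta> z1" "y2 = \<Theta> z2"
    using range_\<Theta> pre[OF y1] pre[OF y2(1)] k_ge_1 by (metis (mono_tags, lifting) imageE mem_Collect_eq of_nat_0_eq_iff not_one_le_zero)
  define L where "L z = \<alpha> * z + \<beta>" for z
  have injL: "inj L" using \<alpha>_nonzero by (auto simp: inj_def L_def)
  have sub: "L ` (\<Theta> -` {y1} \<union> \<Theta> -` {y2}) \<subseteq> \<Theta> -` {x}"
    using y1 y2(1) by (auto simp: L_def simp flip: \<Theta>_conj)
  obtain z0 where z0: "x = \<Theta> z0" using z(1) y1 \<Theta>_conj by metis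
  have "card (L ` (\<Theta> -` {y1} \<union> \<Theta> -` {y2})) \<le> card (\<Theta> -` {x})"
    unfolding z0 by (rule card_mono[OF finf]) (use sub z0 in simp)
  moreover have "card (L ` (\<Theta> -` {y1} \<union> \<Theta> -` {y2})) = card (\<Theta> -` {y1} \<union> \<Theta> -` {y2})"
    by (rule card_image, rule inj_on_subset[OF injL]) simp
  moreover have "card (\<Theta> -` {y1} \<union> \<Theta> -` {y2}) = N + N"
    using card_fibre pre[OF y1] pre[OF y2(1)] y2(2) finf z
    by (subst card_Un_disjoint) auto
  ultimately have "N + N \<le> N" using card_fibre[OF x] by simp
  moreover have "N > 0"
    unfolding N_def using fin fibre_iff_deck[of 0 0] by (auto simp: card_gt_0_iff)
  ultimately show False by simp
qed

text \<open>
  If \<open>x\<close> were omitted, an affine coordinate away from \<open>x\<close> composed with \<open>\<Theta>\<close> would be an entire function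
  with a lattice of periods, hence bounded and constant.
\<close>

lemma lattice_periods_surjective:
  assumes w: "w \<noteq> 0" "Im \<tau> > 0" and P: "periods \<Theta> = (\<lambda>l. w * l) ` plane_lattice \<tau>"
  shows "b x \<noteq> 0"
proof
  assume "b x = 0"
  then have x: "x \<notin> range \<Theta>" using range_\<Theta> by auto
  define g where "g z = away_coord x (\<Theta> z)" for z
  have hol: "g holomorphic_on UNIV"
    unfolding g_def by (rule away_coord_entire[OF \<Theta>_analytic x])
  define R where "R = norm w * (1 + norm \<tau>)"
  \<comment> \<open>Every point is congruent to a point of the period parallelogram spanned by \<open>w\<close> and \<open>w \<tau>\<close>.\<close>
  have red: "\<exists>z'\<in>cball 0 R. g z = g z'" for z
  proof -
    define n where "n = \<lfloor>Im (z / w) / Im \<tau>\<rfloor>"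
    define m where "m = \<lfloor>Re (z / w - of_int n * \<tau>)\<rfloor>"
    define s where "s = z / w - of_int n * \<tau> - of_int m"
    define v where "v = Im (z / w) / Im \<tau> - of_int n"
    have v: "0 \<le> v" "v \<le> 1" unfolding v_def n_def by linarith+
    have "w * (of_int m + of_int n * \<tau>) \<in> periods \<Theta>" unfolding P plane_lattice_def by blast
    moreover have "z = w * s + w * (of_int m + of_int n * \<tau>)" using w(1) by (simp add: s_def field_simps)
    ultimately have "\<Theta> z = \<Theta> (w * s)" unfolding periods_def by blast
    moreover have "norm s \<le> 1 + norm \<tau>"
    proof -
      have "norm s \<le> \<bar>Re s\<bar> + \<bar>Im s\<bar>" by (rule cmod_le)
      moreover have "\<bar>Re s\<bar> \<le> 1" unfolding s_def m_def by (simp, linarith)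
      moreover have "Im s = v * Im \<tau>" using w(2) by (simp add: s_def v_def field_simps)
      then have "\<bar>Im s\<bar> \<le> \<bar>Im \<tau>\<bar>" using v by (simp add: abs_mult mult_left_le_one_le)
      then have "\<bar>Im s\<bar> \<le> norm \<tau>" using abs_Im_le_cmod[of \<tau>] by linarith
      ultimately show ?thesis by linarith
    qed
    then have "norm (w * s) \<le> R" unfolding R_def norm_mult by (intro mult_left_mono) auto
    ultimately show ?thesis by (intro bexI[of _ "w * s"]) (auto simp: g_def)
  qed
  have "compact (g ` cball 0 R)"
    using hol by (intro compact_continuous_image holomorphic_on_imp_continuous_on) (auto intro: holomorphic_on_subset)
  moreover have "range g \<subseteq> g ` cball 0 R" using red by blast
  ultimately have "bounded (range g)" using compact_imp_bounded bounded_subset by blast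
  then obtain c where "\<And>z. g z = c" using Liouville_theorem[OF hol] by (auto simp: constant_on_def)
  then have "\<Theta> z = \<Theta> z'" for z z'
    using away_coord_inject[of "\<Theta> z" x "\<Theta> z'"] x unfolding g_def by (metis rangeI)
  then show False using \<Theta>_nonconstant by blast
qed

end

end

section \<open>Discrete subgroups of the plane\<close>

text \<open>
  Subtracting the nearest integer leaves an element of norm at most \<open>1/2\<close>, hence \<open>0\<close>.
\<close>

lemma real_subgroup_cyclic:
  fixes T :: "complex set"
  assumes diff: "\<And>s t. s \<in> T \<Longrightarrow> t \<in> T \<Longrightarrow> s - t \<in> T" and one: "1 \<in> T"
    and min: "\<And>t. t \<in> T \<Longrightarrow> t \<noteq> 0 \<Longrightarrow> norm t \<ge> 1"
    and t: "t \<in> T" "Im t = 0"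
  shows "t \<in> \<int>"
proof -
  have int_mem: "of_int m \<in> T" for m
  proof (induction m rule: int_induct[of _ 0])
    case base
    show ?case using diff[OF one one] by simp
  next
    case (step1 i)
    have "- 1 \<in> T" using diff[OF diff[OF one one] one] by simp
    from diff[OF step1(2) this] show ?case by (simp add: add.commute)
  next
    case (step2 i)
    from diff[OF step2(2) one] show ?case by simp
  qed
  define s where "s = t - of_int (round (Re t))"
  have "s \<in> T" unfolding s_def by (intro diff t int_mem)
  moreover have "Im s = 0" using t by (simp add: s_def)
  then have "norm s = \<bar>Re s\<bar>" by (simp add: cmod_eq_Re)
  then have "norm s \<le> 1 / 2"
    using of_int_round_abs_le[of "Re t"] by (simp add: s_def abs_minus_commute)
  ultimately have "s = 0" using min[of s] by force
  then have "t = of_int (round (Re t))" by (simp add: s_def)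
  then show ?thesis using Ints_of_int by metis
qed

lemma finite_discrete_subgroup_ball:
  fixes T :: "complex set"
  assumes diff: "\<And>s t. s \<in> T \<Longrightarrow> t \<in> T \<Longrightarrow> s - t \<in> T"
    and e: "e > 0" and disc: "\<And>t. t \<in> T \<Longrightarrow> norm t < e \<Longrightarrow> t = 0"
  shows "finite (T \<inter> cball 0 R)"
proof -
  have "\<not> z islimpt T" for z
  proof
    assume z: "z islimpt T"
    have "z \<in> ball z (e / 2)" using e by simp
    then have "infinite (ball z (e / 2) \<inter> T)"
      using z[unfolded islimpt_eq_acc_point] open_ball by metis
    then have inf: "infinite (T \<inter> ball z (e / 2))" by (simp add: Int_commute)
    obtain s t where st: "s \<in> T \<inter> ball z (e / 2)" "t \<in> T \<inter> ball z (e / 2)" "s \<noteq> t"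
    proof -
      obtain s where s: "s \<in> T \<inter> ball z (e / 2)" using inf by (metis ex_in_conv finite.emptyI)
      have "infinite (T \<inter> ball z (e / 2) - {s})" using inf by simp
      then obtain t where "t \<in> T \<inter> ball z (e / 2) - {s}" by (metis ex_in_conv finite.emptyI)
      then show thesis using that s by blast
    qed
    have "norm (s - t) \<le> norm (s - z) + norm (z - t)" using norm_triangle_ineq[of "s - z" "z - t"] by simp
    also have "\<dots> < e" using st by (simp add: dist_norm norm_minus_commute)
    finally have "s - t = 0" using disc diff st by blast
    then show False using st by simp
  qed
  then have "finite (cball 0 R \<inter> T)" by (intro finite_not_islimpt_in_compact) auto
  then show ?thesis by (simp add: Int_commute)
qed

lemma exists_min_on_finite:
  fixes g :: "'a \<Rightarrow> real"
  assumes "finite A" "A \<noteq> {}"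
  obtains a where "a \<in> A" "\<And>x. x \<in> A \<Longrightarrow> g a \<le> g x"
proof -
  have "Min (g ` A) \<in> g ` A" using assms by simp
  then obtain a where "a \<in> A" "g a = Min (g ` A)" by auto
  then show thesis using that assms(1) by simp
qed

text \<open>
  Scale a shortest nonzero element to \<open>1\<close>. If the group is not real, take \<open>\<tau>\<close> in it with the smallest
  positive imaginary part: subtracting a multiple of \<open>\<tau>\<close> makes the imaginary part of any element zero,
  and the remaining real element is an integer.
\<close>

lemma discrete_subgroup_cases:
  fixes T :: "complex set"
  assumes zero: "0 \<in> T" and diff: "\<And>s t. s \<in> T \<Longrightarrow> t \<in> T \<Longrightarrow> s - t \<in> T"
    and e: "e > 0" and disc: "\<And>t. t \<in> T \<Longrightarrow> norm t < e \<Longrightarrow> t = 0"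
  obtains "T = {0}"
    | w where "w \<noteq> 0" "T = (\<lambda>l. w * l) ` \<int>"
    | w \<tau> where "w \<noteq> 0" "Im \<tau> > 0" "T = (\<lambda>l. w * l) ` plane_lattice \<tau>"
        "\<And>t. t \<in> T \<Longrightarrow> t \<noteq> 0 \<Longrightarrow> norm w \<le> norm t"
proof (cases "T = {0}")
  case True
  then show thesis by (rule that(1))
next
  case False
  then obtain t0 where t0: "t0 \<in> T" "t0 \<noteq> 0" using zero by blast
  define A where "A = (T \<inter> cball 0 (norm t0)) - {0}"
  have "finite A" unfolding A_def using finite_discrete_subgroup_ball[OF diff e disc] by blast
  moreover have "t0 \<in> A" using t0 by (simp add: A_def)
  ultimately obtain w where w: "w \<in> A" "\<And>x. x \<in> A \<Longrightarrow> norm w \<le> norm x"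
    using exists_min_on_finite[of A norm] by blast
  have wT: "w \<in> T" "w \<noteq> 0" using w(1) by (auto simp: A_def)
  have wmin: "norm w \<le> norm t" if "t \<in> T" "t \<noteq> 0" for t
  proof (cases "norm t \<le> norm t0")
    case True
    then show ?thesis using w(2) that by (simp add: A_def)
  next
    case False
    then show ?thesis using w(2)[OF \<open>t0 \<in> A\<close>] by simp
  qed
  define T' where "T' = {l. w * l \<in> T}"
  have T_eq: "T = (\<lambda>l. w * l) ` T'"
  proof
    show "T \<subseteq> (\<lambda>l. w * l) ` T'"
    proof
      fix t assume "t \<in> T"
      then have "t / w \<in> T'" "t = w * (t / w)" using wT by (simp_all add: T'_def)
      then show "t \<in> (\<lambda>l. w * l) ` T'" by blast
    qed
  qed (auto simp: T'_def)
  have diff': "s - t \<in> T'" if "s \<in> T'" "t \<in> T'" for s t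
    using that diff[of "w * s" "w * t"] by (simp add: T'_def algebra_simps)
  have one: "1 \<in> T'" using wT by (simp add: T'_def)
  have min': "norm t \<ge> 1" if "t \<in> T'" "t \<noteq> 0" for t
    using wmin[of "w * t"] that wT by (simp add: T'_def norm_mult)
  have add': "s + t \<in> T'" if "s \<in> T'" "t \<in> T'" for s t
    using diff'[OF that(1) diff'[OF diff'[OF one one] that(2)]] by simp
  have int_mult: "of_int m * t \<in> T'" if t: "t \<in> T'" for m t
  proof (induction m rule: int_induct[of _ 0])
    case base
    show ?case using diff'[OF one one] by simp
  next
    case (step1 i)
    from add'[OF step1(2) t] show ?case by (simp add: algebra_simps)
  next
    case (step2 i)
    from diff'[OF step2(2) t] show ?case by (simp add: algebra_simps)
  qed
  have int_mem: "of_int m \<in> T'" for m using int_mult[OF one, of m] by simp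
  have real: "t \<in> \<int>" if "t \<in> T'" "Im t = 0" for t
    using real_subgroup_cyclic[of T' t] diff' one min' that by blast
  show thesis
  proof (cases "\<forall>t\<in>T'. Im t = 0")
    case True
    have "T' = \<int>"
    proof
      show "T' \<subseteq> \<int>" using real True by blast
      show "\<int> \<subseteq> T'" using int_mem by (auto elim: Ints_cases)
    qed
    then show thesis using that(2)[OF wT(2)] T_eq by simp
  next
    case False
    then obtain t1 where "t1 \<in> T'" "Im t1 \<noteq> 0" by blast
    define t2 where "t2 = (if Im t1 > 0 then t1 else 0 - t1)"
    have "0 \<in> T'" using diff'[OF one one] by simp
    then have t2: "t2 \<in> T'" "Im t2 > 0"
      using \<open>t1 \<in> T'\<close> \<open>Im t1 \<noteq> 0\<close> diff'[of 0 t1] by (auto simp: t2_def)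
    define B where "B = {t \<in> T' \<inter> cball 0 (1 + Im t2). 0 < Im t \<and> Im t \<le> Im t2}"
    have "finite (T' \<inter> cball 0 (1 + Im t2))"
    proof (rule finite_discrete_subgroup_ball[of T' 1])
      show "t = 0" if "t \<in> T'" "norm t < 1" for t using min'[OF that(1)] that(2) by fastforce
    qed (use diff' in auto)
    then have finB: "finite B" by (rule rev_finite_subset) (auto simp: B_def)
    \<comment> \<open>Only finitely many elements with bounded imaginary part remain after reducing the real part.\<close>
    have reduce: "t - of_int (round (Re t)) \<in> B" if "t \<in> T'" "0 < Im t" "Im t \<le> Im t2" for t
    proof -
      have "\<bar>Re (t - of_int (round (Re t)))\<bar> \<le> 1 / 2"
        using of_int_round_abs_le[of "Re t"] by (simp add: abs_minus_commute)
      then have "norm (t - of_int (round (Re t))) \<le> 1 + Im t2"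
        using cmod_le[of "t - of_int (round (Re t))"] that by simp
      then show ?thesis using that diff' int_mem by (simp add: B_def)
    qed
    have "B \<noteq> {}" using reduce[OF t2] by auto
    then obtain \<tau> where \<tau>: "\<tau> \<in> B" "\<And>x. x \<in> B \<Longrightarrow> Im \<tau> \<le> Im x"
      using exists_min_on_finite[OF finB] by blast
    have \<tau>T: "\<tau> \<in> T'" "Im \<tau> > 0" "Im \<tau> \<le> Im t2" using \<tau>(1) by (auto simp: B_def)
    have \<tau>min: "Im \<tau> \<le> Im t" if "t \<in> T'" "Im t > 0" for t
    proof (cases "Im t \<le> Im t2")
      case True
      then show ?thesis using \<tau>(2)[OF reduce[OF that]] by simp
    next
      case False
      then show ?thesis using \<tau>T by simp
    qed
    have "T' = plane_lattice \<tau>"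
    proof
      show "T' \<subseteq> plane_lattice \<tau>"
      proof
        fix t assume t: "t \<in> T'"
        define n where "n = \<lfloor>Im t / Im \<tau>\<rfloor>"
        define s where "s = t - of_int n * \<tau>"
        have s: "s \<in> T'" unfolding s_def by (intro diff' t int_mult \<tau>T)
        have "of_int n \<le> Im t / Im \<tau>" "Im t / Im \<tau> < of_int n + 1" unfolding n_def by linarith+
        then have "of_int n * Im \<tau> \<le> Im t" "Im t < (of_int n + 1) * Im \<tau>"
          using \<tau>T(2) by (simp_all add: field_simps)
        then have "Im s \<ge> 0" "Im s < Im \<tau>" by (simp_all add: s_def algebra_simps)
        then have "Im s = 0" using \<tau>min[OF s] by force
        then obtain m where "s = of_int m" using real[OF s] by (auto elim: Ints_cases)
        then have "t = of_int m + of_int n * \<tau>" by (simp add: s_def algebra_simps)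
        then show "t \<in> plane_lattice \<tau>" unfolding plane_lattice_def by blast
      qed
      show "plane_lattice \<tau> \<subseteq> T'"
        unfolding plane_lattice_def using add' int_mem int_mult \<tau>T(1) by auto
    qed
    then show thesis using that(3)[OF wT(2) \<tau>T(2)] T_eq wmin by simp
  qed
qed

section \<open>The deck group and the weights\<close>

lemma AutC_simps: "carrier AutC = {(\<lambda>z. \<alpha> * z + \<beta>) | \<alpha> \<beta>. \<alpha> \<noteq> 0}" "x \<otimes>\<^bsub>AutC\<^esub> y = x \<circ> y" "\<one>\<^bsub>AutC\<^esub> = id"
  by (simp_all add: AutC_def)

lemma AutC_I: "\<alpha> \<noteq> 0 \<Longrightarrow> (\<lambda>z. \<alpha> * z + \<beta>) \<in> carrier AutC"
  unfolding AutC_simps by blast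

lemma AutC_inverse:
  assumes "\<alpha> \<noteq> (0::complex)"
  shows "(\<lambda>z. (1 / \<alpha>) * z + (- \<beta> / \<alpha>)) \<circ> (\<lambda>z. \<alpha> * z + \<beta>) = id"
  using assms by (auto simp: fun_eq_iff field_simps)

lemma AutC_group: "group AutC"
proof (rule groupI)
  fix x y assume "x \<in> carrier AutC" "y \<in> carrier AutC"
  then obtain \<alpha> \<beta> \<alpha>' \<beta>' where "x = (\<lambda>z. \<alpha> * z + \<beta>)" "\<alpha> \<noteq> 0" "y = (\<lambda>z. \<alpha>' * z + \<beta>')" "\<alpha>' \<noteq> 0"
    unfolding AutC_simps by blast
  then have "x \<otimes>\<^bsub>AutC\<^esub> y = (\<lambda>z. (\<alpha> * \<alpha>') * z + (\<alpha> * \<beta>' + \<beta>))" "\<alpha> * \<alpha>' \<noteq> 0"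
    by (auto simp: AutC_simps algebra_simps)
  then show "x \<otimes>\<^bsub>AutC\<^esub> y \<in> carrier AutC" using AutC_I by simp
next
  have "(\<lambda>z. 1 * z + 0) \<in> carrier AutC" by (rule AutC_I) simp
  moreover have "(\<lambda>z::complex. 1 * z + 0) = id" by (simp add: fun_eq_iff)
  ultimately show "\<one>\<^bsub>AutC\<^esub> \<in> carrier AutC" by (simp add: AutC_simps(3))
next
  fix x assume "x \<in> carrier AutC"
  then obtain \<alpha> \<beta> where x: "x = (\<lambda>z. \<alpha> * z + \<beta>)" "\<alpha> \<noteq> 0" unfolding AutC_simps by blast
  then have "(\<lambda>z. (1 / \<alpha>) * z + (- \<beta> / \<alpha>)) \<in> carrier AutC" by (intro AutC_I) simp
  moreover have "(\<lambda>z. (1 / \<alpha>) * z + (- \<beta> / \<alpha>)) \<otimes>\<^bsub>AutC\<^esub> x = \<one>\<^bsub>AutC\<^esub>"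
    unfolding AutC_simps x by (rule AutC_inverse[OF x(2)])
  ultimately show "\<exists>y\<in>carrier AutC. y \<otimes>\<^bsub>AutC\<^esub> x = \<one>\<^bsub>AutC\<^esub>" by blast
qed (auto simp: AutC_simps)

lemma AutC_inv:
  assumes "\<alpha> \<noteq> 0"
  shows "inv\<^bsub>AutC\<^esub> (\<lambda>z. \<alpha> * z + \<beta>) = (\<lambda>z. (1 / \<alpha>) * z + (- \<beta> / \<alpha>))"
proof (rule group.inv_equality[OF AutC_group])
  show "(\<lambda>z. (1 / \<alpha>) * z + (- \<beta> / \<alpha>)) \<otimes>\<^bsub>AutC\<^esub> (\<lambda>z. \<alpha> * z + \<beta>) = \<one>\<^bsub>AutC\<^esub>"
    unfolding AutC_simps by (rule AutC_inverse[OF assms])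
  show "(\<lambda>z. \<alpha> * z + \<beta>) \<in> carrier AutC" using assms by (rule AutC_I)
  show "(\<lambda>z. (1 / \<alpha>) * z + (- \<beta> / \<alpha>)) \<in> carrier AutC" using assms by (intro AutC_I) simp
qed

context invariant_section
begin

context
  fixes \<Theta> \<alpha> \<beta>
  assumes U: "uniformizes \<Theta> \<alpha> \<beta>"
begin

lemma deck_I: "\<omega> \<noteq> 0 \<Longrightarrow> (\<And>z. \<Theta> (\<omega> * z + t) = \<Theta> z) \<Longrightarrow> (\<lambda>z. \<omega> * z + t) \<in> deck \<Theta>"
  unfolding deck_def by blast

lemma deck_subgroup: "subgroup (deck \<Theta>) AutC"
proof (rule group.subgroupI[OF AutC_group])
  show "deck \<Theta> \<subseteq> carrier AutC" unfolding deck_def AutC_simps by blast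
  show "deck \<Theta> \<noteq> {}" using deck_I[of 1 0] by auto
  fix x assume "x \<in> deck \<Theta>"
  then obtain \<omega> s where x: "x = (\<lambda>z. \<omega> * z + s)" "\<omega> \<noteq> 0" "\<And>z. \<Theta> (\<omega> * z + s) = \<Theta> z"
    unfolding deck_def by blast
  have "\<Theta> (1 / \<omega> * z + - s / \<omega>) = \<Theta> z" for z
    using x(3)[of "1 / \<omega> * z + - s / \<omega>"] x(2) by (simp add: field_simps)
  then show "inv\<^bsub>AutC\<^esub> x \<in> deck \<Theta>"
    unfolding x(1) AutC_inv[OF x(2)] using x(2) by (intro deck_I) auto
  fix y assume "y \<in> deck \<Theta>"
  then obtain \<eta> t where y: "y = (\<lambda>z. \<eta> * z + t)" "\<eta> \<noteq> 0" "\<And>z. \<Theta> (\<eta> * z + t) = \<Theta> z"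
    unfolding deck_def by blast
  have "x \<otimes>\<^bsub>AutC\<^esub> y = (\<lambda>z. (\<omega> * \<eta>) * z + (\<omega> * t + s))"
    by (auto simp: AutC_simps x y algebra_simps)
  moreover have "\<Theta> ((\<omega> * \<eta>) * z + (\<omega> * t + s)) = \<Theta> z" for z
    using x(3)[of "\<eta> * z + t"] y(3)[of z] by (simp add: algebra_simps)
  ultimately show "x \<otimes>\<^bsub>AutC\<^esub> y \<in> deck \<Theta>"
    using x(2) y(2) by (simp add: deck_I)
qed

text \<open>
  The linear parts form a finite set, and two elements with the same linear part differ by a period.
\<close>

lemma deck_discrete: "discrete_group (deck \<Theta>)"
  unfolding discrete_group_def
proof
  let ?S = "(\<lambda>\<gamma>. (\<gamma> 1 - \<gamma> 0, \<gamma> 0)) ` deck \<Theta>"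
  obtain e1 where e1: "e1 > 0" "\<And>\<omega> \<eta>. \<omega> \<in> rotations \<Theta> \<Longrightarrow> \<eta> \<in> rotations \<Theta> \<Longrightarrow> dist \<omega> \<eta> < e1 \<Longrightarrow> \<omega> = \<eta>"
    using finite_rotations[OF U] uniform_discrete_finite_iff[of "rotations \<Theta>"]
    unfolding uniform_discrete_def by blast
  obtain e2 where e2: "e2 > 0" "\<And>t. t \<in> periods \<Theta> \<Longrightarrow> norm t < e2 \<Longrightarrow> t = 0"
    using periods_discrete[OF U] by blast
  have "uniform_discrete ?S"
    unfolding uniform_discrete_def
  proof (intro exI[of _ "min e1 e2"] conjI ballI impI)
    show "min e1 e2 > 0" using e1 e2 by simp
    fix x y assume "x \<in> ?S" "y \<in> ?S" and d: "dist x y < min e1 e2"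
    have pair: "\<exists>\<omega> s. x = (\<omega>, s) \<and> \<omega> \<noteq> 0 \<and> (\<forall>z. \<Theta> (\<omega> * z + s) = \<Theta> z)" if "x \<in> ?S" for x
      using that unfolding deck_def by auto
    obtain \<omega> s where x: "x = (\<omega>, s)" "\<omega> \<noteq> 0" "\<And>z. \<Theta> (\<omega> * z + s) = \<Theta> z"
      using pair[OF \<open>x \<in> ?S\<close>] by blast
    obtain \<eta> t where y: "y = (\<eta>, t)" "\<eta> \<noteq> 0" "\<And>z. \<Theta> (\<eta> * z + t) = \<Theta> z"
      using pair[OF \<open>y \<in> ?S\<close>] by blast
    have "dist \<omega> \<eta> < e1" using d dist_fst_le[of x y] x y by simp
    then have eq: "\<omega> = \<eta>" using e1(2) x y unfolding rotations_def by blast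
    have "s - t \<in> periods \<Theta>" by (rule same_rotation[OF U x(3) _ x(2)]) (simp add: eq y(3))
    moreover have "norm (s - t) < e2" using d dist_snd_le[of x y] x y by (simp add: dist_norm)
    ultimately show "x = y" using e2(2)[of "s - t"] x y eq by simp
  qed
  then show "discrete ?S" by (rule uniform_discrete_imp_discrete)
qed (rule deck_subgroup)

lemma induced_by_deck: "induced_by f nu (deck \<Theta>) (\<lambda>z. \<alpha> * z + \<beta>)"
  unfolding induced_by_def
proof (intro conjI exI[of _ \<Theta>])
  show "(\<lambda>z. \<alpha> * z + \<beta>) \<in> carrier AutC" by (rule AutC_I[OF \<alpha>_nonzero[OF U]])
  show "f \<circ> \<Theta> = \<Theta> \<circ> (\<lambda>z. \<alpha> * z + \<beta>)" using \<Theta>_conj[OF U] by (simp add: fun_eq_iff)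
qed (rule deck_discrete orbifold_quotient[OF U])+

lemma translations_subset_deck: "translations_by (periods \<Theta>) \<subseteq> deck \<Theta>"
proof
  fix x assume "x \<in> translations_by (periods \<Theta>)"
  then obtain t where "x = (\<lambda>z. z + t)" "t \<in> periods \<Theta>" unfolding translations_by_def by blast
  then show "x \<in> deck \<Theta>" using deck_I[of 1 t] by (simp add: periods_def)
qed

text \<open>
  The alternative \<open>X = {}\<close> covers the group of translations, in which the generating rotation is trivial.
\<close>

lemma deck_eq_generate:
  assumes \<omega>: "\<omega> \<noteq> 0" "\<And>z. \<Theta> (\<omega> * z) = \<Theta> z" and R: "\<And>\<eta>. \<eta> \<in> rotations \<Theta> \<Longrightarrow> \<exists>j::nat. \<eta> = \<omega> ^ j"
    and X: "X = {\<lambda>z. \<omega> * z} \<or> X = {} \<and> \<omega> = 1"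
  shows "deck \<Theta> = generate AutC (translations_by (periods \<Theta>) \<union> X)"
proof
  show "generate AutC (translations_by (periods \<Theta>) \<union> X) \<subseteq> deck \<Theta>"
  proof (rule group.generate_subgroup_incl[OF AutC_group _ deck_subgroup])
    show "translations_by (periods \<Theta>) \<union> X \<subseteq> deck \<Theta>"
      using translations_subset_deck deck_I[of \<omega> 0] \<omega> X by auto
  qed
  show "deck \<Theta> \<subseteq> generate AutC (translations_by (periods \<Theta>) \<union> X)" (is "_ \<subseteq> ?G")
  proof
    fix x assume "x \<in> deck \<Theta>"
    then obtain \<eta> t where x: "x = (\<lambda>z. \<eta> * z + t)" "\<eta> \<noteq> 0" "\<And>z. \<Theta> (\<eta> * z + t) = \<Theta> z"
      unfolding deck_def by blast
    then have "\<eta> \<in> rotations \<Theta>" unfolding rotations_def by blast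
    then obtain j where j: "\<eta> = \<omega> ^ j" using R by blast
    have inv_pow: "\<Theta> (\<omega> ^ j * z) = \<Theta> z" for z j
      by (induction j) (simp_all add: \<omega>(2) mult.assoc)
    have pow: "(\<lambda>z. \<omega> ^ j * z) \<in> ?G" for j
    proof (induction j)
      case 0
      have "(\<lambda>z::complex. z) = \<one>\<^bsub>AutC\<^esub>" by (simp add: AutC_simps fun_eq_iff)
      then show ?case using generate.one[of AutC "translations_by (periods \<Theta>) \<union> X"] by simp
    next
      case (Suc j)
      show ?case
      proof (cases "X = {\<lambda>z. \<omega> * z}")
        case True
        have "(\<lambda>z. \<omega> * z) \<in> ?G" by (rule generate.incl) (use True in simp)
        from generate.eng[OF this Suc] show ?thesis by (simp add: AutC_simps o_def mult.assoc)
      next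
        case False
        then show ?thesis using X Suc by simp
      qed
    qed
    have "t - 0 \<in> periods \<Theta>"
      by (rule same_rotation[OF U x(3) _ x(2)]) (use inv_pow j in simp)
    then have "(\<lambda>z. z + t) \<in> ?G"
      by (intro generate.incl) (auto simp: translations_by_def)
    from generate.eng[OF this pow[of j]] show "x \<in> ?G"
      by (simp add: AutC_simps o_def x(1) j)
  qed
qed

text \<open>
  The rotations about \<open>z\<close> by all the \<open>n\<close>-th roots of unity, for \<open>n = \<nu>(\<Theta> z)\<close>, belong to the deck group, so
  a primitive one has order dividing \<open>m\<close>.
\<close>

lemma weight_dvd:
  assumes R: "\<And>\<omega>. \<omega> \<in> rotations \<Theta> \<Longrightarrow> \<omega> ^ m = 1"
  shows "wt (\<Theta> z) dvd m"
proof -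
  define n where "n = wt (\<Theta> z)"
  have n: "n \<ge> 1" unfolding n_def by (rule wt(1)[OF b_\<Theta>[OF U]])
  define \<omega> where "\<omega> = exp (2 * of_real pi * \<i> * of_nat 1 / of_nat n)"
  have "\<omega> ^ n = 1" unfolding \<omega>_def using complex_root_unity[of n 1] n by simp
  then have st: "\<Theta> (z + \<omega> * u) = \<Theta> (z + u)" for u using stabilizer[OF U] n_def by blast
  have "\<Theta> (\<omega> * y + (z - \<omega> * z)) = \<Theta> y" for y
    using st[of "y - z"] by (simp add: algebra_simps)
  moreover have "\<omega> \<noteq> 0" by (simp add: \<omega>_def)
  ultimately have "\<omega> \<in> rotations \<Theta>" unfolding rotations_def by blast
  then have "\<omega> ^ m = 1" by (rule R)
  then have "exp (2 * of_real pi * \<i> * of_nat m / of_nat n) = 1"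
    unfolding \<omega>_def by (simp add: mult_ac flip: exp_of_nat_mult)
  then have "n dvd m" using complex_root_unity_eq_1[of n m] n by simp
  then show ?thesis by (simp add: n_def)
qed

text \<open>
  A rotation about \<open>0\<close> fixes \<open>0\<close>, so its order divides the weight there.
\<close>

lemma weight_at_center:
  assumes "\<And>z. \<Theta> (\<omega> * z) = \<Theta> z"
  shows "\<omega> ^ wt (\<Theta> 0) = 1"
  using stabilizer[OF U, of 0 \<omega>] assms by simp

end

definition defect :: "enat \<Rightarrow> real" where
  "defect v = (case v of enat m \<Rightarrow> 1 - 1 / real m | \<infinity> \<Rightarrow> 1)"

lemma count_weights: "count (weights nu) v = card {x. nu x \<noteq> 1 \<and> nu x = v}"
proof -
  have "finite {x. nu x \<noteq> 1}" unfolding nu_eq_1_iff by (rule finite_singular)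
  then have "count (weights nu) v = (\<Sum>x\<in>nu -` {v} \<inter> {x. nu x \<noteq> 1}. count (mset_set {x. nu x \<noteq> 1}) x)"
    unfolding weights_def by (simp add: count_image_mset)
  also have "\<dots> = (\<Sum>x\<in>nu -` {v} \<inter> {x. nu x \<noteq> 1}. 1)"
    by (rule sum.cong) (use \<open>finite {x. nu x \<noteq> 1}\<close> in \<open>auto simp: count_mset_set\<close>)
  also have "\<dots> = card (nu -` {v} \<inter> {x. nu x \<noteq> 1})" by simp
  also have "nu -` {v} \<inter> {x. nu x \<noteq> 1} = {x. nu x \<noteq> 1 \<and> nu x = v}" by auto
  finally show ?thesis .
qed

text \<open>
  The degree formula divided by \<open>k\<close>, with the points grouped by weight.
\<close>

lemma weights_sum:
  assumes V: "finite V" "\<And>x. nu x \<noteq> 1 \<Longrightarrow> nu x \<in> V"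
  shows "(\<Sum>v\<in>V. real (count (weights nu) v) * defect v) = 2"
proof -
  have fin: "finite {x. nu x \<noteq> 1}" unfolding nu_eq_1_iff by (rule finite_singular)
  have def_nu: "defect (nu x) = real_of_int (int k - b x) / real k" for x
  proof (cases "b x = 0")
    case True
    then show ?thesis using k_ge_1 by (simp add: defect_def nu_def)
  next
    case False
    have "real (wt x) * real_of_int (b x) = real k"
      using wt(2)[OF False] by (metis of_int_mult of_int_of_nat_eq)
    then show ?thesis using wt(3)[OF False] False wt(1)[OF False] k_ge_1
      by (simp add: defect_def field_simps)
  qed
  have "(\<Sum>v\<in>V. real (count (weights nu) v) * defect v) = (\<Sum>v\<in>V. \<Sum>x | x \<in> {x. nu x \<noteq> 1} \<and> nu x = v. defect (nu x))"
    by (intro sum.cong refl) (simp add: count_weights)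
  also have "\<dots> = (\<Sum>x | nu x \<noteq> 1. defect (nu x))"
    using V fin by (intro sum.group) auto
  also have "\<dots> = real_of_int (\<Sum>x | b x \<noteq> int k. int k - b x) / real k"
    by (simp only: def_nu nu_eq_1_iff of_int_sum sum_divide_distrib)
  also have "\<dots> = 2" unfolding degree_formula using k_ge_1 by simp
  finally show ?thesis .
qed

lemma count_weights_outside:
  assumes "\<And>x. nu x \<noteq> 1 \<Longrightarrow> nu x \<in> V" "v \<notin> V"
  shows "count (weights nu) v = 0"
proof -
  have "{x. nu x \<noteq> 1 \<and> nu x = v} = {}" using assms by blast
  then show ?thesis by (simp only: count_weights card.empty)
qed

lemma count_weights_positive:
  assumes "nu x = v" "v \<noteq> 1"
  shows "count (weights nu) v > 0"
proof -
  have "finite {x. nu x \<noteq> 1}" unfolding nu_eq_1_iff by (rule finite_singular)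
  then have "finite {x. nu x \<noteq> 1 \<and> nu x = v}" by (rule rev_finite_subset) blast
  then show ?thesis unfolding count_weights card_gt_0_iff using assms by blast
qed

end

section \<open>The lattices of Gaussian and Eisenstein integers\<close>

lemma zeta_eq: "\<zeta> = Complex (- 1 / 2) (sqrt 3 / 2)"
proof -
  have "\<zeta> = cis (2 * pi / 3)"
    unfolding zeta_def cis_conv_exp by (simp add: mult_ac)
  then show ?thesis by (simp add: complex_eq_iff cos_120 sin_120)
qed

lemma zeta_Re_Im [simp]: "Re \<zeta> = - 1 / 2" "Im \<zeta> = sqrt 3 / 2"
  by (simp_all add: zeta_eq)

lemma zeta_sq: "\<zeta> * \<zeta> = - 1 - \<zeta>"
  by (simp add: complex_eq_iff)

lemma zeta_sq_left: "\<zeta> * (\<zeta> * x) = - x - \<zeta> * x"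
  by (simp add: mult.assoc[symmetric] zeta_sq algebra_simps)

lemma zeta_cube: "\<zeta> ^ 3 = 1"
  by (simp add: power3_eq_cube zeta_sq algebra_simps)

lemma zeta_nonzero [simp]: "\<zeta> \<noteq> 0"
  by (simp add: complex_eq_iff)

lemma lattice_I: "of_int m + of_int n * \<tau> \<in> plane_lattice \<tau>"
  unfolding plane_lattice_def by blast

text \<open>
  The Gaussian integers have covering radius less than \<open>1\<close>: rounding both coordinates leaves an element
  of norm less than \<open>1\<close>.
\<close>

lemma lattice_i_eq:
  assumes diff: "\<And>s t. s \<in> P \<Longrightarrow> t \<in> P \<Longrightarrow> s - t \<in> P" and sub: "plane_lattice \<i> \<subseteq> P"
    and min: "\<And>t. t \<in> P \<Longrightarrow> t \<noteq> 0 \<Longrightarrow> norm t \<ge> 1"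
  shows "P = plane_lattice \<i>"
proof (intro equalityI subsetI)
  fix t assume t: "t \<in> P"
  define l where "l = of_int (round (Re t)) + of_int (round (Im t)) * \<i>"
  have l: "l \<in> plane_lattice \<i>" unfolding l_def by (rule lattice_I)
  have "\<bar>Re (t - l)\<bar> \<le> 1 / 2" "\<bar>Im (t - l)\<bar> \<le> 1 / 2"
    using of_int_round_abs_le[of "Re t"] of_int_round_abs_le[of "Im t"] by (simp_all add: l_def abs_minus_commute)
  then have "(Re (t - l))\<^sup>2 \<le> (1 / 2)\<^sup>2" "(Im (t - l))\<^sup>2 \<le> (1 / 2)\<^sup>2"
    using abs_le_square_iff[of _ "1 / 2 :: real"] by auto
  then have "(norm (t - l))\<^sup>2 < 1\<^sup>2" unfolding cmod_power2 by (simp add: power2_eq_square)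
  then have "norm (t - l) < 1" using power2_less_imp_less[of "norm (t - l)" 1] by simp
  moreover have "t - l \<in> P" using diff t l sub by blast
  ultimately have "t - l = 0" using min[of "t - l"] by linarith
  then show "t \<in> plane_lattice \<i>" using l by simp
qed (use sub in blast)

text \<open>
  Rounding the coordinates \<open>u, v\<close> with respect to \<open>1, \<zeta>\<close> leaves \<open>u^2 - u v + v^2 \<le> 3/4\<close>.
\<close>

lemma lattice_zeta_eq:
  assumes diff: "\<And>s t. s \<in> P \<Longrightarrow> t \<in> P \<Longrightarrow> s - t \<in> P" and sub: "plane_lattice \<zeta> \<subseteq> P"
    and min: "\<And>t. t \<in> P \<Longrightarrow> t \<noteq> 0 \<Longrightarrow> norm t \<ge> 1"
  shows "P = plane_lattice \<zeta>"
proof (intro equalityI subsetI)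
  fix t assume t: "t \<in> P"
  define y where "y = Im t / (sqrt 3 / 2)"
  define x where "x = Re t + y / 2"
  have t_xy: "t = of_real x + of_real y * \<zeta>" by (simp add: complex_eq_iff x_def y_def)
  define l where "l = of_int (round x) + of_int (round y) * \<zeta>"
  have l: "l \<in> plane_lattice \<zeta>" unfolding l_def by (rule lattice_I)
  define u v where "u = x - of_int (round x)" and "v = y - of_int (round y)"
  have uv: "\<bar>u\<bar> \<le> 1 / 2" "\<bar>v\<bar> \<le> 1 / 2"
    using of_int_round_abs_le[of x] of_int_round_abs_le[of y] by (simp_all add: u_def v_def abs_minus_commute)
  have tl: "t - l = of_real u + of_real v * \<zeta>" by (simp add: t_xy l_def u_def v_def algebra_simps)
  have "(norm (t - l))\<^sup>2 = (u - v / 2)\<^sup>2 + (v * sqrt 3 / 2)\<^sup>2" unfolding tl cmod_power2 by simp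
  also have "\<dots> = u * u - u * v + v * v" by (simp add: power2_eq_square field_simps)
  also have "\<dots> \<le> \<bar>u\<bar> * \<bar>u\<bar> + \<bar>u\<bar> * \<bar>v\<bar> + \<bar>v\<bar> * \<bar>v\<bar>"
    using abs_ge_minus_self[of "u * v"] by (simp add: abs_mult)
  also have "\<dots> \<le> 1 / 2 * (1 / 2) + 1 / 2 * (1 / 2) + 1 / 2 * (1 / 2)"
    using uv by (intro add_mono mult_mono) auto
  also have "\<dots> < 1\<^sup>2" by simp
  finally have "norm (t - l) < 1" using power2_less_imp_less[of "norm (t - l)" 1] by simp
  moreover have "t - l \<in> P" using diff t l sub by blast
  ultimately have "t - l = 0" using min[of "t - l"] by linarith
  then show "t \<in> plane_lattice \<zeta>" using l by simp
qed (use sub in blast)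

text \<open>
  Since \<open>1/(1 - \<i>) = (1 + \<i>)/2\<close> and \<open>1 - \<i>\<close> has norm \<open>2\<close>, the quotients by \<open>1 - \<i>\<close> of Gaussian integers
  fall into two classes.
\<close>

lemma lattice_i_residue:
  assumes "(1 - \<i>) * \<beta> \<in> plane_lattice \<i>"
  shows "\<exists>\<beta>'\<in>{0, (\<i> + 1) / 2}. \<beta> - \<beta>' \<in> plane_lattice \<i>"
proof -
  obtain m n where mn: "(1 - \<i>) * \<beta> = of_int m + of_int n * \<i>" using assms unfolding plane_lattice_def by blast
  have "\<beta> = ((1 - \<i>) * \<beta>) * (1 + \<i>) / 2" by (simp add: algebra_simps)
  then have \<beta>: "\<beta> = (of_int (m - n) + of_int (m + n) * \<i>) / 2" unfolding mn by (simp add: algebra_simps)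
  show ?thesis
  proof (cases "even (m + n)")
    case True
    then obtain a where a: "m + n = 2 * a" by blast
    then have m: "m = 2 * a - n" by simp
    have "\<beta> - 0 = of_int (a - n) + of_int a * \<i>"
      unfolding \<beta> m by (simp add: field_simps)
    then show ?thesis using lattice_I[of "a - n" a \<i>] by auto
  next
    case False
    then obtain a where a: "m + n = 2 * a + 1" by (elim oddE)
    then have m: "m = 2 * a + 1 - n" by simp
    have "\<beta> - (\<i> + 1) / 2 = of_int (a - n) + of_int a * \<i>"
      unfolding \<beta> m by (simp add: field_simps)
    then show ?thesis using lattice_I[of "a - n" a \<i>] by auto
  qed
qed

text \<open>
  Since \<open>1/(1 - \<zeta>) = (2 + \<zeta>)/3\<close> and \<open>1 - \<zeta>\<close> has norm \<open>3\<close>, there are three classes, represented by the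
  multiples of \<open>(2 + \<zeta>)/3\<close>; twice this number is \<open>\<i> sqrt 3 / 3 + 1\<close>.
\<close>

lemma lattice_zeta_residue3:
  assumes "(1 - \<zeta>) * \<beta> \<in> plane_lattice \<zeta>"
  shows "\<exists>\<beta>'\<in>{0, (\<zeta> + 2) / 3, \<i> * of_real (sqrt 3) / 3}. \<beta> - \<beta>' \<in> plane_lattice \<zeta>"
proof -
  obtain m n where mn: "(1 - \<zeta>) * \<beta> = of_int m + of_int n * \<zeta>" using assms unfolding plane_lattice_def by blast
  have "(1 - \<zeta>) * (2 + \<zeta>) = 3" by (simp add: algebra_simps zeta_sq)
  then have "3 * \<beta> = ((1 - \<zeta>) * \<beta>) * (2 + \<zeta>)" by (metis mult.assoc mult.commute)
  also have "\<dots> = of_int (2 * m - n) + of_int (m + n) * \<zeta>" unfolding mn by (simp add: algebra_simps zeta_sq zeta_sq_left)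
  finally have \<beta>: "\<beta> = (of_int (2 * m - n) + of_int (m + n) * \<zeta>) / 3" by (simp add: field_simps)
  have i3: "\<i> * of_real (sqrt 3) = 1 + 2 * \<zeta>" by (simp add: complex_eq_iff)
  define a where "a = (m + n) div 3"
  have "(m + n) mod 3 = 0 \<or> (m + n) mod 3 = 1 \<or> (m + n) mod 3 = 2" by presburger
  then consider "n = 3 * a - m" | "n = 3 * a + 1 - m" | "n = 3 * a + 2 - m"
    unfolding a_def by (metis add_diff_cancel_left' add.right_neutral mult_div_mod_eq)
  then show ?thesis
  proof cases
    case 1
    have "\<beta> - 0 = of_int (m - a) + of_int a * \<zeta>" unfolding \<beta> 1 by (simp add: field_simps)
    then show ?thesis using lattice_I[of "m - a" a \<zeta>] by auto
  next
    case 2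
    have "\<beta> - (\<zeta> + 2) / 3 = of_int (m - a - 1) + of_int a * \<zeta>" unfolding \<beta> 2 by (simp add: field_simps)
    then show ?thesis using lattice_I[of "m - a - 1" a \<zeta>] by auto
  next
    case 3
    have "\<beta> - \<i> * of_real (sqrt 3) / 3 = of_int (m - a - 1) + of_int a * \<zeta>" unfolding \<beta> 3 i3 by (simp add: field_simps)
    then show ?thesis using lattice_I[of "m - a - 1" a \<zeta>] by auto
  qed
qed

text \<open>
  \<open>1 + \<zeta>\<close> is a unit with inverse \<open>- \<zeta>\<close>.
\<close>

lemma lattice_zeta_residue6:
  assumes "(1 - - \<zeta>) * \<beta> \<in> plane_lattice \<zeta>"
  shows "\<beta> \<in> plane_lattice \<zeta>"
proof -
  obtain m n where mn: "(1 - - \<zeta>) * \<beta> = of_int m + of_int n * \<zeta>" using assms unfolding plane_lattice_def by blast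
  have "(1 - - \<zeta>) * (- \<zeta>) = 1" by (simp add: algebra_simps zeta_sq)
  then have "\<beta> = ((1 - - \<zeta>) * \<beta>) * (- \<zeta>)" by (metis mult.assoc mult.commute mult.left_neutral)
  also have "\<dots> = of_int n + of_int (n - m) * \<zeta>" unfolding mn by (simp add: algebra_simps zeta_sq zeta_sq_left)
  finally show ?thesis using lattice_I by metis
qed

text \<open>
  Multiplication by \<open>\<alpha>\<close> acts on the basis \<open>1, \<tau>\<close> by an integral matrix with trace \<open>s\<close> and determinant
  \<open>p\<close>, so \<open>\<alpha>^2 - s \<alpha> + p = 0\<close>. Unless \<open>\<alpha>\<close> is an integer it is not real, and then \<open>4 p - s^2\<close> is positive.
\<close>

lemma lattice_multiplier_imaginary_quadratic:
  assumes \<tau>: "Im \<tau> > 0" and \<alpha>: "\<alpha> \<in> plane_lattice \<tau>" "\<alpha> * \<tau> \<in> plane_lattice \<tau>"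
  shows "algebraic_int \<alpha> \<and> (\<exists>K. imaginary_quadratic_field K \<and> \<alpha> \<in> K)"
proof -
  obtain a b where ab: "\<alpha> = of_int a + of_int b * \<tau>" using \<alpha>(1) unfolding plane_lattice_def by blast
  obtain c d where cd: "\<alpha> * \<tau> = of_int c + of_int d * \<tau>" using \<alpha>(2) unfolding plane_lattice_def by blast
  define s p where "s = a + d" and "p = a * d - b * c"
  have quad: "\<alpha> * \<alpha> - of_int s * \<alpha> + of_int p = 0"
  proof -
    have "(\<alpha> - of_int a) * (\<alpha> * \<tau> - of_int d * \<tau>) = of_int b * \<tau> * of_int c" using ab cd by simp
    then have "((\<alpha> - of_int a) * (\<alpha> - of_int d) - of_int (b * c)) * \<tau> = 0" by (simp add: algebra_simps)
    moreover have "\<tau> \<noteq> 0" using \<tau> by auto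
    ultimately have "(\<alpha> - of_int a) * (\<alpha> - of_int d) - of_int (b * c) = 0" by simp
    then show ?thesis by (simp add: s_def p_def algebra_simps)
  qed
  have alg: "algebraic_int \<alpha>"
  proof (rule algebraic_int.intros)
    let ?P = "[:of_int p, - of_int s, 1:] :: complex poly"
    show "lead_coeff ?P = 1" by simp
    show "\<forall>i. coeff ?P i \<in> \<int>" by (auto simp: coeff_pCons split: nat.split)
    show "poly ?P \<alpha> = 0" using quad by (simp add: algebra_simps)
  qed
  have "\<exists>K. imaginary_quadratic_field K \<and> \<alpha> \<in> K"
  proof (cases "b = 0")
    case True
    define K where "K = {of_rat x + of_rat y * (\<i> * of_real (sqrt (real 1))) | x y :: rat. True}"
    have "imaginary_quadratic_field K" unfolding imaginary_quadratic_field_def K_def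
      by (intro exI[of _ 1]) simp
    moreover have "\<alpha> = of_rat (of_int a) + of_rat 0 * (\<i> * of_real (sqrt (real 1)))" using True ab by simp
    then have "\<alpha> \<in> K" unfolding K_def by blast
    ultimately show ?thesis by blast
  next
    case False
    then have Im\<alpha>: "Im \<alpha> \<noteq> 0" using \<tau> ab by simp
    have "Im (\<alpha> * \<alpha> - of_int s * \<alpha> + of_int p) = 0" "Re (\<alpha> * \<alpha> - of_int s * \<alpha> + of_int p) = 0" by (simp_all add: quad)
    then have re: "2 * Re \<alpha> = of_int s" and "(Re \<alpha>)\<^sup>2 - (Im \<alpha>)\<^sup>2 - of_int s * Re \<alpha> + of_int p = 0"
      using Im\<alpha> by (simp_all add: power2_eq_square algebra_simps)
    then have disc: "(2 * Im \<alpha>)\<^sup>2 = of_int (4 * p - s * s)"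
      by (simp add: power2_eq_square algebra_simps flip: re)
    define D where "D = nat (4 * p - s * s)"
    have "(2 * Im \<alpha>)\<^sup>2 > 0" using Im\<alpha> by simp
    then have "real_of_int (4 * p - s * s) > 0" by (simp only: disc)
    then have pos: "4 * p - s * s > 0" by linarith
    then have D: "D > 0" "real D = (2 * Im \<alpha>)\<^sup>2" using disc by (simp_all add: D_def)
    have sq: "sqrt (real D) = \<bar>2 * Im \<alpha>\<bar>" unfolding D(2) by (rule real_sqrt_abs)
    \<comment> \<open>\<open>sqrt D = \<bar>2 Im \<alpha>\<bar>\<close>, so the sign of \<open>Im \<alpha>\<close> has to be restored.\<close>
    define y :: rat where "y = (if Im \<alpha> > 0 then 1 / 2 else - 1 / 2)"
    define K where "K = {of_rat x + of_rat y * (\<i> * of_real (sqrt (real D))) | x y :: rat. True}"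
    have "imaginary_quadratic_field K" unfolding imaginary_quadratic_field_def K_def using D(1) by blast
    moreover have "\<alpha> = of_rat (of_int s / 2) + of_rat y * (\<i> * of_real (sqrt (real D)))"
      unfolding sq using re by (simp add: complex_eq_iff y_def of_rat_divide of_rat_minus)
    then have "\<alpha> \<in> K" unfolding K_def by blast
    ultimately show ?thesis by blast
  qed
  with alg show ?thesis by blast
qed

text \<open>
  The crystallographic restriction, by running through the possible integers \<open>2 Re \<omega>\<close>.
\<close>

lemma unit_rotation_cases:
  assumes unit: "norm \<omega> = 1" and int: "2 * Re \<omega> \<in> \<int>"
  shows "\<omega> \<in> {1, - 1} \<or> \<omega> \<in> {\<i>, - \<i>} \<or> \<omega> \<in> {\<zeta>, \<zeta>\<^sup>2} \<or> \<omega> \<in> {- \<zeta>, - \<zeta>\<^sup>2}"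
proof -
  obtain r :: int where r: "2 * Re \<omega> = of_int r" using int by (auto elim: Ints_cases)
  have "\<bar>Re \<omega>\<bar> \<le> 1" using abs_Re_le_cmod[of \<omega>] unit by simp
  then have "\<bar>r\<bar> \<le> 2" using r by linarith
  then have "r \<in> {-2, -1, 0, 1, 2}" by auto
  moreover have sq: "(Im \<omega>)\<^sup>2 = 1 - (Re \<omega>)\<^sup>2" using unit cmod_power2[of \<omega>] by simp
  have z2: "\<zeta>\<^sup>2 = Complex (- 1 / 2) (- sqrt 3 / 2)" by (simp add: power2_eq_square zeta_sq complex_eq_iff)
  have three: "Im \<omega> = sqrt 3 / 2 \<or> Im \<omega> = - (sqrt 3 / 2)" if "\<bar>Re \<omega>\<bar> = 1 / 2"
  proof -
    have "(Re \<omega>)\<^sup>2 = (1 / 2)\<^sup>2" using that by (metis power2_abs)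
    then have "(Im \<omega>)\<^sup>2 = (sqrt 3 / 2)\<^sup>2" using sq by (simp add: power_divide)
    then show ?thesis by (simp only: power2_eq_iff)
  qed
  ultimately show ?thesis
  proof (elim insertE emptyE)
    assume "r = - 2"
    then have "Re \<omega> = - 1" using r by simp
    moreover from this have "Im \<omega> = 0" using sq by simp
    ultimately show ?thesis by (simp add: complex_eq_iff)
  next
    assume "r = 2"
    then have "Re \<omega> = 1" using r by simp
    moreover from this have "Im \<omega> = 0" using sq by simp
    ultimately show ?thesis by (simp add: complex_eq_iff)
  next
    assume "r = 0"
    then have "Re \<omega> = 0" using r by simp
    moreover from this have "Im \<omega> = 1 \<or> Im \<omega> = - 1" using sq power2_eq_iff[of "Im \<omega>" 1] by simp
    ultimately show ?thesis by (auto simp: complex_eq_iff)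
  next
    assume "r = - 1"
    then have "Re \<omega> = - 1 / 2" using r by simp
    moreover from this have "Im \<omega> = sqrt 3 / 2 \<or> Im \<omega> = - (sqrt 3 / 2)" by (intro three) simp
    ultimately show ?thesis by (auto simp: complex_eq_iff z2)
  next
    assume "r = 1"
    then have "Re \<omega> = 1 / 2" using r by simp
    moreover from this have "Im \<omega> = sqrt 3 / 2 \<or> Im \<omega> = - (sqrt 3 / 2)" by (intro three) simp
    ultimately show ?thesis by (auto simp: complex_eq_iff z2)
  qed
qed

section \<open>The six cases\<close>

lemma two_dvd_cases: "n dvd (2::nat) \<Longrightarrow> n = 1 \<or> n = 2"
proof -
  assume n: "n dvd 2"
  then have "n \<le> 2" by (rule dvd_imp_le) simp
  then have "n \<in> {0, 1, 2}" by auto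
  then show ?thesis using n by auto
qed

lemma three_dvd_cases: "n dvd (3::nat) \<Longrightarrow> n = 1 \<or> n = 3"
proof -
  assume n: "n dvd 3"
  then have "n \<le> 3" by (rule dvd_imp_le) simp
  then have "n \<in> {0, 1, 2, 3}" by auto
  then show ?thesis using n by auto
qed

lemma four_dvd_cases: "n dvd (4::nat) \<Longrightarrow> n = 1 \<or> n = 2 \<or> n = 4"
proof -
  assume n: "n dvd 4"
  then have "n \<le> 4" by (rule dvd_imp_le) simp
  then have "n \<in> {0, 1, 2, 3, 4}" by auto
  then show ?thesis using n by auto
qed

lemma six_dvd_cases: "n dvd (6::nat) \<Longrightarrow> n = 1 \<or> n = 2 \<or> n = 3 \<or> n = 6"
proof -
  assume n: "n dvd 6"
  then have "n \<le> 6" by (rule dvd_imp_le) simp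
  then have "n \<in> {0, 1, 2, 3, 4, 5, 6}" by auto
  then show ?thesis using n by auto
qed

context invariant_section
begin

lemma defect_numeral [simp]: "defect (numeral n) = 1 - 1 / numeral n"
  and defect_infinity [simp]: "defect \<infinity> = 1"
  by (simp_all add: defect_def numeral_eq_enat)

lemma uniformizes_shift:
  assumes U: "uniformizes \<Theta> \<alpha> \<beta>" and p: "\<beta> - \<beta>' \<in> periods \<Theta>"
  shows "uniformizes \<Theta> \<alpha> \<beta>'"
proof -
  have "\<Theta> (\<alpha> * z + \<beta>) = \<Theta> (\<alpha> * z + \<beta>')" for z
  proof -
    have "\<Theta> ((\<alpha> * z + \<beta>') + (\<beta> - \<beta>')) = \<Theta> (\<alpha> * z + \<beta>')" using p unfolding periods_def by blast
    then show ?thesis by (simp add: algebra_simps)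
  qed
  then show ?thesis using U unfolding uniformizes_def by simp
qed

lemma periods_rescale:
  assumes "w \<noteq> 0"
  shows "periods (\<lambda>z. \<Theta> (w * z + z0)) = {l. w * l \<in> periods \<Theta>}"
proof (intro equalityI subsetI)
  fix l assume l: "l \<in> periods (\<lambda>z. \<Theta> (w * z + z0))"
  have "\<Theta> (z + w * l) = \<Theta> z" for z
  proof -
    define y where "y = (z - z0) / w"
    have y: "z = w * y + z0" using assms by (simp add: y_def)
    have "\<Theta> (w * (y + l) + z0) = \<Theta> (w * y + z0)" using l unfolding periods_def by blast
    then show ?thesis by (simp add: y algebra_simps)
  qed
  then show "l \<in> {l. w * l \<in> periods \<Theta>}" by (simp add: periods_def)
next
  fix l assume "l \<in> {l. w * l \<in> periods \<Theta>}"
  then have l: "\<Theta> (z + w * l) = \<Theta> z" for z by (simp add: periods_def)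
  have "\<Theta> (w * (z + l) + z0) = \<Theta> (w * z + z0)" for z
    using l[of "w * z + z0"] by (simp add: algebra_simps)
  then show "l \<in> periods (\<lambda>z. \<Theta> (w * z + z0))" by (simp add: periods_def)
qed

lemma rotations_rescale:
  assumes "w \<noteq> 0"
  shows "rotations (\<lambda>z. \<Theta> (w * z + z0)) = rotations \<Theta>"
proof (intro equalityI subsetI)
  fix \<omega> assume "\<omega> \<in> rotations (\<lambda>z. \<Theta> (w * z + z0))"
  then obtain t where \<omega>: "\<omega> \<noteq> 0" and t: "\<And>z. \<Theta> (w * (\<omega> * z + t) + z0) = \<Theta> (w * z + z0)"
    unfolding rotations_def by blast
  have "\<Theta> (\<omega> * z + (w * t + z0 - \<omega> * z0)) = \<Theta> z" for z
  proof -
    define y where "y = (z - z0) / w"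
    have y: "z = w * y + z0" using assms by (simp add: y_def)
    show ?thesis using t[of y] by (simp add: y algebra_simps)
  qed
  then show "\<omega> \<in> rotations \<Theta>" using \<omega> unfolding rotations_def by blast
next
  fix \<omega> assume "\<omega> \<in> rotations \<Theta>"
  then obtain t where \<omega>: "\<omega> \<noteq> 0" and t: "\<And>z. \<Theta> (\<omega> * z + t) = \<Theta> z"
    unfolding rotations_def by blast
  define s where "s = (t - z0 + \<omega> * z0) / w"
  have "w * s = t - z0 + \<omega> * z0" using assms by (simp add: s_def)
  then have "w * (\<omega> * z + s) + z0 = \<omega> * (w * z + z0) + t" for z by (simp add: algebra_simps)
  then have "\<Theta> (w * (\<omega> * z + s) + z0) = \<Theta> (w * z + z0)" for z using t by simp
  then show "\<omega> \<in> rotations (\<lambda>z. \<Theta> (w * z + z0))" using \<omega> unfolding rotations_def by blast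
qed

text \<open>
  A deck transformation \<open>z \<mapsto> \<omega> z + t\<close> with \<open>\<omega> \<noteq> 1\<close> has the fixed point \<open>t / (1 - \<omega>)\<close>, which becomes
  the origin.
\<close>

lemma center_rotation:
  assumes U: "uniformizes \<Theta>\<^sub>0 \<alpha> \<beta>\<^sub>0" and w: "w \<noteq> 0" and \<omega>: "\<omega> \<in> rotations \<Theta>\<^sub>0" "\<omega> \<noteq> 1"
  obtains \<Theta> \<beta> where "uniformizes \<Theta> \<alpha> \<beta>" "\<And>z. \<Theta> (\<omega> * z) = \<Theta> z"
    "periods \<Theta> = {l. w * l \<in> periods \<Theta>\<^sub>0}" "rotations \<Theta> = rotations \<Theta>\<^sub>0"
proof -
  obtain t where t: "\<And>z. \<Theta>\<^sub>0 (\<omega> * z + t) = \<Theta>\<^sub>0 z" using \<omega>(1) unfolding rotations_def by blast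
  define z0 where "z0 = t / (1 - \<omega>)"
  have "(1 - \<omega>) * z0 = t" using \<omega>(2) by (simp add: z0_def)
  then have z0: "t = z0 - \<omega> * z0" by (simp add: algebra_simps)
  have "\<Theta>\<^sub>0 (w * (\<omega> * z) + z0) = \<Theta>\<^sub>0 (w * z + z0)" for z
    using t[of "w * z + z0"] by (simp add: z0 algebra_simps)
  then show thesis
    by (rule that[OF uniformizes_affine[OF U w] _ periods_rescale[OF w] rotations_rescale[OF w]])
qed

lemma one_rotation: "1 \<in> rotations \<Theta>"
  unfolding rotations_def by (auto intro: exI[of _ 0])

lemma mult_rotation:
  assumes "\<omega> \<in> rotations \<Theta>" "\<eta> \<in> rotations \<Theta>"
  shows "\<omega> * \<eta> \<in> rotations \<Theta>"
proof -
  obtain s t where \<omega>: "\<omega> \<noteq> 0" "\<And>z. \<Theta> (\<omega> * z + s) = \<Theta> z" and \<eta>: "\<eta> \<noteq> 0" "\<And>z. \<Theta> (\<eta> * z + t) = \<Theta> z"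
    using assms unfolding rotations_def by blast
  have "\<Theta> (\<omega> * \<eta> * z + (\<omega> * t + s)) = \<Theta> z" for z
    using \<omega>(2)[of "\<eta> * z + t"] \<eta>(2)[of z] by (simp add: algebra_simps)
  then show ?thesis using \<omega>(1) \<eta>(1) unfolding rotations_def by auto
qed

lemma norm_rotation:
  assumes "uniformizes \<Theta> \<alpha> \<beta>" "\<omega> \<in> rotations \<Theta>"
  shows "norm \<omega> = 1"
proof -
  have "norm \<omega> ^ k = 1" using rotations_roots[OF assms] by (metis norm_one norm_power)
  then show ?thesis using k_ge_1 power_eq_imp_eq_base[of "norm \<omega>" k 1] by simp
qed

lemma weight_values:
  assumes U: "uniformizes \<Theta> \<alpha> \<beta>" and R: "\<And>\<omega>. \<omega> \<in> rotations \<Theta> \<Longrightarrow> \<omega> ^ m = 1"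
  shows "nu x = \<infinity> \<or> (\<exists>n. n dvd m \<and> nu x = enat n)"
proof (cases "b x = 0")
  case True
  then show ?thesis by (simp add: nu_def)
next
  case False
  then obtain z where z: "x = \<Theta> z" using range_\<Theta>[OF U] by blast
  have "wt x dvd m" unfolding z by (rule weight_dvd[OF U R])
  then show ?thesis using wt(3)[OF False] by blast
qed

lemma weights_eqI:
  assumes V: "\<And>x. nu x \<noteq> 1 \<Longrightarrow> nu x \<in> V" "set_mset M \<subseteq> V"
    and c: "\<And>v. v \<in> V \<Longrightarrow> count (weights nu) v = count M v"
  shows "weights nu = M"
proof (rule multiset_eqI)
  fix v show "count (weights nu) v = count M v"
  proof (cases "v \<in> V")
    case True
    then show ?thesis by (rule c)
  next
    case False
    then have "v \<notin># M" using V(2) by blast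
    then show ?thesis using count_weights_outside[OF V(1) False] by (simp add: not_in_iff)
  qed
qed

lemma rank_one_translations:
  assumes U: "uniformizes \<Theta> \<alpha> 0" and P: "periods \<Theta> = \<int>" and R: "rotations \<Theta> = {1}"
  shows "weights nu = {#\<infinity>, \<infinity>#} \<and> deck \<Theta> = generate AutC (translations_by \<int>) \<and>
    (\<exists>n::int. \<bar>n\<bar> > 1 \<and> (\<lambda>z. \<alpha> * z + 0) = (\<lambda>z. of_int n * z))"
proof (intro conjI)
  have vals: "nu x = \<infinity> \<or> (\<exists>n. n dvd 1 \<and> nu x = enat n)" for x
    by (rule weight_values[OF U]) (simp add: R)
  have V: "nu x \<in> {\<infinity>}" if "nu x \<noteq> 1" for x using vals[of x] that by (auto simp: one_enat_def)
  have "count (weights nu) \<infinity> = 2" using weights_sum[of "{\<infinity>}"] V by simp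
  then show "weights nu = {#\<infinity>, \<infinity>#}" by (intro weights_eqI[of "{\<infinity>}"] V) auto
  show "deck \<Theta> = generate AutC (translations_by \<int>)"
    using deck_eq_generate[OF U, of 1 "{}"] by (simp add: R P)
  have "\<alpha> * 1 \<in> periods \<Theta>" by (rule scale_period[OF U]) (simp add: P)
  then obtain n where n: "\<alpha> = of_int n" by (auto simp: P elim: Ints_cases)
  have "real_of_int \<bar>n\<bar> > 1" using \<alpha>_norm[OF U] by (simp add: n)
  then have "\<bar>n\<bar> > 1" by linarith
  then show "\<exists>n::int. \<bar>n\<bar> > 1 \<and> (\<lambda>z. \<alpha> * z + 0) = (\<lambda>z. of_int n * z)" using n by auto
qed

text \<open>
  The number \<open>x\<close> of points of weight \<open>2\<close> and the number \<open>y\<close> of boundary points satisfy \<open>x + 2 y = 4\<close>. A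
  point of weight \<open>2\<close> lies below a \<open>z\<close> with \<open>2 z\<close> an integer, so \<open>x \<le> 2\<close>, while the image of \<open>0\<close> shows
  \<open>x \<ge> 1\<close>.
\<close>

lemma rank_one_reflection:
  assumes U: "uniformizes \<Theta> \<alpha> \<beta>" and P: "periods \<Theta> = \<int>" and R: "rotations \<Theta> = {1, - 1}"
    and even_\<Theta>: "\<And>z. \<Theta> (- 1 * z) = \<Theta> z"
  shows "\<exists>\<beta>'. uniformizes \<Theta> \<alpha> \<beta>' \<and> weights nu = {#2, 2, \<infinity>#} \<and>
    deck \<Theta> = generate AutC (translations_by \<int> \<union> {\<lambda>z. - z}) \<and>
    (\<exists>n::int. \<bar>n\<bar> > 1 \<and> \<beta>' \<in> {0, 1 / 2} \<and> (\<lambda>z. \<alpha> * z + \<beta>') = (\<lambda>z. of_int n * z + \<beta>'))"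
proof -
  have R2: "\<omega> ^ 2 = 1" if "\<omega> \<in> rotations \<Theta>" for \<omega> using that by (auto simp: R)
  have vals: "nu x = \<infinity> \<or> (\<exists>n. n dvd 2 \<and> nu x = enat n)" for x
    by (rule weight_values[OF U R2])
  have V: "nu x \<in> {2, \<infinity>}" if "nu x \<noteq> 1" for x
    using vals[of x] that by (auto simp: one_enat_def numeral_eq_enat dest!: two_dvd_cases)
  have "real (count (weights nu) 2) * (1 / 2) + real (count (weights nu) \<infinity>) = 2"
    using weights_sum[of "{2, \<infinity>}"] V by simp
  then have sum: "count (weights nu) 2 + 2 * count (weights nu) \<infinity> = 4" by linarith
  have "wt (\<Theta> 0) dvd 2" by (rule weight_dvd[OF U R2])
  moreover have "(- 1) ^ wt (\<Theta> 0) = (1::complex)" by (rule weight_at_center[OF U even_\<Theta>])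
  ultimately have "wt (\<Theta> 0) = 2" by (auto dest!: two_dvd_cases)
  then have "nu (\<Theta> 0) = 2" using wt(3)[OF b_\<Theta>[OF U]] by (simp add: numeral_eq_enat)
  then have pos: "count (weights nu) 2 > 0" by (intro count_weights_positive) (auto simp: numeral_eq_enat one_enat_def)
  have "{x. nu x \<noteq> 1 \<and> nu x = 2} \<subseteq> {\<Theta> 0, \<Theta> (1 / 2)}"
  proof
    fix x assume "x \<in> {x. nu x \<noteq> 1 \<and> nu x = 2}"
    then have nx: "nu x = enat 2" by (simp add: numeral_eq_enat)
    then have bx: "b x \<noteq> 0" by (auto simp: nu_def)
    then obtain z where z: "x = \<Theta> z" using range_\<Theta>[OF U] by blast
    have "wt (\<Theta> z) = 2" using wt(3)[OF bx] nx z by simp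
    then have st: "\<Theta> (z + - 1 * u) = \<Theta> (z + u)" for u using stabilizer[OF U, of z "- 1"] by simp
    have "\<Theta> (v + 2 * z) = \<Theta> v" for v
    proof -
      have "\<Theta> (v + 2 * z) = \<Theta> (z + (v + z))" by (simp add: algebra_simps)
      also have "\<dots> = \<Theta> (- 1 * v)" using st[of "v + z"] by simp
      finally show ?thesis by (simp only: even_\<Theta>)
    qed
    then have "2 * z \<in> \<int>" unfolding P[symmetric] periods_def by blast
    then obtain n where n: "2 * z = of_int n" by (auto elim: Ints_cases)
    have per: "\<Theta> (y + of_int j) = \<Theta> y" for y j
    proof -
      have "of_int j \<in> periods \<Theta>" unfolding P by simp
      then show ?thesis unfolding periods_def by blast
    qed
    show "x \<in> {\<Theta> 0, \<Theta> (1 / 2)}"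
    proof (cases "even n")
      case True
      then obtain j where "n = 2 * j" by blast
      then have "z = 0 + of_int j" using n by simp
      then show ?thesis using per[of 0 j] z by simp
    next
      case False
      then obtain j where "n = 2 * j + 1" by (elim oddE)
      then have "z = 1 / 2 + of_int j" using n by (simp add: field_simps)
      then show ?thesis using per[of "1 / 2" j] z by simp
    qed
  qed
  then have "count (weights nu) 2 \<le> card {\<Theta> 0, \<Theta> (1 / 2)}"
    unfolding count_weights by (intro card_mono) auto
  also have "\<dots> \<le> 2" by (simp add: card_insert_if)
  finally have counts: "count (weights nu) 2 = 2" "count (weights nu) \<infinity> = 1" using pos sum by presburger+
  have W: "weights nu = {#2, 2, \<infinity>#}"
    by (rule weights_eqI[of "{2, \<infinity>}"]) (use V counts in auto)
  have G: "deck \<Theta> = generate AutC (translations_by \<int> \<union> {\<lambda>z. - z})"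
  proof -
    have "\<exists>j::nat. \<eta> = (- 1) ^ j" if "\<eta> \<in> rotations \<Theta>" for \<eta>
      using that R by (auto intro: exI[of _ 0] exI[of _ 1])
    then have "deck \<Theta> = generate AutC (translations_by (periods \<Theta>) \<union> {\<lambda>z. - 1 * z})"
      by (intro deck_eq_generate[OF U _ even_\<Theta>]) auto
    then show ?thesis by (simp add: P)
  qed
  have "\<alpha> * 1 \<in> periods \<Theta>" by (rule scale_period[OF U]) (simp add: P)
  then obtain n where n: "\<alpha> = of_int n" by (auto simp: P elim: Ints_cases)
  have "real_of_int \<bar>n\<bar> > 1" using \<alpha>_norm[OF U] by (simp add: n)
  then have n1: "\<bar>n\<bar> > 1" by linarith
  have "(1 - - 1) * \<beta> \<in> periods \<Theta>" by (rule rotation_shift_period[OF U even_\<Theta>]) simp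
  then obtain j where j: "2 * \<beta> = of_int j" by (auto simp: P elim: Ints_cases)
  define \<beta>' :: complex where "\<beta>' = (if even j then 0 else 1 / 2)"
  have "\<beta> - \<beta>' \<in> \<int>"
  proof (cases "even j")
    case True
    then obtain i where "j = 2 * i" by blast
    then have "\<beta> - \<beta>' = of_int i" using j True by (simp add: \<beta>'_def)
    then show ?thesis by simp
  next
    case False
    then obtain i where "j = 2 * i + 1" by (elim oddE)
    then have "\<beta> - \<beta>' = of_int i" using j False by (simp add: \<beta>'_def field_simps)
    then show ?thesis by simp
  qed
  then have "uniformizes \<Theta> \<alpha> \<beta>'" by (intro uniformizes_shift[OF U]) (simp add: P)
  moreover have "\<beta>' \<in> {0, 1 / 2}" by (simp add: \<beta>'_def)
  ultimately show ?thesis using W G n n1 by blast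
qed

lemma lattice_reflection:
  assumes U: "uniformizes \<Theta> \<alpha> \<beta>" and \<tau>: "Im \<tau> > 0" and P: "periods \<Theta> = plane_lattice \<tau>"
    and R: "rotations \<Theta> = {1, - 1}" and even_\<Theta>: "\<And>z. \<Theta> (- 1 * z) = \<Theta> z" and D: "\<And>x. nu x \<noteq> \<infinity>"
  shows "weights nu = {#2, 2, 2, 2#} \<and>
    deck \<Theta> = generate AutC (translations_by (plane_lattice \<tau>) \<union> {\<lambda>z. - z}) \<and>
    (\<exists>K. algebraic_int \<alpha> \<and> imaginary_quadratic_field K \<and> \<alpha> \<in> K) \<and> 2 * \<beta> \<in> plane_lattice \<tau>"
proof (intro conjI)
  have R2: "\<omega> ^ 2 = 1" if "\<omega> \<in> rotations \<Theta>" for \<omega> using that by (auto simp: R)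
  have vals: "nu x = \<infinity> \<or> (\<exists>n. n dvd 2 \<and> nu x = enat n)" for x
    by (rule weight_values[OF U R2])
  have V: "nu x \<in> {2}" if "nu x \<noteq> 1" for x
    using vals[of x] that D[of x] by (auto simp: one_enat_def numeral_eq_enat dest!: two_dvd_cases)
  have "count (weights nu) 2 = 4" using weights_sum[of "{2}"] V by simp
  then show "weights nu = {#2, 2, 2, 2#}" by (intro weights_eqI[of "{2}"] V) auto
  have "\<exists>j::nat. \<eta> = (- 1) ^ j" if "\<eta> \<in> rotations \<Theta>" for \<eta>
    using that R by (auto intro: exI[of _ 0] exI[of _ 1])
  then have "deck \<Theta> = generate AutC (translations_by (periods \<Theta>) \<union> {\<lambda>z. - 1 * z})"
    by (intro deck_eq_generate[OF U _ even_\<Theta>]) auto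
  then show "deck \<Theta> = generate AutC (translations_by (plane_lattice \<tau>) \<union> {\<lambda>z. - z})" by (simp add: P)
  have "1 \<in> plane_lattice \<tau>" "\<tau> \<in> plane_lattice \<tau>" using lattice_I[of 1 0 \<tau>] lattice_I[of 0 1 \<tau>] by simp_all
  then have "\<alpha> * 1 \<in> plane_lattice \<tau>" "\<alpha> * \<tau> \<in> plane_lattice \<tau>" using scale_period[OF U] P by blast+
  then show "\<exists>K. algebraic_int \<alpha> \<and> imaginary_quadratic_field K \<and> \<alpha> \<in> K"
    using lattice_multiplier_imaginary_quadratic[OF \<tau>] by simp
  have "(1 - - 1) * \<beta> \<in> periods \<Theta>" by (rule rotation_shift_period[OF U even_\<Theta>]) simp
  then show "2 * \<beta> \<in> plane_lattice \<tau>" by (simp add: P)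
qed

lemma lattice_order_3:
  assumes U: "uniformizes \<Theta> \<alpha> \<beta>" and P: "periods \<Theta> = plane_lattice \<zeta>"
    and R: "rotations \<Theta> \<subseteq> {1, \<zeta>, \<zeta>\<^sup>2}" and sym: "\<And>z. \<Theta> (\<zeta> * z) = \<Theta> z" and D: "\<And>x. nu x \<noteq> \<infinity>"
  shows "\<exists>\<beta>'. uniformizes \<Theta> \<alpha> \<beta>' \<and> weights nu = {#3, 3, 3#} \<and>
    deck \<Theta> = generate AutC (translations_by (plane_lattice \<zeta>) \<union> {\<lambda>z. \<zeta> * z}) \<and>
    \<alpha> \<in> plane_lattice \<zeta> \<and> \<beta>' \<in> {0, (\<zeta> + 2) / 3, \<i> * of_real (sqrt 3) / 3}"
proof -
  have R3: "\<omega> ^ 3 = 1" if "\<omega> \<in> rotations \<Theta>" for \<omega>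
  proof -
    have "(\<zeta>\<^sup>2) ^ 3 = (\<zeta> ^ 3)\<^sup>2" by (simp flip: power_mult)
    then show ?thesis using that R zeta_cube by auto
  qed
  have vals: "nu x = \<infinity> \<or> (\<exists>n. n dvd 3 \<and> nu x = enat n)" for x
    by (rule weight_values[OF U R3])
  have V: "nu x \<in> {3}" if "nu x \<noteq> 1" for x
    using vals[of x] that D[of x] by (auto simp: one_enat_def numeral_eq_enat dest!: three_dvd_cases)
  have "count (weights nu) 3 = 3" using weights_sum[of "{3}"] V by simp
  then have W: "weights nu = {#3, 3, 3#}" by (intro weights_eqI[of "{3}"] V) auto
  have "\<exists>j::nat. \<eta> = \<zeta> ^ j" if "\<eta> \<in> rotations \<Theta>" for \<eta>
  proof -
    have "\<eta> = \<zeta> ^ 0 \<or> \<eta> = \<zeta> ^ 1 \<or> \<eta> = \<zeta> ^ 2" using that R by auto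
    then show ?thesis by blast
  qed
  then have G: "deck \<Theta> = generate AutC (translations_by (plane_lattice \<zeta>) \<union> {\<lambda>z. \<zeta> * z})"
    unfolding P[symmetric] by (intro deck_eq_generate[OF U _ sym]) auto
  have "1 \<in> plane_lattice \<zeta>" using lattice_I[of 1 0 \<zeta>] by simp
  then have A: "\<alpha> \<in> plane_lattice \<zeta>" using scale_period[OF U, of 1] P by simp
  have "(1 - \<zeta>) * \<beta> \<in> periods \<Theta>" by (rule rotation_shift_period[OF U sym]) simp
  then obtain \<beta>' where "\<beta>' \<in> {0, (\<zeta> + 2) / 3, \<i> * of_real (sqrt 3) / 3}" "\<beta> - \<beta>' \<in> plane_lattice \<zeta>"
    using lattice_zeta_residue3 P by blast
  then show ?thesis using uniformizes_shift[OF U] W G A P by blast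
qed

text \<open>
  With \<open>x\<close> points of weight \<open>2\<close> and \<open>y\<close> of weight \<open>4\<close>, \<open>2 x + 3 y = 8\<close>; the image of the centre of the
  rotation shows \<open>y \<ge> 1\<close>.
\<close>

lemma lattice_order_4:
  assumes U: "uniformizes \<Theta> \<alpha> \<beta>" and P: "periods \<Theta> = plane_lattice \<i>"
    and R: "rotations \<Theta> \<subseteq> {1, - 1, \<i>, - \<i>}" and sym: "\<And>z. \<Theta> (\<i> * z) = \<Theta> z" and D: "\<And>x. nu x \<noteq> \<infinity>"
  shows "\<exists>\<beta>'. uniformizes \<Theta> \<alpha> \<beta>' \<and> weights nu = {#2, 4, 4#} \<and>
    deck \<Theta> = generate AutC (translations_by (plane_lattice \<i>) \<union> {\<lambda>z. \<i> * z}) \<and>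
    \<alpha> \<in> plane_lattice \<i> \<and> \<beta>' \<in> {0, (\<i> + 1) / 2}"
proof -
  have R4: "\<omega> ^ 4 = 1" if "\<omega> \<in> rotations \<Theta>" for \<omega> using that R by auto
  have vals: "nu x = \<infinity> \<or> (\<exists>n. n dvd 4 \<and> nu x = enat n)" for x
    by (rule weight_values[OF U R4])
  have V: "nu x \<in> {2, 4}" if "nu x \<noteq> 1" for x
    using vals[of x] that D[of x] by (auto simp: one_enat_def numeral_eq_enat dest!: four_dvd_cases)
  have "real (count (weights nu) 2) * (1 / 2) + real (count (weights nu) 4) * (3 / 4) = 2"
    using weights_sum[of "{2, 4}"] V by simp
  then have sum: "2 * count (weights nu) 2 + 3 * count (weights nu) 4 = 8" by linarith
  have "wt (\<Theta> 0) dvd 4" by (rule weight_dvd[OF U R4])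
  moreover have "\<i> ^ wt (\<Theta> 0) = 1" by (rule weight_at_center[OF U sym])
  ultimately have "wt (\<Theta> 0) = 4" by (auto dest!: four_dvd_cases simp: complex_eq_iff)
  then have "nu (\<Theta> 0) = 4" using wt(3)[OF b_\<Theta>[OF U]] by (simp add: numeral_eq_enat)
  then have "count (weights nu) 4 > 0" by (intro count_weights_positive) (auto simp: numeral_eq_enat one_enat_def)
  then have counts: "count (weights nu) 2 = 1" "count (weights nu) 4 = 2" using sum by presburger+
  have W: "weights nu = {#2, 4, 4#}"
    by (rule weights_eqI[of "{2, 4}"]) (use V counts in auto)
  have "\<exists>j::nat. \<eta> = \<i> ^ j" if "\<eta> \<in> rotations \<Theta>" for \<eta>
  proof -
    have "\<eta> = \<i> ^ 0 \<or> \<eta> = \<i> ^ 2 \<or> \<eta> = \<i> ^ 1 \<or> \<eta> = \<i> ^ 3" using that R by (auto simp: power3_eq_cube)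
    then show ?thesis by blast
  qed
  then have G: "deck \<Theta> = generate AutC (translations_by (plane_lattice \<i>) \<union> {\<lambda>z. \<i> * z})"
    unfolding P[symmetric] by (intro deck_eq_generate[OF U _ sym]) auto
  have "1 \<in> plane_lattice \<i>" using lattice_I[of 1 0 \<i>] by simp
  then have A: "\<alpha> \<in> plane_lattice \<i>" using scale_period[OF U, of 1] P by simp
  have "(1 - \<i>) * \<beta> \<in> periods \<Theta>" by (rule rotation_shift_period[OF U sym]) simp
  then obtain \<beta>' where "\<beta>' \<in> {0, (\<i> + 1) / 2}" "\<beta> - \<beta>' \<in> plane_lattice \<i>"
    using lattice_i_residue P by blast
  then show ?thesis using uniformizes_shift[OF U] W G A P by blast
qed

text \<open>
  With \<open>x\<close>, \<open>y\<close>, \<open>z\<close> points of weight \<open>2\<close>, \<open>3\<close>, \<open>6\<close>, \<open>3 x + 4 y + 5 z = 12\<close>; the image of the centre of the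
  rotation shows \<open>z \<ge> 1\<close>.
\<close>

lemma lattice_order_6:
  assumes U: "uniformizes \<Theta> \<alpha> \<beta>" and P: "periods \<Theta> = plane_lattice \<zeta>"
    and R: "rotations \<Theta> \<subseteq> {1, - 1, \<zeta>, \<zeta>\<^sup>2, - \<zeta>, - \<zeta>\<^sup>2}" and sym: "\<And>z. \<Theta> (- \<zeta> * z) = \<Theta> z" and D: "\<And>x. nu x \<noteq> \<infinity>"
  shows "uniformizes \<Theta> \<alpha> 0 \<and> weights nu = {#2, 3, 6#} \<and>
    deck \<Theta> = generate AutC (translations_by (plane_lattice \<zeta>) \<union> {\<lambda>z. - \<zeta> * z}) \<and>
    \<alpha> \<in> plane_lattice \<zeta>"
proof -
  have p2: "(- \<zeta>) ^ 2 = \<zeta>\<^sup>2" and p3: "(- \<zeta>) ^ 3 = - 1" using zeta_cube by simp_all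
  have "(- \<zeta>) ^ 4 = (- \<zeta>) ^ 3 * (- \<zeta>)" "(- \<zeta>) ^ 5 = (- \<zeta>) ^ 3 * (- \<zeta>) ^ 2" "(- \<zeta>) ^ 6 = (- \<zeta>) ^ 3 * (- \<zeta>) ^ 3"
    by (simp_all only: power_add[symmetric] power_Suc2[symmetric]) simp_all
  then have p: "(- \<zeta>) ^ 4 = \<zeta>" "(- \<zeta>) ^ 5 = - \<zeta>\<^sup>2" "(- \<zeta>) ^ 6 = 1" unfolding p3 p2 by simp_all
  have pows: "(- \<zeta>) ^ 0 = 1" "(- \<zeta>) ^ 1 = - \<zeta>" "(- \<zeta>) ^ 2 = \<zeta>\<^sup>2" "(- \<zeta>) ^ 3 = - 1"
    "(- \<zeta>) ^ 4 = \<zeta>" "(- \<zeta>) ^ 5 = - \<zeta>\<^sup>2" "(- \<zeta>) ^ 6 = 1"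
    by (simp, simp, rule p2, rule p3, rule p, rule p, rule p)
  have pow: "\<exists>j::nat. \<eta> = (- \<zeta>) ^ j" if "\<eta> \<in> rotations \<Theta>" for \<eta>
  proof -
    have "\<eta> \<in> {1, - 1, \<zeta>, \<zeta>\<^sup>2, - \<zeta>, - \<zeta>\<^sup>2}" using that R by blast
    then have "\<eta> = (- \<zeta>) ^ 0 \<or> \<eta> = (- \<zeta>) ^ 3 \<or> \<eta> = (- \<zeta>) ^ 4 \<or> \<eta> = (- \<zeta>) ^ 2 \<or> \<eta> = (- \<zeta>) ^ 1 \<or> \<eta> = (- \<zeta>) ^ 5"
      unfolding pows by blast
    then show ?thesis by blast
  qed
  have R6: "\<omega> ^ 6 = 1" if \<omega>: "\<omega> \<in> rotations \<Theta>" for \<omega>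
  proof -
    obtain j where "\<omega> = (- \<zeta>) ^ j" using pow[OF \<omega>] by blast
    then have "\<omega> ^ 6 = ((- \<zeta>) ^ 6) ^ j" by (metis power_mult mult.commute)
    then show ?thesis by (simp only: pows power_one)
  qed
  have vals: "nu x = \<infinity> \<or> (\<exists>n. n dvd 6 \<and> nu x = enat n)" for x
    by (rule weight_values[OF U R6])
  have V: "nu x \<in> {2, 3, 6}" if "nu x \<noteq> 1" for x
    using vals[of x] that D[of x] by (auto simp: one_enat_def numeral_eq_enat dest!: six_dvd_cases)
  have "real (count (weights nu) 2) * (1 / 2) + (real (count (weights nu) 3) * (2 / 3) + real (count (weights nu) 6) * (5 / 6)) = 2"
    using weights_sum[of "{2, 3, 6}"] V by simp
  then have sum: "3 * count (weights nu) 2 + 4 * count (weights nu) 3 + 5 * count (weights nu) 6 = 12" by linarith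
  have "wt (\<Theta> 0) dvd 6" by (rule weight_dvd[OF U R6])
  moreover have "(- \<zeta>) ^ wt (\<Theta> 0) = 1" by (rule weight_at_center[OF U sym])
  moreover have "- \<zeta> \<noteq> 1" "(- \<zeta>) ^ 2 \<noteq> 1" "(- \<zeta>) ^ 3 \<noteq> 1"
    unfolding pows by (simp_all add: complex_eq_iff power2_eq_square)
  ultimately have "wt (\<Theta> 0) = 6" by (metis six_dvd_cases power_one_right)
  then have "nu (\<Theta> 0) = 6" using wt(3)[OF b_\<Theta>[OF U]] by (simp add: numeral_eq_enat)
  then have "count (weights nu) 6 > 0" by (intro count_weights_positive) (auto simp: numeral_eq_enat one_enat_def)
  then have counts: "count (weights nu) 2 = 1" "count (weights nu) 3 = 1" "count (weights nu) 6 = 1" using sum by presburger+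
  have W: "weights nu = {#2, 3, 6#}"
    by (rule weights_eqI[of "{2, 3, 6}"]) (use V counts in auto)
  have G: "deck \<Theta> = generate AutC (translations_by (plane_lattice \<zeta>) \<union> {\<lambda>z. - \<zeta> * z})"
    unfolding P[symmetric] by (intro deck_eq_generate[OF U _ sym pow]) auto
  have "1 \<in> plane_lattice \<zeta>" using lattice_I[of 1 0 \<zeta>] by simp
  then have A: "\<alpha> \<in> plane_lattice \<zeta>" using scale_period[OF U, of 1] P by simp
  have "(1 - - \<zeta>) * \<beta> \<in> periods \<Theta>" by (rule rotation_shift_period[OF U sym]) simp
  then have "\<beta> - 0 \<in> plane_lattice \<zeta>" using lattice_zeta_residue6 P by simp
  then show ?thesis using uniformizes_shift[OF U, of 0] W G A P by simp
qed

end

section \<open>Classification\<close>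

lemma sublattice:
  assumes "x \<in> plane_lattice \<tau>"
  shows "plane_lattice x \<subseteq> plane_lattice \<tau>"
proof
  obtain a b where x: "x = of_int a + of_int b * \<tau>" using assms unfolding plane_lattice_def by blast
  fix y assume "y \<in> plane_lattice x"
  then obtain m n where "y = of_int m + of_int n * x" unfolding plane_lattice_def by blast
  then have "y = of_int (m + n * a) + of_int (n * b) * \<tau>" by (simp add: x algebra_simps)
  then show "y \<in> plane_lattice \<tau>" using lattice_I by metis
qed

lemma not_square_3: "r * r \<noteq> (3::int)"
proof
  assume r: "r * r = 3"
  have "\<bar>r\<bar> * \<bar>r\<bar> = 3" using r by (simp add: abs_mult_self_eq)
  moreover have "\<bar>r\<bar> \<le> 1 \<or> 2 \<le> \<bar>r\<bar>" by linarith
  then have "\<bar>r\<bar> * \<bar>r\<bar> \<le> 1 * 1 \<or> 2 * 2 \<le> \<bar>r\<bar> * \<bar>r\<bar>"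
    using mult_mono[of "\<bar>r\<bar>" 1 "\<bar>r\<bar>" 1] mult_mono[of 2 "\<bar>r\<bar>" 2 "\<bar>r\<bar>"] by auto
  ultimately show False by linarith
qed

lemma rescaled_image:
  assumes "w \<noteq> (0::complex)"
  shows "{l. w * l \<in> (\<lambda>l. w * l) ` A} = A"
  using assms by auto

context invariant_section
begin

text \<open>
  A rotation and its inverse \<open>cnj \<omega>\<close> both preserve the lattice, so the real number \<open>\<omega> + cnj \<omega>\<close> belongs
  to the lattice scaled to contain \<open>1\<close>.
\<close>

lemma rotation_of_lattice:
  assumes U: "uniformizes \<Theta> \<alpha> \<beta>" and w: "w \<noteq> 0" and \<tau>: "Im \<tau> > 0"
    and P: "periods \<Theta> = (\<lambda>l. w * l) ` plane_lattice \<tau>" and \<omega>: "\<omega> \<in> rotations \<Theta>"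
  shows "2 * Re \<omega> \<in> \<int>"
proof -
  have "w \<in> periods \<Theta>" using lattice_I[of 1 0 \<tau>] by (auto simp: P)
  then have "\<omega> * w \<in> periods \<Theta>" "w / \<omega> \<in> periods \<Theta>" using rotate_period[OF U \<omega>] by blast+
  then obtain l l' where l: "l \<in> plane_lattice \<tau>" "\<omega> * w = w * l" and l': "l' \<in> plane_lattice \<tau>" "w / \<omega> = w * l'"
    unfolding P by blast
  have unit: "norm \<omega> = 1" by (rule norm_rotation[OF U \<omega>])
  then have "\<omega> \<noteq> 0" by auto
  have eq: "l = \<omega>" "l' = inverse \<omega>" using l(2) l'(2) w \<open>\<omega> \<noteq> 0\<close> by (auto simp: field_simps)
  have "inverse \<omega> = cnj \<omega>" 
  proof (rule inverse_unique)
    show "\<omega> * cnj \<omega> = 1" using unit by (simp add: complex_mult_cnj cmod_def complex_eq_iff)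
  qed
  then obtain m n m' n' where mn: "\<omega> = of_int m + of_int n * \<tau>" "cnj \<omega> = of_int m' + of_int n' * \<tau>"
    using l(1) l'(1) unfolding eq plane_lattice_def by auto
  have Im_eq: "Im \<omega> = of_int n * Im \<tau>" "- Im \<omega> = of_int n' * Im \<tau>"
    using arg_cong[OF mn(1), of Im] arg_cong[OF mn(2), of Im] by simp_all
  then have "of_int (n + n') * Im \<tau> = 0" by (simp add: distrib_right)
  then have "real_of_int (n + n') = 0" using \<tau> by simp
  then have "n' = - n" by linarith
  then have "2 * Re \<omega> = of_int (m + m')"
    using arg_cong[OF mn(1), of Re] arg_cong[OF mn(2), of Re] by (simp add: mult.commute)
  then show ?thesis by (metis Ints_of_int)
qed

lemma classification:
  "\<exists>\<Gamma> L. induced_by f nu \<Gamma> L \<and>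
     ((weights nu = {#\<infinity>, \<infinity>#} \<and>
       \<Gamma> = generate AutC (translations_by \<int>) \<and>
       (\<exists>n::int. \<bar>n\<bar> > 1 \<and> L = (\<lambda>z. of_int n * z)))
    \<or> (weights nu = {#2, 2, \<infinity>#} \<and>
       \<Gamma> = generate AutC (translations_by \<int> \<union> {\<lambda>z. - z}) \<and>
       (\<exists>(n::int) \<beta>. \<bar>n\<bar> > 1 \<and> \<beta> \<in> {0, 1 / 2} \<and> L = (\<lambda>z. of_int n * z + \<beta>)))
    \<or> (weights nu = {#2, 2, 2, 2#} \<and>
       (\<exists>\<tau>. Im \<tau> > 0 \<and>
          \<Gamma> = generate AutC (translations_by (plane_lattice \<tau>) \<union> {\<lambda>z. - z}) \<and>
          (\<exists>\<alpha> \<beta> K. algebraic_int \<alpha> \<and> imaginary_quadratic_field K \<and> \<alpha> \<in> K \<and>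
             2 * \<beta> \<in> plane_lattice \<tau> \<and> L = (\<lambda>z. \<alpha> * z + \<beta>))))
    \<or> (weights nu = {#3, 3, 3#} \<and>
       \<Gamma> = generate AutC (translations_by (plane_lattice \<zeta>) \<union> {\<lambda>z. \<zeta> * z}) \<and>
       (\<exists>\<alpha> \<beta>. \<alpha> \<in> plane_lattice \<zeta> \<and> \<beta> \<in> {0, (\<zeta> + 2) / 3, \<i> * of_real (sqrt 3) / 3} \<and>
          L = (\<lambda>z. \<alpha> * z + \<beta>)))
    \<or> (weights nu = {#2, 4, 4#} \<and>
       \<Gamma> = generate AutC (translations_by (plane_lattice \<i>) \<union> {\<lambda>z. \<i> * z}) \<and>
       (\<exists>\<alpha> \<beta>. \<alpha> \<in> plane_lattice \<i> \<and> \<beta> \<in> {0, (\<i> + 1) / 2} \<and> L = (\<lambda>z. \<alpha> * z + \<beta>)))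
    \<or> (weights nu = {#2, 3, 6#} \<and>
       \<Gamma> = generate AutC (translations_by (plane_lattice \<zeta>) \<union> {\<lambda>z. - \<zeta> * z}) \<and>
       (\<exists>\<alpha>. \<alpha> \<in> plane_lattice \<zeta> \<and> L = (\<lambda>z. \<alpha> * z))))"
  (is "\<exists>\<Gamma> L. _ \<and> (?C1 \<Gamma> L \<or> ?C2 \<Gamma> L \<or> ?C3 \<Gamma> L \<or> ?C4 \<Gamma> L \<or> ?C5 \<Gamma> L \<or> ?C6 \<Gamma> L)")
proof -
  have conclude: ?thesis if "induced_by f nu \<Gamma> L"
    "?C1 \<Gamma> L \<or> ?C2 \<Gamma> L \<or> ?C3 \<Gamma> L \<or> ?C4 \<Gamma> L \<or> ?C5 \<Gamma> L \<or> ?C6 \<Gamma> L" for \<Gamma> L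
    by (rule exI[of _ \<Gamma>], rule exI[of _ L], rule conjI, rule that(1), rule that(2))
  obtain \<Theta>\<^sub>0 \<alpha> where "\<And>z. flat_at 1 \<Theta>\<^sub>0 z" "\<And>z. f (\<Theta>\<^sub>0 z) = \<Theta>\<^sub>0 (\<alpha> * z)" "norm \<alpha> > 1"
    using exists_uniformization by blast
  then have "(\<exists>C. C \<noteq> 0 \<and> (\<forall>z. flat_at C \<Theta>\<^sub>0 z)) \<and> (\<forall>z. f (\<Theta>\<^sub>0 z) = \<Theta>\<^sub>0 (\<alpha> * z + 0)) \<and> norm \<alpha> > 1"
    by (intro conjI exI[of _ 1]) auto
  then have U0: "uniformizes \<Theta>\<^sub>0 \<alpha> 0" unfolding uniformizes_def .
  obtain e where e: "e > 0" "\<And>t. t \<in> periods \<Theta>\<^sub>0 \<Longrightarrow> norm t < e \<Longrightarrow> t = 0"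
    using periods_discrete[OF U0] by blast
  show ?thesis
  proof (rule discrete_subgroup_cases[OF zero_period[OF U0] diff_period[OF U0] e])
    assume "periods \<Theta>\<^sub>0 = {0}"
    then show ?thesis using periods_nontrivial[OF U0] by blast
  next
    fix w assume w: "w \<noteq> 0" and P0: "periods \<Theta>\<^sub>0 = (\<lambda>l. w * l) ` \<int>"
    have R: "\<omega> = 1 \<or> \<omega> = - 1" if \<omega>: "\<omega> \<in> rotations \<Theta>\<^sub>0" for \<omega>
    proof -
      have "w \<in> periods \<Theta>\<^sub>0" unfolding P0 by (rule image_eqI[of _ _ 1]) auto
      then have "\<omega> * w \<in> (\<lambda>l. w * l) ` \<int>" using rotate_period(1)[OF U0 \<omega>] P0 by blast
      then obtain n where n: "\<omega> = of_int n" using w by (auto elim!: Ints_cases)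
      have "norm \<omega> = 1" by (rule norm_rotation[OF U0 \<omega>])
      then have "real_of_int \<bar>n\<bar> = 1" by (simp add: n)
      then have "n = 1 \<or> n = - 1" by linarith
      then show ?thesis using n by auto
    qed
    show ?thesis
    proof (cases "- 1 \<in> rotations \<Theta>\<^sub>0")
      case True
      obtain \<Theta> \<beta> where U: "uniformizes \<Theta> \<alpha> \<beta>" and sym: "\<And>z. \<Theta> (- 1 * z) = \<Theta> z"
        and P: "periods \<Theta> = {l. w * l \<in> periods \<Theta>\<^sub>0}" and R': "rotations \<Theta> = rotations \<Theta>\<^sub>0"
        using center_rotation[OF U0 w True] by auto
      have "periods \<Theta> = \<int>" unfolding P P0 by (rule rescaled_image[OF w])
      moreover have "rotations \<Theta> = {1, - 1}" unfolding R' using R True one_rotation by auto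
      ultimately obtain \<beta>' where U': "uniformizes \<Theta> \<alpha> \<beta>'" and C: "?C2 (deck \<Theta>) (\<lambda>z. \<alpha> * z + \<beta>')"
        using rank_one_reflection[OF U _ _ sym] by blast
      show ?thesis by (rule conclude[OF induced_by_deck[OF U']], rule disjI2, rule disjI1, rule C)
    next
      case False
      define \<Theta> where "\<Theta> z = \<Theta>\<^sub>0 (w * z + 0)" for z
      have U: "uniformizes \<Theta> \<alpha> 0" using uniformizes_affine[OF U0 w, of 0] by (simp add: \<Theta>_def[abs_def])
      have "periods \<Theta> = \<int>" unfolding \<Theta>_def[abs_def] periods_rescale[OF w] P0 by (rule rescaled_image[OF w])
      moreover have "rotations \<Theta> = {1}"
        unfolding \<Theta>_def[abs_def] rotations_rescale[OF w] using R False one_rotation by auto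
      ultimately have C: "?C1 (deck \<Theta>) (\<lambda>z. \<alpha> * z + 0)" by (rule rank_one_translations[OF U])
      show ?thesis by (rule conclude[OF induced_by_deck[OF U]], rule disjI1, rule C)
    qed
  next
    fix w \<tau> assume w: "w \<noteq> 0" and \<tau>: "Im \<tau> > 0" and P0: "periods \<Theta>\<^sub>0 = (\<lambda>l. w * l) ` plane_lattice \<tau>"
      and min: "\<And>t. t \<in> periods \<Theta>\<^sub>0 \<Longrightarrow> t \<noteq> 0 \<Longrightarrow> norm w \<le> norm t"
    have D: "nu x \<noteq> \<infinity>" for x using lattice_periods_surjective[OF U0 w \<tau> P0, of x] by (simp add: nu_def)
    have min': "norm t \<ge> 1" if "t \<in> plane_lattice \<tau>" "t \<noteq> 0" for t
      using min[of "w * t"] that w by (simp add: P0 norm_mult)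
    have Rint: "2 * Re \<omega> \<in> \<int>" if "\<omega> \<in> rotations \<Theta>\<^sub>0" for \<omega>
      by (rule rotation_of_lattice[OF U0 w \<tau> P0 that])
    have Rcases: "\<omega> \<in> {1, - 1} \<or> \<omega> \<in> {\<i>, - \<i>} \<or> \<omega> \<in> {\<zeta>, \<zeta>\<^sup>2} \<or> \<omega> \<in> {- \<zeta>, - \<zeta>\<^sup>2}"
      if "\<omega> \<in> rotations \<Theta>\<^sub>0" for \<omega>
      by (rule unit_rotation_cases[OF norm_rotation[OF U0 that] Rint[OF that]])
    have center: "\<exists>\<Theta> \<beta>. uniformizes \<Theta> \<alpha> \<beta> \<and> (\<forall>z. \<Theta> (\<omega> * z) = \<Theta> z) \<and> periods \<Theta> = plane_lattice \<tau> \<and>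
        rotations \<Theta> = rotations \<Theta>\<^sub>0 \<and> plane_lattice \<omega> \<subseteq> plane_lattice \<tau>"
      if \<omega>: "\<omega> \<in> rotations \<Theta>\<^sub>0" "\<omega> \<noteq> 1" for \<omega>
    proof -
      obtain \<Theta> \<beta> where U: "uniformizes \<Theta> \<alpha> \<beta>" and sym: "\<And>z. \<Theta> (\<omega> * z) = \<Theta> z"
        and P: "periods \<Theta> = {l. w * l \<in> periods \<Theta>\<^sub>0}" and R': "rotations \<Theta> = rotations \<Theta>\<^sub>0"
        using center_rotation[OF U0 w \<omega>] by blast
      have P': "periods \<Theta> = plane_lattice \<tau>" unfolding P P0 by (rule rescaled_image[OF w])
      have "1 \<in> periods \<Theta>" unfolding P' using lattice_I[of 1 0 \<tau>] by simp
      then have "\<omega> * 1 \<in> periods \<Theta>" using \<omega>(1) R' by (intro rotate_period(1)[OF U]) simp_all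
      then have "plane_lattice \<omega> \<subseteq> plane_lattice \<tau>" by (intro sublattice) (simp add: P')
      then show ?thesis using U sym P' R' by blast
    qed
    have diff: "s - t \<in> plane_lattice \<tau>" if "s \<in> plane_lattice \<tau>" "t \<in> plane_lattice \<tau>" for s t
    proof -
      have "w * s - w * t \<in> periods \<Theta>\<^sub>0" by (intro diff_period[OF U0]) (use that P0 in auto)
      then show ?thesis using w by (auto simp: P0 simp flip: right_diff_distrib)
    qed
    have pow2: "\<omega>\<^sup>2 \<in> rotations \<Theta>\<^sub>0" if "\<omega> \<in> rotations \<Theta>\<^sub>0" for \<omega>
      using mult_rotation[OF that that] by (simp add: power2_eq_square)
    have \<zeta>4: "(\<zeta>\<^sup>2)\<^sup>2 = \<zeta>" using zeta_cube by (simp add: power2_eq_square power3_eq_cube mult.assoc)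
    have \<zeta>6: "\<zeta>\<^sup>2 * \<zeta>\<^sup>2 * \<zeta>\<^sup>2 = 1"
    proof -
      have "\<zeta>\<^sup>2 * \<zeta>\<^sup>2 * \<zeta>\<^sup>2 = (\<zeta> ^ 3)\<^sup>2" by (simp add: power2_eq_square power3_eq_cube mult_ac)
      then show ?thesis by (simp add: zeta_cube)
    qed
    define quarter_turn where "quarter_turn \<longleftrightarrow> (\<exists>\<omega>\<in>rotations \<Theta>\<^sub>0. \<omega> \<in> {\<i>, - \<i>})"
    define third_turn where
      "third_turn \<longleftrightarrow> (\<exists>\<omega>\<in>rotations \<Theta>\<^sub>0. \<omega> \<in> {\<zeta>, \<zeta>\<^sup>2, - \<zeta>, - \<zeta>\<^sup>2})"
    have no_quarter: "\<omega> \<in> {1, - 1, \<zeta>, \<zeta>\<^sup>2, - \<zeta>, - \<zeta>\<^sup>2}" if "\<not> quarter_turn" "\<omega> \<in> rotations \<Theta>\<^sub>0" for \<omega>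
    proof -
      have "\<omega> \<notin> {\<i>, - \<i>}" using that unfolding quarter_turn_def by blast
      then show ?thesis using Rcases[OF that(2)] by blast
    qed
    have half_turns: "rotations \<Theta>\<^sub>0 \<subseteq> {1, - 1}" if "\<not> quarter_turn" "\<not> third_turn"
    proof
      fix \<omega> assume \<omega>: "\<omega> \<in> rotations \<Theta>\<^sub>0"
      then have "\<omega> \<notin> {\<zeta>, \<zeta>\<^sup>2, - \<zeta>, - \<zeta>\<^sup>2}" using that(2) unfolding third_turn_def by blast
      then show "\<omega> \<in> {1, - 1}" using no_quarter[OF that(1) \<omega>] by blast
    qed
    consider (four) "quarter_turn"
      | (six) "\<not> quarter_turn" "third_turn" "- 1 \<in> rotations \<Theta>\<^sub>0"
      | (three) "\<not> quarter_turn" "third_turn" "- 1 \<notin> rotations \<Theta>\<^sub>0"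
      | (two) "rotations \<Theta>\<^sub>0 \<subseteq> {1, - 1}"
      using half_turns by argo
    then show ?thesis
    proof cases
      case four
      have i_rot: "\<i> \<in> rotations \<Theta>\<^sub>0"
      proof -
        obtain \<omega> where \<omega>: "\<omega> \<in> rotations \<Theta>\<^sub>0" "\<omega> = \<i> \<or> \<omega> = - \<i>" using four unfolding quarter_turn_def by blast
        have "\<omega>\<^sup>2 * \<omega> \<in> rotations \<Theta>\<^sub>0" by (rule mult_rotation[OF pow2[OF \<omega>(1)] \<omega>(1)])
        then show ?thesis using \<omega> by auto
      qed
      have R: "rotations \<Theta>\<^sub>0 \<subseteq> {1, - 1, \<i>, - \<i>}"
      proof
        fix \<omega> assume \<omega>: "\<omega> \<in> rotations \<Theta>\<^sub>0"
        \<comment> \<open>A rotation by a multiple of \<open>pi/3\<close> other than \<open>\<plusminus> 1\<close> would give \<open>2 Re (\<i> \<omega>) = \<plusminus> sqrt 3\<close>.\<close>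
        obtain r :: int where r: "2 * Re (\<i> * \<omega>) = of_int r"
          by (rule Ints_cases[OF Rint[OF mult_rotation[OF i_rot \<omega>]]])
        then have "of_int (r * r) = 4 * (Im \<omega>)\<^sup>2" by (simp add: power2_eq_square flip: r)
        moreover have "of_int (r * r) \<noteq> (3::real)" using not_square_3[of r] by (metis of_int_eq_iff of_int_numeral)
        ultimately have "(Im \<omega>)\<^sup>2 \<noteq> 3 / 4" by auto
        then have "\<omega> \<notin> {\<zeta>, \<zeta>\<^sup>2, - \<zeta>, - \<zeta>\<^sup>2}"
          by (auto simp: power_divide power2_eq_square[of \<zeta>] zeta_sq)
        then show "\<omega> \<in> {1, - 1, \<i>, - \<i>}" using Rcases[OF \<omega>] by blast
      qed
      have "\<i> \<noteq> 1" by (simp add: complex_eq_iff)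
      then obtain \<Theta> \<beta> where U: "uniformizes \<Theta> \<alpha> \<beta>" and sym: "\<And>z. \<Theta> (\<i> * z) = \<Theta> z"
        and P: "periods \<Theta> = plane_lattice \<tau>" "rotations \<Theta> = rotations \<Theta>\<^sub>0" "plane_lattice \<i> \<subseteq> plane_lattice \<tau>"
        using center[OF i_rot] by blast
      have "plane_lattice \<tau> = plane_lattice \<i>" by (rule lattice_i_eq[OF diff P(3) min'])
      then obtain \<beta>' where U': "uniformizes \<Theta> \<alpha> \<beta>'" and C: "?C5 (deck \<Theta>) (\<lambda>z. \<alpha> * z + \<beta>')"
        using lattice_order_4[OF U _ _ sym D] P R by blast
      show ?thesis by (rule conclude[OF induced_by_deck[OF U']], rule disjI2, rule disjI2, rule disjI2, rule disjI2, rule disjI1, rule C)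
    next
      case six
      obtain \<omega> where \<omega>: "\<omega> \<in> rotations \<Theta>\<^sub>0" "\<omega> \<in> {\<zeta>, \<zeta>\<^sup>2, - \<zeta>, - \<zeta>\<^sup>2}" using six(2) unfolding third_turn_def by blast
      have "- 1 * \<omega> \<in> rotations \<Theta>\<^sub>0" by (rule mult_rotation[OF six(3) \<omega>(1)])
      then have "\<zeta> \<in> rotations \<Theta>\<^sub>0 \<or> \<zeta>\<^sup>2 \<in> rotations \<Theta>\<^sub>0" using \<omega> by auto
      then have "\<zeta> \<in> rotations \<Theta>\<^sub>0" using pow2[of "\<zeta>\<^sup>2"] \<zeta>4 by auto
      from mult_rotation[OF six(3) this] have rot: "- \<zeta> \<in> rotations \<Theta>\<^sub>0" by simp
      have R: "rotations \<Theta>\<^sub>0 \<subseteq> {1, - 1, \<zeta>, \<zeta>\<^sup>2, - \<zeta>, - \<zeta>\<^sup>2}" using no_quarter[OF six(1)] by (rule subsetI)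
      have "- \<zeta> \<noteq> 1" by (simp add: complex_eq_iff)
      then obtain \<Theta> \<beta> where U: "uniformizes \<Theta> \<alpha> \<beta>" and sym: "\<And>z. \<Theta> (- \<zeta> * z) = \<Theta> z"
        and P: "periods \<Theta> = plane_lattice \<tau>" "rotations \<Theta> = rotations \<Theta>\<^sub>0" "plane_lattice (- \<zeta>) \<subseteq> plane_lattice \<tau>"
        using center[OF rot] by blast
      have "\<zeta> \<in> plane_lattice (- \<zeta>)" using lattice_I[of 0 "- 1" "- \<zeta>"] by simp
      then have "plane_lattice \<zeta> \<subseteq> plane_lattice \<tau>" using sublattice P(3) by blast
      then have "plane_lattice \<tau> = plane_lattice \<zeta>" by (intro lattice_zeta_eq diff min')
      then have *: "uniformizes \<Theta> \<alpha> 0 \<and> weights nu = {#2, 3, 6#} \<and>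
          deck \<Theta> = generate AutC (translations_by (plane_lattice \<zeta>) \<union> {\<lambda>z. - \<zeta> * z}) \<and> \<alpha> \<in> plane_lattice \<zeta>"
        by (intro lattice_order_6[OF U _ _ sym D]) (simp_all add: P R)
      then have C: "?C6 (deck \<Theta>) (\<lambda>z. \<alpha> * z)" by blast
      have I: "induced_by f nu (deck \<Theta>) (\<lambda>z. \<alpha> * z)" using induced_by_deck[of \<Theta> \<alpha> 0] * by simp
      show ?thesis by (rule conclude[OF I], rule disjI2, rule disjI2, rule disjI2, rule disjI2, rule disjI2, rule C)
    next
      case three
      have no: "- \<zeta> \<notin> rotations \<Theta>\<^sub>0" "- \<zeta>\<^sup>2 \<notin> rotations \<Theta>\<^sub>0"
      proof -
        have cube: "\<omega>\<^sup>2 * \<omega> \<in> rotations \<Theta>\<^sub>0" if "\<omega> \<in> rotations \<Theta>\<^sub>0" for \<omega>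
          by (rule mult_rotation[OF pow2[OF that] that])
        have "(- \<zeta>)\<^sup>2 * (- \<zeta>) = - 1" using zeta_cube by (simp add: power2_eq_square power3_eq_cube)
        then show "- \<zeta> \<notin> rotations \<Theta>\<^sub>0" using cube[of "- \<zeta>"] three(3) by auto
        have "(- \<zeta>\<^sup>2)\<^sup>2 * (- \<zeta>\<^sup>2) = - 1" using \<zeta>6 by (simp add: power2_eq_square)
        then show "- \<zeta>\<^sup>2 \<notin> rotations \<Theta>\<^sub>0" using cube[of "- \<zeta>\<^sup>2"] three(3) by auto
      qed
      then have "\<zeta> \<in> rotations \<Theta>\<^sub>0 \<or> \<zeta>\<^sup>2 \<in> rotations \<Theta>\<^sub>0" using three(2) unfolding third_turn_def by auto
      then have rot: "\<zeta> \<in> rotations \<Theta>\<^sub>0" using pow2[of "\<zeta>\<^sup>2"] \<zeta>4 by auto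
      have R: "rotations \<Theta>\<^sub>0 \<subseteq> {1, \<zeta>, \<zeta>\<^sup>2}"
      proof
        fix \<omega> assume \<omega>: "\<omega> \<in> rotations \<Theta>\<^sub>0"
        then have "\<omega> \<noteq> - 1" "\<omega> \<noteq> - \<zeta>" "\<omega> \<noteq> - \<zeta>\<^sup>2" using three(3) no by auto
        then show "\<omega> \<in> {1, \<zeta>, \<zeta>\<^sup>2}" using no_quarter[OF three(1) \<omega>] by blast
      qed
      have "\<zeta> \<noteq> 1" by (simp add: complex_eq_iff)
      then obtain \<Theta> \<beta> where U: "uniformizes \<Theta> \<alpha> \<beta>" and sym: "\<And>z. \<Theta> (\<zeta> * z) = \<Theta> z"
        and P: "periods \<Theta> = plane_lattice \<tau>" "rotations \<Theta> = rotations \<Theta>\<^sub>0" "plane_lattice \<zeta> \<subseteq> plane_lattice \<tau>"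
        using center[OF rot] by blast
      have "plane_lattice \<tau> = plane_lattice \<zeta>" by (rule lattice_zeta_eq[OF diff P(3) min'])
      then obtain \<beta>' where U': "uniformizes \<Theta> \<alpha> \<beta>'" and C: "?C4 (deck \<Theta>) (\<lambda>z. \<alpha> * z + \<beta>')"
        using lattice_order_3[OF U _ _ sym D] P R by blast
      show ?thesis by (rule conclude[OF induced_by_deck[OF U']], rule disjI2, rule disjI2, rule disjI2, rule disjI1, rule C)
    next
      case two
      show ?thesis
      proof (cases "- 1 \<in> rotations \<Theta>\<^sub>0")
        case True
        have "- 1 \<noteq> (1::complex)" by simp
        then obtain \<Theta> \<beta> where U: "uniformizes \<Theta> \<alpha> \<beta>" and sym: "\<And>z. \<Theta> (- 1 * z) = \<Theta> z"
          and P: "periods \<Theta> = plane_lattice \<tau>" "rotations \<Theta> = rotations \<Theta>\<^sub>0"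
          using center[OF True] by blast
        have R: "rotations \<Theta> = {1, - 1}" unfolding P(2) using two True one_rotation by blast
        have C: "?C3 (deck \<Theta>) (\<lambda>z. \<alpha> * z + \<beta>)"
          using lattice_reflection[OF U \<tau> P(1) R sym D] \<tau> by blast
        show ?thesis by (rule conclude[OF induced_by_deck[OF U]], rule disjI2, rule disjI2, rule disjI1, rule C)
      next
        case False
        then have R: "\<omega> ^ 1 = 1" if "\<omega> \<in> rotations \<Theta>\<^sub>0" for \<omega> using two that by auto
        have "nu x = 1" for x using weight_values[OF U0 R, of x] D[of x] by (auto simp: one_enat_def)
        then have False using weights_sum[of "{}"] by simp
        then show ?thesis ..
      qed
    qed
  qed
qed

end

lemma rat_map_identity: "rat_map [:0, 1:] [:1, 0:] = id"
proof
  fix x show "rat_map [:0, 1:] [:1, 0:] x = id x" by (cases x) (simp_all add: rat_map_def)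
qed

lemma identity_in_PGL2: "id \<in> PGL2"
proof -
  have "rat_map [:0, 1:] [:1, 0:] \<in> PGL2"
    unfolding PGL2_def by (intro CollectI exI[of _ 1] exI[of _ 0] conjI refl) simp_all
  then show ?thesis by (simp only: rat_map_identity)
qed

theorem theorem4p6:
  fixes f :: "P1 \<Rightarrow> P1" and d k :: nat and c :: complex and q :: "complex \<Rightarrow> complex"
  assumes "rational_map_of_degree f d" and "d > 1"
    and "k \<ge> 1" and "c \<noteq> 0"
    and "meromorphic_section k q" and "\<not> section_eq q (\<lambda>_. 0)"
    and "section_eq (pullback k f q) (\<lambda>z. c * q z)"
  shows "\<exists>M \<in> PGL2. \<exists>g \<nu> \<Gamma> L.
     g = M \<circ> f \<circ> inv_into UNIV M \<and> preserves_orbifold g \<nu> \<and> induced_by g \<nu> \<Gamma> L \<and>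
     ((weights \<nu> = {#\<infinity>, \<infinity>#} \<and>
       \<Gamma> = generate AutC (translations_by \<int>) \<and>
       (\<exists>n::int. \<bar>n\<bar> > 1 \<and> L = (\<lambda>z. of_int n * z)))
    \<or> (weights \<nu> = {#2, 2, \<infinity>#} \<and>
       \<Gamma> = generate AutC (translations_by \<int> \<union> {\<lambda>z. - z}) \<and>
       (\<exists>(n::int) \<beta>. \<bar>n\<bar> > 1 \<and> \<beta> \<in> {0, 1 / 2} \<and> L = (\<lambda>z. of_int n * z + \<beta>)))
    \<or> (weights \<nu> = {#2, 2, 2, 2#} \<and>
       (\<exists>\<tau>. Im \<tau> > 0 \<and>
          \<Gamma> = generate AutC (translations_by (plane_lattice \<tau>) \<union> {\<lambda>z. - z}) \<and>
          (\<exists>\<alpha> \<beta> K. algebraic_int \<alpha> \<and> imaginary_quadratic_field K \<and> \<alpha> \<in> K \<and>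
             2 * \<beta> \<in> plane_lattice \<tau> \<and> L = (\<lambda>z. \<alpha> * z + \<beta>))))
    \<or> (weights \<nu> = {#3, 3, 3#} \<and>
       \<Gamma> = generate AutC (translations_by (plane_lattice \<zeta>) \<union> {\<lambda>z. \<zeta> * z}) \<and>
       (\<exists>\<alpha> \<beta>. \<alpha> \<in> plane_lattice \<zeta> \<and> \<beta> \<in> {0, (\<zeta> + 2) / 3, \<i> * of_real (sqrt 3) / 3} \<and>
          L = (\<lambda>z. \<alpha> * z + \<beta>)))
    \<or> (weights \<nu> = {#2, 4, 4#} \<and>
       \<Gamma> = generate AutC (translations_by (plane_lattice \<i>) \<union> {\<lambda>z. \<i> * z}) \<and>
       (\<exists>\<alpha> \<beta>. \<alpha> \<in> plane_lattice \<i> \<and> \<beta> \<in> {0, (\<i> + 1) / 2} \<and> L = (\<lambda>z. \<alpha> * z + \<beta>)))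
    \<or> (weights \<nu> = {#2, 3, 6#} \<and>
       \<Gamma> = generate AutC (translations_by (plane_lattice \<zeta>) \<union> {\<lambda>z. - \<zeta> * z}) \<and>
       (\<exists>\<alpha>. \<alpha> \<in> plane_lattice \<zeta> \<and> L = (\<lambda>z. \<alpha> * z))))"
proof -
  obtain p r where "coprime p r" "d = max (degree p) (degree r)" "f = rat_map p r"
    using assms(1) unfolding rational_map_of_degree_def by blast
  then interpret invariant_section p r d f k c q
    by unfold_locales (use assms in auto)
  have f_id: "f = id \<circ> f \<circ> inv_into UNIV id" by simp
  show ?thesis using classification
    by (elim exE conjE, intro bexI[OF _ identity_in_PGL2] exI conjI)
       (rule f_id, rule preserves_orbifold_nu, assumption+)
qed

end
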